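(* Let $\alpha\in(1,2)$ and suppose $T\ge T_2>T_1\ge M(\lambda_1)$, where $\lambda_1$ is the smallest eigenvalue of $-\Delta$ on $\Omega$ with homogeneous Dirichlet boundary condition and $M(\lambda_1)$ is the constant described in the context. Then for any $g_1,g_2\in\dot H^2(\Omega)$ there exist $a,b\in L^2(\Omega)$ such that the solution $u$ of $$\partial_t^\alpha u-\Delta u=0\ \text{in }\Omega\times(0,T],\qquad u=0\ \text{on }\partial\Omega,\qquad u(0)=a,\ \ \partial_tu(0)=b$$ satisfies $u(T_1)=g_1$ and $u(T_2)=g_2$. Moreover, there are positive constants $c_1,c_2$, depending only on $T_1$, $T_2$ and $\alpha$, such that $$c_1\big(\|g_1\|_{\dot H^2(\Omega)}+\|g_2\|_{\dot H^2(\Omega)}\big)\le \|a\|_{L^2(\Omega)}+\|b\|_{L^2(\Omega)}\le c_2\big(\|g_1\|_{\dot H^2(\Omega)}+\|g_2\|_{\dot H^2(\Omega)}\big).$$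
   Context: $\Omega\subset\mathbb R^d$ ($d=1,2,3$) is a convex polyhedral domain and $T>0$. $\{(\lambda_j,\varphi_j)\}_{j\ge1}$ are the eigenvalues (nondecreasing) and $L^2(\Omega)$-orthonormal eigenfunctions of $-\Delta$ with homogeneous Dirichlet boundary condition; $\|v\|_{\dot H^q(\Omega)}^2=\sum_j\lambda_j^q(v,\varphi_j)^2$, and $\dot H^q(\Omega)$ is the corresponding Hilbert space ($\dot H^0=L^2$, $\dot H^2=H^2\cap H_0^1$). $\partial_t^\alpha$ is the Caputo derivative of order $\alpha\in(1,2)$: $\partial_t^\alpha u(t)=\frac1{\Gamma(2-\alpha)}\int_0^t(t-s)^{1-\alpha}u''(s)\,ds$. The Mittag-Leffler function is $E_{\alpha,\beta}(z)=\sum_{k\ge0}z^k/\Gamma(k\alpha+\beta)$. The solution of the homogeneous problem with initial data $a,b\in L^2(\Omega)$ is $$u(t)=F(t)a+\bar F(t)b,\quad F(t)v=\sum_jE_{\alpha,1}(-\lambda_jt^\alpha)(v,\varphi_j)\varphi_j,\quad \bar F(t)v=\sum_jtE_{\alpha,2}(-\lambda_jt^\alpha)(v,\varphi_j)\varphi_j.$$ Define $\psi(T_1,T_2;\lambda)=T_2E_{\alpha,1}(-\lambda T_1^\alpha)E_{\alpha,2}(-\lambda T_2^\alpha)-T_1E_{\alpha,1}(-\lambda T_2^\alpha)E_{\alpha,2}(-\lambda T_1^\alpha)$. There are a constant $c_*>0$ depending only on $\alpha$ and, for each $\lambda>0$, a constant $M(\lambda)>0$ such that for all $T_2>T_1\ge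 M(\lambda)$: $\psi(T_1,T_2;\lambda)\le \frac{c_*(T_2-T_1)}{\Gamma(1-\alpha)\Gamma(2-\alpha)}\frac1{\lambda^2T_1^\alpha T_2^\alpha}<0$. $M(\lambda_1)$ is this constant for $\lambda=\lambda_1$. *)

theory Defs
  imports "HOL-Analysis.Analysis"
begin

section \<open>Square-integrable functions on a domain\<close>

text \<open>Elements of \<open>L\<^sup>2(\<Omega>)\<close> are represented by functions; equality of elements is equality almost
  everywhere on \<open>\<Omega>\<close>. The codomain is Euclidean so that the same definitions serve scalar functions
  and gradients.\<close>

definition L2 :: "'a::euclidean_space set \<Rightarrow> ('a \<Rightarrow> 'b::euclidean_space) set" where
  "L2 \<Omega> = {f \<in> borel_measurable (lebesgue_on \<Omega>).
             integrable (lebesgue_on \<Omega>) (\<lambda>x. (norm (f x))\<^sup>2)}"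

definition l2_inner ::
  "'a::euclidean_space set \<Rightarrow> ('a \<Rightarrow> 'b::euclidean_space) \<Rightarrow> ('a \<Rightarrow> 'b) \<Rightarrow> real" where
  "l2_inner \<Omega> f g = (LINT x|lebesgue_on \<Omega>. f x \<bullet> g x)"

definition l2_norm :: "'a::euclidean_space set \<Rightarrow> ('a \<Rightarrow> 'b::euclidean_space) \<Rightarrow> real" where
  "l2_norm \<Omega> f = sqrt (LINT x|lebesgue_on \<Omega>. (norm (f x))\<^sup>2)"

definition l2_tendsto ::
  "'a::euclidean_space set \<Rightarrow> (nat \<Rightarrow> 'a \<Rightarrow> 'b::euclidean_space) \<Rightarrow> ('a \<Rightarrow> 'b) \<Rightarrow> bool" where
  "l2_tendsto \<Omega> f w \<longleftrightarrow>
     (\<forall>n. f n \<in> L2 \<Omega>) \<and> w \<in> L2 \<Omega> \<and> (\<lambda>n. l2_norm \<Omega> (\<lambda>x. f n x - w x)) \<longlonglongrightarrow> 0"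

definition l2_sums ::
  "'a::euclidean_space set \<Rightarrow> (nat \<Rightarrow> 'a \<Rightarrow> real) \<Rightarrow> ('a \<Rightarrow> real) \<Rightarrow> bool" where
  "l2_sums \<Omega> f w \<longleftrightarrow> l2_tendsto \<Omega> (\<lambda>n x. \<Sum>j<n. f j x) w"

text \<open>A representative of the \<open>L\<^sup>2\<close> sum; the choice only matters on a null set.\<close>

definition l2_suminf :: "'a::euclidean_space set \<Rightarrow> (nat \<Rightarrow> 'a \<Rightarrow> real) \<Rightarrow> 'a \<Rightarrow> real" where
  "l2_suminf \<Omega> f = (SOME w. l2_sums \<Omega> f w)"


section \<open>Dirichlet eigenpairs of the negative Laplacian\<close>

definition convex_polyhedral_domain :: "'a::euclidean_space set \<Rightarrow> bool" where
  "convex_polyhedral_domain \<Omega> \<longleftrightarrow>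
     open \<Omega> \<and> \<Omega> \<noteq> {} \<and> convex \<Omega> \<and> polytope (closure \<Omega>)"

text \<open>\<open>C\<^sup>\<infinity>\<close>: everywhere differentiable, with all partial derivatives again \<open>C\<^sup>\<infinity>\<close>
  (greatest fixed point).\<close>

coinductive smooth :: "('a::euclidean_space \<Rightarrow> real) \<Rightarrow> bool" where
  "\<lbrakk>\<forall>x. f differentiable (at x); \<forall>i\<in>Basis. smooth (\<lambda>x. frechet_derivative f (at x) i)\<rbrakk>
    \<Longrightarrow> smooth f"

definition grad :: "('a::euclidean_space \<Rightarrow> real) \<Rightarrow> 'a \<Rightarrow> 'a" where
  "grad f x = (\<Sum>i\<in>Basis. frechet_derivative f (at x) i *\<^sub>R i)"

definition test_function :: "'a::euclidean_space set \<Rightarrow> ('a \<Rightarrow> real) \<Rightarrow> bool" where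
  "test_function \<Omega> v \<longleftrightarrow> smooth v \<and> (\<exists>K. compact K \<and> K \<subseteq> \<Omega> \<and> (\<forall>x. x \<notin> K \<longrightarrow> v x = 0))"

text \<open>\<open>f\<close> belongs to \<open>H\<^sub>0\<^sup>1(\<Omega>)\<close>, the closure of the test functions in \<open>H\<^sup>1(\<Omega>)\<close>, and \<open>G\<close> is its
  weak gradient.\<close>

definition H01_with_grad ::
  "'a::euclidean_space set \<Rightarrow> ('a \<Rightarrow> real) \<Rightarrow> ('a \<Rightarrow> 'a) \<Rightarrow> bool" where
  "H01_with_grad \<Omega> f G \<longleftrightarrow>
     (\<exists>v. (\<forall>n. test_function \<Omega> (v n)) \<and> l2_tendsto \<Omega> v f \<and> l2_tendsto \<Omega> (\<lambda>n. grad (v n)) G)"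

text \<open>Weak form of \<open>-\<Delta>\<phi> = \<mu>\<phi>\<close> in \<open>\<Omega>\<close>, \<open>\<phi> = 0\<close> on the boundary. That \<open>\<phi>\<close> is nonzero will follow from
  normalisation.\<close>

definition dirichlet_eigenpair ::
  "'a::euclidean_space set \<Rightarrow> real \<Rightarrow> ('a \<Rightarrow> real) \<Rightarrow> bool" where
  "dirichlet_eigenpair \<Omega> \<mu> \<phi> \<longleftrightarrow>
     (\<exists>G. H01_with_grad \<Omega> \<phi> G \<and>
          (\<forall>v. test_function \<Omega> v \<longrightarrow> l2_inner \<Omega> G (grad v) = \<mu> * l2_inner \<Omega> \<phi> v))"

text \<open>All eigenvalues, repeated according to multiplicity and in nondecreasing order, with an
  orthonormal basis of eigenfunctions. Indices start at \<open>0\<close>, so \<open>lam 0\<close> is the smallest eigenvalue.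
  No eigenvalue is missing because the eigenfunctions span \<open>L\<^sup>2(\<Omega>)\<close>.\<close>

definition dirichlet_eigensystem ::
  "'a::euclidean_space set \<Rightarrow> (nat \<Rightarrow> real) \<Rightarrow> (nat \<Rightarrow> 'a \<Rightarrow> real) \<Rightarrow> bool" where
  "dirichlet_eigensystem \<Omega> lam \<phi> \<longleftrightarrow>
     mono lam \<and>
     (\<forall>j. dirichlet_eigenpair \<Omega> (lam j) (\<phi> j)) \<and>
     (\<forall>i j. l2_inner \<Omega> (\<phi> i) (\<phi> j) = (if i = j then 1 else 0)) \<and>
     (\<forall>v\<in>L2 \<Omega>. l2_sums \<Omega> (\<lambda>j x. l2_inner \<Omega> v (\<phi> j) * \<phi> j x) v)"

definition Hdot ::
  "'a::euclidean_space set \<Rightarrow> (nat \<Rightarrow> real) \<Rightarrow> (nat \<Rightarrow> 'a \<Rightarrow> real) \<Rightarrow> real \<Rightarrow> ('a \<Rightarrow> real) set" where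
  "Hdot \<Omega> lam \<phi> q =
     {v \<in> L2 \<Omega>. summable (\<lambda>j. lam j powr q * (l2_inner \<Omega> v (\<phi> j))\<^sup>2)}"

definition Hdot_norm ::
  "'a::euclidean_space set \<Rightarrow> (nat \<Rightarrow> real) \<Rightarrow> (nat \<Rightarrow> 'a \<Rightarrow> real) \<Rightarrow> real \<Rightarrow> ('a \<Rightarrow> real) \<Rightarrow> real" where
  "Hdot_norm \<Omega> lam \<phi> q v = sqrt (\<Sum>j. lam j powr q * (l2_inner \<Omega> v (\<phi> j))\<^sup>2)"


section \<open>Mittag-Leffler functions and the diffusion-wave problem\<close>

definition mittag_leffler :: "real \<Rightarrow> real \<Rightarrow> real \<Rightarrow> real" where
  "mittag_leffler \<alpha> \<beta> z = (\<Sum>k. z ^ k / Gamma (real k * \<alpha> + \<beta>))"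

definition psi :: "real \<Rightarrow> real \<Rightarrow> real \<Rightarrow> real \<Rightarrow> real" where
  "psi \<alpha> T1 T2 \<mu> =
     T2 * mittag_leffler \<alpha> 1 (- \<mu> * T1 powr \<alpha>) * mittag_leffler \<alpha> 2 (- \<mu> * T2 powr \<alpha>) -
     T1 * mittag_leffler \<alpha> 1 (- \<mu> * T2 powr \<alpha>) * mittag_leffler \<alpha> 2 (- \<mu> * T1 powr \<alpha>)"

definition psi_threshold :: "real \<Rightarrow> real \<Rightarrow> (real \<Rightarrow> real) \<Rightarrow> bool" where
  "psi_threshold \<alpha> cstar M \<longleftrightarrow>
     (\<forall>\<mu>>0. M \<mu> > 0 \<and>
       (\<forall>T1 T2. M \<mu> \<le> T1 \<and> T1 < T2 \<longrightarrow>
          (let B = cstar * (T2 - T1) / (Gamma (1 - \<alpha>) * Gamma (2 - \<alpha>))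
                     * (1 / (\<mu>\<^sup>2 * T1 powr \<alpha> * T2 powr \<alpha>))
           in psi \<alpha> T1 T2 \<mu> \<le> B \<and> B < 0)))"

definition sol_F ::
  "'a::euclidean_space set \<Rightarrow> (nat \<Rightarrow> real) \<Rightarrow> (nat \<Rightarrow> 'a \<Rightarrow> real) \<Rightarrow> real \<Rightarrow> real \<Rightarrow>
   ('a \<Rightarrow> real) \<Rightarrow> 'a \<Rightarrow> real" where
  "sol_F \<Omega> lam \<phi> \<alpha> t v =
     l2_suminf \<Omega> (\<lambda>j x. mittag_leffler \<alpha> 1 (- lam j * t powr \<alpha>) * l2_inner \<Omega> v (\<phi> j) * \<phi> j x)"

definition sol_Fbar ::
  "'a::euclidean_space set \<Rightarrow> (nat \<Rightarrow> real) \<Rightarrow> (nat \<Rightarrow> 'a \<Rightarrow> real) \<Rightarrow> real \<Rightarrow> real \<Rightarrow>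
   ('a \<Rightarrow> real) \<Rightarrow> 'a \<Rightarrow> real" where
  "sol_Fbar \<Omega> lam \<phi> \<alpha> t v =
     l2_suminf \<Omega> (\<lambda>j x. t * mittag_leffler \<alpha> 2 (- lam j * t powr \<alpha>) * l2_inner \<Omega> v (\<phi> j) * \<phi> j x)"

definition solution ::
  "'a::euclidean_space set \<Rightarrow> (nat \<Rightarrow> real) \<Rightarrow> (nat \<Rightarrow> 'a \<Rightarrow> real) \<Rightarrow> real \<Rightarrow>
   ('a \<Rightarrow> real) \<Rightarrow> ('a \<Rightarrow> real) \<Rightarrow> real \<Rightarrow> 'a \<Rightarrow> real" where
  "solution \<Omega> lam \<phi> \<alpha> a b t = (\<lambda>x. sol_F \<Omega> lam \<phi> \<alpha> t a x + sol_Fbar \<Omega> lam \<phi> \<alpha> t b x)"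

text \<open>The Caputo derivative of order \<open>\<alpha> \<in> (1,2)\<close> of \<open>w\<close> at \<open>t > 0\<close> exists and equals \<open>D\<close>. The second
  derivative is only required on the open interval: for solutions of the equation it is
  typically unbounded, but integrable, near \<open>0\<close>.\<close>

definition has_caputo_derivative :: "real \<Rightarrow> (real \<Rightarrow> real) \<Rightarrow> real \<Rightarrow> real \<Rightarrow> bool" where
  "has_caputo_derivative \<alpha> w D t \<longleftrightarrow>
     (\<exists>w' w''.
        (\<forall>s\<in>{0..t}. (w has_real_derivative w' s) (at s within {0..t})) \<and>
        continuous_on {0..t} w' \<and>
        (\<forall>s\<in>{0<..<t}. (w' has_real_derivative w'' s) (at s)) \<and>
        set_integrable lborel {0<..<t} (\<lambda>s. (t - s) powr (1 - \<alpha>) * w'' s) \<and>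
        D = 1 / Gamma (2 - \<alpha>) * (LINT s:{0<..<t}|lborel. (t - s) powr (1 - \<alpha>) * w'' s))"

text \<open>\<open>u\<close> solves \<open>\<partial>\<^sub>t\<^sup>\<alpha> u - \<Delta>u = 0\<close> on \<open>(0,T]\<close> with zero boundary values, \<open>u(0) = a\<close> and
  \<open>\<partial>\<^sub>t u(0) = b\<close>. The boundary condition is \<open>u(t) \<in> H\<^sup>2 \<inter> H\<^sub>0\<^sup>1\<close>, which is \<open>Hdot 2\<close>. The equation and
  the initial velocity are tested with the eigenfunctions, using \<open>(-\<Delta>u, \<phi>\<^sub>j) = \<lambda>\<^sub>j (u, \<phi>\<^sub>j)\<close>:
  for data merely in \<open>L\<^sup>2\<close>, the \<open>L\<^sup>2\<close>-valued integral defining the Caputo derivative need not converge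
  absolutely, and \<open>\<partial>\<^sub>t u(t)\<close> need not converge in \<open>L\<^sup>2\<close> as \<open>t\<close> tends to \<open>0\<close>.\<close>

definition solves_ibvp ::
  "'a::euclidean_space set \<Rightarrow> (nat \<Rightarrow> real) \<Rightarrow> (nat \<Rightarrow> 'a \<Rightarrow> real) \<Rightarrow> real \<Rightarrow> real \<Rightarrow>
   ('a \<Rightarrow> real) \<Rightarrow> ('a \<Rightarrow> real) \<Rightarrow> (real \<Rightarrow> 'a \<Rightarrow> real) \<Rightarrow> bool" where
  "solves_ibvp \<Omega> lam \<phi> \<alpha> T a b u \<longleftrightarrow>
     (\<forall>t\<in>{0..T}. u t \<in> L2 \<Omega>) \<and>
     (\<forall>t\<in>{0<..T}. u t \<in> Hdot \<Omega> lam \<phi> 2) \<and>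
     (\<forall>t\<in>{0<..T}. \<forall>j. has_caputo_derivative \<alpha> (\<lambda>s. l2_inner \<Omega> (u s) (\<phi> j))
                        (- lam j * l2_inner \<Omega> (u t) (\<phi> j)) t) \<and>
     (AE x in lebesgue_on \<Omega>. u 0 x = a x) \<and>
     (\<forall>j. ((\<lambda>s. l2_inner \<Omega> (u s) (\<phi> j)) has_real_derivative l2_inner \<Omega> b (\<phi> j))
            (at 0 within {0..T}))"

definition two_time_recovery ::
  "'a::euclidean_space set \<Rightarrow> (nat \<Rightarrow> real) \<Rightarrow> (nat \<Rightarrow> 'a \<Rightarrow> real) \<Rightarrow> real \<Rightarrow> real \<Rightarrow> real \<Rightarrow> real \<Rightarrow>
   real \<Rightarrow> real \<Rightarrow> bool" where
  "two_time_recovery \<Omega> lam \<phi> \<alpha> T T1 T2 c1 c2 \<longleftrightarrow>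
     (\<forall>g1\<in>Hdot \<Omega> lam \<phi> 2. \<forall>g2\<in>Hdot \<Omega> lam \<phi> 2.
        \<exists>a\<in>L2 \<Omega>. \<exists>b\<in>L2 \<Omega>.
          solves_ibvp \<Omega> lam \<phi> \<alpha> T a b (solution \<Omega> lam \<phi> \<alpha> a b) \<and>
          (AE x in lebesgue_on \<Omega>. solution \<Omega> lam \<phi> \<alpha> a b T1 x = g1 x) \<and>
          (AE x in lebesgue_on \<Omega>. solution \<Omega> lam \<phi> \<alpha> a b T2 x = g2 x) \<and>
          c1 * (Hdot_norm \<Omega> lam \<phi> 2 g1 + Hdot_norm \<Omega> lam \<phi> 2 g2) \<le> l2_norm \<Omega> a + l2_norm \<Omega> b \<and>
          l2_norm \<Omega> a + l2_norm \<Omega> b \<le> c2 * (Hdot_norm \<Omega> lam \<phi> 2 g1 + Hdot_norm \<Omega> lam \<phi> 2 g2))"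

end

theory Submission
  imports Defs "HOL-Complex_Analysis.Complex_Analysis" "HOL-Real_Asymp.Real_Asymp"
begin

text \<open>Expanding in the eigenfunctions turns the two observations into a \<open>2 \<times> 2\<close> linear system for the
  coefficients of \<open>a\<close> and \<open>b\<close> at each eigenvalue \<open>\<mu>\<close>, with determinant \<open>\<psi>(T\<^sub>1, T\<^sub>2; \<mu>)\<close>. The functions
  \<open>E\<^bsub>\<alpha>,\<beta>\<^esub>(-\<mu>t\<^sup>\<alpha>)\<close> depend on \<open>\<mu>\<close> only through \<open>\<mu>t\<^sup>\<alpha>\<close>, so that scaling time carries the bound on \<open>\<psi>\<close> from the
  smallest eigenvalue to all others: \<open>-\<psi>\<close> is at least a constant times \<open>1 / \<mu>\<^sup>2\<close>. As the matrix entries are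
  of size at most \<open>1 / \<mu>\<close>, the coefficients of \<open>a\<close> and \<open>b\<close> are comparable to \<open>\<mu>\<close> times those of \<open>g\<^sub>1\<close> and \<open>g\<^sub>2\<close>.

  The decay of \<open>E\<^bsub>\<alpha>,\<beta>\<^esub>(-x)\<close> comes from Hankel's integral for \<open>1 / \<Gamma>\<close>, taken over the two rays
  \<open>R + r exp(\<plusminus>i\<theta>)\<close> with \<open>\<pi> / 2 < \<theta> < \<pi> / \<alpha>\<close>. For large \<open>R\<close> the Mittag-Leffler series is summed under the
  integral to \<open>exp(z) z\<^bsup>\<alpha>-\<beta>\<^esup> / (z\<^sup>\<alpha> + x)\<close>. The poles of this kernel lie to the left of the rays, hence \<open>R\<close> can be
  lowered to \<open>1\<close> for every \<open>x\<close>, where the denominator is at least a constant times \<open>x\<close>.\<close>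

section \<open>Integrals along rays and the Hankel representation of the reciprocal Gamma function\<close>

text \<open>The angle obeys two constraints. Beyond \<pi> / 2 the factor exp(z) decays along the
  rays, so that every integral converges absolutely; below \<pi> / \<alpha> the power
  \<open>z powr \<alpha>\<close> keeps to a sector that misses the negative axis, where
  \<open>z powr \<alpha> + x\<close> would vanish. Both can be met because \<alpha> < 2. Rays that
  start at a point R > 0 avoid the branch point, so no arc around the origin is needed. Pieces of
  contour on the positive axis are real and disappear on taking imaginary parts.

  The constants of the theorem have to be fixed before the domain is known. Hence the decay is
  stated as one bound on x |E(-x)| for all x >= 0, and the determinant bound as
  \<open>D / \<mu>\<^sup>2\<close> with \<open>D\<close> independent of the eigenvalue. The argument
  also needs the spectrum to start at a positive value, so that the threshold applies to it and the
  coefficients can be divided by eigenvalues. The notion of an eigensystem does not contain this; it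
  is derived from a Poincare inequality.\<close>

definition ray_integral :: "(complex \<Rightarrow> complex) \<Rightarrow> complex \<Rightarrow> complex \<Rightarrow> complex" where
  "ray_integral f w z = (LINT r:{0..}|lborel. f (z + of_real r * w) * w)"

lemma set_integrable_exp_minus:
  assumes "0 < (c::real)"
  shows "set_integrable lborel {0..} (\<lambda>r. A * exp (- c * r))"
proof -
  have "set_integrable lebesgue {0..} (\<lambda>r::real. exp (- c * r))"
    by (rule nonnegative_absolutely_integrable_1)
      (use integrable_on_exp_minus_to_infinity[OF assms, of 0] in auto)
  then have "set_integrable lborel {0..} (\<lambda>r::real. exp (- c * r))"
    unfolding set_integrable_def by (subst (asm) integrable_completion) simp_all
  then show ?thesis by (rule set_integrable_mult_right)
qed

lemma ray_integrable:
  fixes f :: "complex \<Rightarrow> complex"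
  assumes "continuous_on {0..} (\<lambda>r. f (z + of_real r * w))"
    and "\<And>r. 0 \<le> r \<Longrightarrow> norm (f (z + of_real r * w)) \<le> A * exp (- c * r)" and "0 < c"
  shows "set_integrable lborel {0..} (\<lambda>r. f (z + of_real r * w) * w)"
proof (rule set_integrable_bound[OF set_integrable_exp_minus[OF assms(3), of "A * norm w"]])
  have "continuous_on {0..} (\<lambda>r. f (z + of_real r * w) * w)"
    by (intro continuous_intros assms)
  from borel_measurable_continuous_on_indicator[OF _ this]
  show "set_borel_measurable lborel {0..} (\<lambda>r. f (z + of_real r * w) * w)"
    unfolding set_borel_measurable_def
    by simp
  show "AE r in lborel. r \<in> {0..} \<longrightarrow>
      norm (f (z + complex_of_real r * w) * w) \<le> norm (A * norm w * exp (- c * r))"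
  proof (intro AE_I2 impI)
    fix r :: real assume "r \<in> {0..}"
    then have "norm (f (z + of_real r * w)) * norm w \<le> A * exp (- c * r) * norm w"
      using assms(2)[of r] by (intro mult_right_mono) auto
    then show "norm (f (z + complex_of_real r * w) * w) \<le> norm (A * norm w * exp (- c * r))"
      unfolding norm_mult[of "f _"] by (simp add: mult_ac)
  qed
qed

lemma norm_ray_integral_le:
  fixes f :: "complex \<Rightarrow> complex"
  assumes "continuous_on {0..} (\<lambda>r. f (z + of_real r * w))"
    and "\<And>r. 0 \<le> r \<Longrightarrow> norm (f (z + of_real r * w)) \<le> A * exp (- c * r)" and "0 < c"
  shows "norm (ray_integral f w z) \<le> A * norm w * (LINT r:{0..}|lborel. exp (- c * r))"
proof -
  note i = ray_integrable[OF assms]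
  have "norm (ray_integral f w z) \<le> (LINT r:{0..}|lborel. norm (f (z + of_real r * w) * w))"
    unfolding ray_integral_def by (rule set_integral_norm_bound[OF i])
  also have "\<dots> \<le> (LINT r:{0..}|lborel. A * norm w * exp (- c * r))"
  proof (rule set_integral_mono[OF set_integrable_norm[OF i] set_integrable_exp_minus[OF assms(3)]])
    fix r :: real assume "r \<in> {0..}"
    then have "norm (f (z + of_real r * w)) * norm w \<le> A * exp (- c * r) * norm w"
      using assms(2)[of r] by (intro mult_right_mono) auto
    then show "norm (f (z + complex_of_real r * w) * w) \<le> A * norm w * exp (- c * r)"
      unfolding norm_mult[of "f _"] by (simp add: mult_ac)
  qed
  finally show ?thesis by simp
qed

text \<open>Unbounded contours are never closed. Deforming one ray into another is done by comparing
  the limits at infinity of one common primitive, and absolute integrability provides these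
  limits.\<close>

lemma ray_primitive_tendsto:
  fixes f F :: "complex \<Rightarrow> complex"
  assumes "continuous_on {0..} (\<lambda>r. f (z + of_real r * w))"
    and "\<And>r. 0 \<le> r \<Longrightarrow> norm (f (z + of_real r * w)) \<le> A * exp (- c * r)" and "0 < c"
    and F: "\<And>r. 0 \<le> r \<Longrightarrow> (F has_field_derivative f (z + of_real r * w)) (at (z + of_real r * w))"
  shows "((\<lambda>r. F (z + of_real r * w)) \<longlongrightarrow> F z + ray_integral f w z) at_top"
proof -
  have "((\<lambda>b. LINT r:{0..b}|lborel. f (z + of_real r * w) * w) \<longlongrightarrow> ray_integral f w z) at_top"
    unfolding ray_integral_def
    by (rule tendsto_set_lebesgue_integral_at_top) (auto intro: ray_integrable[OF assms(1-3)])
  moreover have "\<forall>\<^sub>F b in at_top. (LINT r:{0..b}|lborel. f (z + of_real r * w) * w)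
      = F (z + of_real b * w) - F z"
  proof (rule eventually_mono[OF eventually_ge_at_top[of 0]])
    fix b :: real assume b: "0 \<le> b"
    have "(LINT r|lborel. indicator {0..b} r *\<^sub>R (f (z + of_real r * w) * w))
        = F (z + of_real b * w) - F (z + of_real 0 * w)"
    proof (rule integral_FTC_Icc[OF b])
      fix r assume "0 \<le> r" "r \<le> b"
      have "((\<lambda>x. F (z + x * w)) has_field_derivative f (z + of_real r * w) * w) (at (of_real r))"
        by (rule DERIV_chain2[where g = "\<lambda>x. z + x * w", OF F[OF \<open>0 \<le> r\<close>]])
          (auto intro!: derivative_eq_intros)
      from has_vector_derivative_real_field[OF this]
      show "((\<lambda>r. F (z + of_real r * w)) has_vector_derivative f (z + of_real r * w) * w)
          (at r within {0..b})"
        by (rule has_vector_derivative_at_within)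
    next
      show "continuous_on {0..b} (\<lambda>r. f (z + of_real r * w) * w)"
        by (intro continuous_intros continuous_on_subset[OF assms(1)]) auto
    qed
    then show "(LINT r:{0..b}|lborel. f (z + of_real r * w) * w) = F (z + of_real b * w) - F z"
      unfolding set_lebesgue_integral_def by simp
  qed
  ultimately have "((\<lambda>b. F (z + of_real b * w) - F z) \<longlongrightarrow> ray_integral f w z) at_top"
    using tendsto_cong by force
  from tendsto_add[OF this tendsto_const[of "F z"]] show ?thesis by (simp add: add.commute)
qed

text \<open>The derivative of \<open>Im F\<close> along the axis is the imaginary part of a real
  number. Moving the starting point of a ray along the positive axis therefore never changes
  imaginary parts.\<close>

lemma Im_const_of_real_derivative:
  fixes f F :: "complex \<Rightarrow> complex"
  assumes "\<And>x. 0 < x \<Longrightarrow> (F has_field_derivative f (of_real x)) (at (of_real x))"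
    and "\<And>x. 0 < x \<Longrightarrow> f (of_real x) \<in> \<real>" and "0 < a" "0 < b"
  shows "Im (F (of_real a)) = Im (F (of_real b))"
proof -
  have "\<exists>c. \<forall>x\<in>{0<..}. Im (F (of_real x)) = c"
  proof (rule has_derivative_zero_constant)
    fix x :: real assume "x \<in> {0<..}"
    then have x: "0 < x" by simp
    have "((\<lambda>x. F (of_real x)) has_vector_derivative f (of_real x)) (at x)"
      by (rule has_vector_derivative_real_field[OF assms(1)[OF x]])
    then have "((\<lambda>x. Im (F (of_real x))) has_vector_derivative Im (f (of_real x))) (at x)"
      using bounded_linear.has_vector_derivative[OF bounded_linear_Im] by fastforce
    moreover have "Im (f (of_real x)) = 0" using assms(2)[OF x] by (simp add: complex_is_Real_iff)
    ultimately show "((\<lambda>x. Im (F (of_real x))) has_derivative (\<lambda>h. 0)) (at x within {0<..})"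
      by (simp add: has_vector_derivative_def has_derivative_at_withinI)
  qed auto
  then show ?thesis using assms(3,4) by force
qed

lemma segment_primitive_bound:
  fixes f F :: "complex \<Rightarrow> complex"
  assumes "\<And>z. z \<in> closed_segment a b \<Longrightarrow> (F has_field_derivative f z) (at z)"
    and "\<And>z. z \<in> closed_segment a b \<Longrightarrow> norm (f z) \<le> B"
  shows "norm (F b - F a) \<le> B * norm (b - a)"
  by (rule field_differentiable_bound[of "closed_segment a b" F f])
    (use assms in \<open>auto intro: has_field_derivative_at_within\<close>)

text \<open>The rays leaving distinct points of the positive axis in the same direction bound a half-strip,
  whose third side lies on the axis and contributes a real number.\<close>

lemma Im_ray_integral_shift:
  fixes f :: "complex \<Rightarrow> complex"
  assumes th: "0 < \<theta>" "\<theta> < pi" and R: "0 < R1" "R1 \<le> R2"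
    and hol: "f holomorphic_on {z. Im (z * cnj (cis \<theta>)) < 0}"
    and real: "\<And>x. 0 < x \<Longrightarrow> f (of_real x) \<in> \<real>"
    and bound: "\<And>a r. R1 \<le> a \<Longrightarrow> a \<le> R2 \<Longrightarrow> 0 \<le> r \<Longrightarrow>
      norm (f (of_real a + of_real r * cis \<theta>)) \<le> A * exp (- c * r)" and c: "0 < c"
  shows "Im (ray_integral f (cis \<theta>) (of_real R1)) = Im (ray_integral f (cis \<theta>) (of_real R2))"
proof -
  \<comment> \<open>The half-plane to the right of the line through 0 with direction
    \<open>cis \<theta>\<close>. It contains the positive axis and every ray in question, and its
    convexity yields a primitive.\<close>
  let ?H = "{z. Im (z * cnj (cis \<theta>)) < 0}" and ?w = "cis \<theta>"
  have sin: "0 < sin \<theta>" using th by (simp add: sin_gt_zero)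
  have H: "?H = {z. inner (Complex (- sin \<theta>) (cos \<theta>)) z < 0}"
    by (auto simp: inner_complex_def algebra_simps)
  have op: "open ?H" "convex ?H"
    unfolding H by (rule open_halfspace_lt convex_halfspace_lt)+
  have inH: "of_real a + of_real r * ?w \<in> ?H" if "0 < a" for a r
  proof -
    have "Im ((of_real a + of_real r * ?w) * cnj ?w) = - a * sin \<theta>"
      by (simp add: algebra_simps)
    then show ?thesis using that sin by simp
  qed
  obtain F where F: "\<And>z. z \<in> ?H \<Longrightarrow> (F has_field_derivative f z) (at z)"
    using holomorphic_convex_primitive'[OF op(2,1) hol] at_within_open[OF _ op(1)] by metis
  have cont: "continuous_on {0..} (\<lambda>r. f (of_real a + of_real r * ?w))" if "0 < a" for a
    by (rule continuous_on_compose2[OF holomorphic_on_imp_continuous_on[OF hol]])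
      (use inH[OF that] in \<open>auto intro!: continuous_intros\<close>)
  have lim: "((\<lambda>r. F (of_real a + of_real r * ?w)) \<longlongrightarrow> F (of_real a) + ray_integral f ?w (of_real a)) at_top"
    if "R1 \<le> a" "a \<le> R2" for a
    by (rule ray_primitive_tendsto[OF cont bound[OF that] c F[OF inH]]) (use that R in auto)
  \<comment> \<open>The far ends of the two rays are joined by a horizontal segment of fixed length
    \<open>R2 - R1\<close>. The bound on \<open>f\<close> is uniform over the starting points in
    between, so it decays along the whole segment.\<close>
  have lim0: "((\<lambda>r. F (of_real R2 + of_real r * ?w) - F (of_real R1 + of_real r * ?w)) \<longlongrightarrow> 0) at_top"
  proof (rule Lim_null_comparison)
    show "\<forall>\<^sub>F r in at_top. norm (F (of_real R2 + of_real r * ?w) - F (of_real R1 + of_real r * ?w))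
       \<le> A * exp (- c * r) * (R2 - R1)"
    proof (rule eventually_mono[OF eventually_ge_at_top[of 0]])
      fix r :: real assume r: "0 \<le> r"
      have *: "\<exists>a. z = of_real a + of_real r * ?w \<and> R1 \<le> a \<and> a \<le> R2"
        if z: "z \<in> closed_segment (of_real R1 + of_real r * ?w) (of_real R2 + of_real r * ?w)" for z
      proof -
        obtain u where u: "0 \<le> u" "u \<le> 1"
          "z = of_real R1 + of_real r * ?w + u *\<^sub>R (of_real R2 - of_real R1)"
          using z by (auto simp: closed_segment_def algebra_simps)
        have "u * (R2 - R1) \<le> 1 * (R2 - R1)" using u R by (intro mult_right_mono) auto
        then show ?thesis using u R
          by (intro exI[of _ "R1 + u * (R2 - R1)"]) (auto simp: scaleR_conv_of_real)
      qed
      have "norm (F (of_real R2 + of_real r * ?w) - F (of_real R1 + of_real r * ?w))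
         \<le> A * exp (- c * r) * norm ((of_real R2 + of_real r * ?w) - (of_real R1 + of_real r * ?w))"
        using * bound r R inH by (intro segment_primitive_bound[of _ _ F f] F) force+
      also have "norm ((of_real R2 + of_real r * ?w) - (of_real R1 + of_real r * ?w)) = R2 - R1"
        using R norm_of_real[of "R2 - R1", where 'a = complex] by simp
      finally show "norm (F (of_real R2 + of_real r * ?w) - F (of_real R1 + of_real r * ?w))
         \<le> A * exp (- c * r) * (R2 - R1)" .
    qed
    show "((\<lambda>r. A * exp (- c * r) * (R2 - R1)) \<longlongrightarrow> 0) at_top"
      using c by real_asymp
  qed
  have "F (of_real R2) + ray_integral f ?w (of_real R2) - (F (of_real R1) + ray_integral f ?w (of_real R1)) = 0"
    by (rule tendsto_unique[OF trivial_limit_at_top_linorder tendsto_diff[OF lim lim] lim0]) (use R in auto)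
  moreover have "Im (F (of_real R1)) = Im (F (of_real R2))"
  proof (rule Im_const_of_real_derivative[of F f])
    show "(F has_field_derivative f (of_real x)) (at (of_real x))" if "0 < x" for x
      using F[OF inH[OF that, of 0]] by simp
  qed (use R real in auto)
  ultimately show ?thesis by (simp add: complex_eq_iff)
qed

text \<open>\<open>R * sin \<theta>\<close> is the distance from the origin to the line that carries
  the ray. This lower bound on the norm is what controls negative powers of
  \<open>z\<close>.\<close>

lemma ray_points:
  assumes "pi / 2 < \<theta>" "\<theta> < pi" "0 < R" "0 \<le> r"
  defines "z \<equiv> of_real R + of_real r * cis \<theta>"
  shows "0 \<le> Im z" "Re z = R + r * cos \<theta>" "norm z \<le> R + r" "R * sin \<theta> \<le> norm z" "z \<notin> \<real>\<^sub>\<le>\<^sub>0"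
proof -
  have s: "0 < sin \<theta>" using assms by (intro sin_gt_zero) (auto intro: less_trans[OF pi_half_gt_zero])
  show "0 \<le> Im z" "Re z = R + r * cos \<theta>" using s assms by (auto simp: z_def)
  have "norm z \<le> norm (of_real R :: complex) + norm (of_real r * cis \<theta>)"
    unfolding z_def by (rule norm_triangle_ineq)
  then show "norm z \<le> R + r" using assms by (simp add: norm_mult)
  have "R * sin \<theta> = - Im (z * cnj (cis \<theta>))" by (simp add: z_def algebra_simps)
  also have "\<dots> \<le> norm (z * cnj (cis \<theta>))" using abs_Im_le_cmod[of "z * cnj (cis \<theta>)"] by linarith
  finally show "R * sin \<theta> \<le> norm z" by (simp add: norm_mult)
  show "z \<notin> \<real>\<^sub>\<le>\<^sub>0"
  proof
    assume "z \<in> \<real>\<^sub>\<le>\<^sub>0"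
    then have "Re z \<le> 0" "Im z = 0" by (auto simp: complex_nonpos_Reals_iff)
    then have "r = 0" using s by (auto simp: z_def)
    then show False using \<open>Re z \<le> 0\<close> assms by (simp add: z_def)
  qed
qed

lemma continuous_on_ray:
  assumes "pi / 2 < \<theta>" "\<theta> < pi" "0 < R" "continuous_on (- \<real>\<^sub>\<le>\<^sub>0) f"
  shows "continuous_on {0..} (\<lambda>r. f (of_real R + of_real r * cis \<theta>))"
proof (rule continuous_on_compose2[OF assms(4)])
  show "continuous_on {0..} (\<lambda>r. of_real R + of_real r * cis \<theta>)"
    by (intro continuous_intros)
qed (use ray_points(5)[OF assms(1-3)] in blast)

section \<open>Hankel's formula for arguments in [-1, 0)\<close>

lemma Ln_upper:
  assumes "0 \<le> Im z" "z \<noteq> 0"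
  shows "Ln z = Ln (- \<i> * z) + \<i> * of_real pi / 2"
  using Ln_times_ii[of "- \<i> * z"] assms by simp

text \<open>The branch cut is turned to the negative imaginary axis, so that the primitive extends to the upper
  edge of the negative real axis.\<close>

lemma slit_exp_powr_primitive:
  fixes p :: real
  obtains F where "\<And>z. 0 \<le> Im z \<Longrightarrow> z \<noteq> 0 \<Longrightarrow> (F has_field_derivative exp z * z powr of_real p) (at z)"
proof -
  \<comment> \<open>\<open>f\<close> is the integrand taken at \<open>\<i> * z\<close>, so
    \<open>f (- \<i> * z)\<close> is the integrand at \<open>z\<close>. The factor
    \<open>\<i>\<close> in the final primitive cancels the factor from the chain rule.\<close>
  define f where "f z = exp (\<i> * z + of_real p * (Ln z + \<i> * of_real pi / 2))" for z
  let ?S = "- \<real>\<^sub>\<le>\<^sub>0 :: complex set"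
  have S: "?S = - (complex_of_real ` {..0})"
    by (auto simp: nonpos_Reals_def)
  have "f holomorphic_on ?S"
    unfolding f_def by (auto intro!: holomorphic_intros)
  moreover have op: "open ?S" by (simp add: open_Compl)
  ultimately obtain G where G: "\<And>z. z \<in> ?S \<Longrightarrow> (G has_field_derivative f z) (at z)"
    using holomorphic_starlike_primitive[of ?S f "{}"] starlike_slotted_complex_plane_left[of 0]
    by (auto simp: S holomorphic_on_imp_continuous_on holomorphic_on_imp_differentiable_at)
  show ?thesis
  proof (rule that[of "\<lambda>z. \<i> * G (- \<i> * z)"])
    fix z :: complex assume z: "0 \<le> Im z" "z \<noteq> 0"
    have "- \<i> * z \<in> ?S" using z by (auto simp: complex_nonpos_Reals_iff complex_eq_iff)
    have "((\<lambda>z. G (- \<i> * z)) has_field_derivative f (- \<i> * z) * (- \<i>)) (at z)"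
      by (rule DERIV_chain2[where g = "\<lambda>z. - \<i> * z", OF G[OF \<open>- \<i> * z \<in> ?S\<close>]])
        (auto intro!: derivative_eq_intros)
    then have "((\<lambda>z. \<i> * G (- \<i> * z)) has_field_derivative \<i> * (f (- \<i> * z) * (- \<i>))) (at z)"
      by (rule DERIV_cmult)
    moreover have "f (- \<i> * z) = exp z * z powr of_real p"
      using z by (simp add: f_def powr_def exp_add Ln_upper)
    moreover have "\<i> * (x * - \<i>) = x" for x by (simp add: complex_eq_iff)
    ultimately show "((\<lambda>z. \<i> * G (- \<i> * z)) has_field_derivative exp z * z powr of_real p) (at z)"
      by (simp only:)
  qed
qed

lemma norm_exp_powr: "norm (exp z * z powr of_real p) = exp (Re z) * norm z powr p"
  by (simp add: norm_mult norm_powr_real_powr')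

lemma powr_le_one_plus:
  assumes "0 \<le> x" "0 < p" "p \<le> (1::real)"
  shows "x powr p \<le> 1 + x"
proof (cases "x \<le> 1")
  case True then show ?thesis using assms powr_le1[of p x] by linarith
next
  case False then show ?thesis using assms powr_mono[of p 1 x] by simp
qed

text \<open>Half of the decay rate is spent on absorbing the linear factor.\<close>

lemma linear_exp_le_exp:
  fixes c :: real
  assumes "0 < c" "0 \<le> B"
  obtains A where "\<And>r. 0 \<le> r \<Longrightarrow> (B + r) * exp (- c * r) \<le> A * exp (- (c / 2) * r)"
proof
  fix r :: real assume r: "0 \<le> r"
  have "r = (2 / c) * (c / 2 * r)" using assms by simp
  also have "\<dots> \<le> (2 / c) * exp (c / 2 * r)"
    using mult_left_mono[OF order_trans[OF _ exp_ge_add_one_self[of "c / 2 * r"]], of "c / 2 * r" "2 / c"] assms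
    by simp
  finally have "r \<le> (2 / c) * exp (c / 2 * r)" .
  moreover have "B \<le> B * exp (c / 2 * r)" using assms r mult_left_mono[of 1 "exp (c / 2 * r)" B] by simp
  ultimately have "B + r \<le> (B + 2 / c) * exp (c / 2 * r)" by (simp add: algebra_simps)
  then have "(B + r) * exp (- c * r) \<le> (B + 2 / c) * exp (c / 2 * r) * exp (- c * r)"
    by (intro mult_right_mono) auto
  also have "\<dots> = (B + 2 / c) * exp (- (c / 2) * r)"
    by (simp add: mult.assoc exp_add[symmetric] algebra_simps)
  finally show "(B + r) * exp (- c * r) \<le> (B + 2 / c) * exp (- (c / 2) * r)" .
qed

text \<open>The ray on the negative axis has to start at a distance e from the branch point, and
  parametrising it from there gives these integrals. The integrands are dominated by
  \<open>(2 + r) * exp (- r)\<close> uniformly in e, so e may tend to 0 in Euler's integral.\<close>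

lemma gamma_tail_tendsto:
  fixes p :: real
  assumes "0 < p" "p \<le> 1"
  shows "(\<lambda>n. LINT r:{0..}|lborel. exp (- (inverse (real (Suc n)) + r)) * (inverse (real (Suc n)) + r) powr p)
    \<longlonglongrightarrow> Gamma (1 + p)"
proof -
  have lim: "(\<lambda>n. inverse (real (Suc n)) + r) \<longlonglongrightarrow> r" for r :: real
    using tendsto_add[OF LIMSEQ_inverse_real_of_nat tendsto_const[of r]] by simp
  obtain A where A: "\<And>r::real. 0 \<le> r \<Longrightarrow> (2 + r) * exp (- 1 * r) \<le> A * exp (- (1 / 2) * r)"
    using linear_exp_le_exp[of 1 2] by auto
  have "(\<lambda>n. LINT r:{0..}|lborel. exp (- (inverse (real (Suc n)) + r)) * (inverse (real (Suc n)) + r) powr p)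
    \<longlonglongrightarrow> (LINT r:{0..}|lborel. exp (- r) * r powr p)"
    unfolding set_lebesgue_integral_def
  proof (rule integral_dominated_convergence)
    show "integrable lborel (\<lambda>r. indicator {0..} r *\<^sub>R (A * exp (- (1 / 2) * r)))"
      using set_integrable_exp_minus[of "1/2" A] by (simp add: set_integrable_def)
    show "AE r in lborel. (\<lambda>n. indicat_real {0..} r *\<^sub>R (exp (- (inverse (real (Suc n)) + r)) * (inverse (real (Suc n)) + r) powr p))
       \<longlonglongrightarrow> indicat_real {0..} r *\<^sub>R (exp (- r) * r powr p)"
    proof (intro AE_I2)
      fix r :: real
      have "(\<lambda>n. exp (- (inverse (real (Suc n)) + r)) * (inverse (real (Suc n)) + r) powr p)
          \<longlonglongrightarrow> exp (- r) * r powr p" if "0 \<le> r"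
        by (intro tendsto_mult tendsto_exp tendsto_minus lim tendsto_powr'[OF lim tendsto_const])
          (use that assms in auto)
      then show "(\<lambda>n. indicat_real {0..} r *\<^sub>R (exp (- (inverse (real (Suc n)) + r)) * (inverse (real (Suc n)) + r) powr p))
       \<longlonglongrightarrow> indicat_real {0..} r *\<^sub>R (exp (- r) * r powr p)"
        by (auto simp: indicator_def)
    qed
    fix n
    show "AE r in lborel. norm (indicat_real {0..} r *\<^sub>R (exp (- (inverse (real (Suc n)) + r)) * (inverse (real (Suc n)) + r) powr p))
        \<le> indicator {0..} r *\<^sub>R (A * exp (- (1 / 2) * r))"
    proof (intro AE_I2)
      fix r :: real
      define e where "e = inverse (real (Suc n))"
      have e: "0 < e" "e \<le> 1" by (auto simp: e_def field_simps)
      have "exp (- (e + r)) * (e + r) powr p \<le> A * exp (- (1 / 2) * r)" if r: "0 \<le> r"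
      proof -
        have "exp (- (e + r)) * (e + r) powr p \<le> exp (- 1 * r) * (2 + r)"
          using e r powr_le_one_plus[of "e + r" p] assms by (intro mult_mono) auto
        then show ?thesis using A[OF r] by (simp add: mult.commute)
      qed
      then show "norm (indicat_real {0..} r *\<^sub>R (exp (- (inverse (real (Suc n)) + r)) * (inverse (real (Suc n)) + r) powr p))
        \<le> indicator {0..} r *\<^sub>R (A * exp (- (1 / 2) * r))"
        unfolding e_def[symmetric] by (auto simp: indicator_def)
    qed
  qed measurable
  also have "(LINT r:{0..}|lborel. exp (- r) * r powr p) = Gamma (1 + p)"
  proof -
    have h: "((\<lambda>t. t powr p / exp t) has_integral Gamma (1 + p)) {0..}"
      using Gamma_integral_real[of "1 + p"] assms by simp
    have "set_integrable lebesgue {0..} (\<lambda>t. t powr p / exp t)"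
      by (rule nonnegative_absolutely_integrable_1) (use h in auto)
    then have "set_integrable lborel {0..} (\<lambda>t. t powr p / exp t)"
      unfolding set_integrable_def by (subst (asm) integrable_completion) simp_all
    from set_borel_integral_eq_integral(2)[OF this] integral_unique[OF h]
    show ?thesis by (simp add: exp_minus field_simps)
  qed
  finally show ?thesis .
qed

text \<open>On the negative axis the principal logarithm has imaginary part \<open>pi\<close>, which
  is its limit from above. The values of \<open>powr\<close> there are thus those on the upper edge
  of the cut.\<close>

lemma powr_minus_real:
  assumes "0 < (s::real)"
  shows "(- complex_of_real s) powr of_real p = of_real (s powr p) * cis (pi * p)"
proof -
  have "Ln (- complex_of_real s) = of_real (ln s) + \<i> * of_real pi"
    using assms by (subst Ln_minus) (auto simp: Ln_of_real)
  then show ?thesis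
    using assms by (simp add: powr_def exp_add cis_conv_exp algebra_simps flip: exp_of_real)
qed

lemma exp_powr_upper_bound:
  assumes "0 \<le> p" "Re z \<le> a" "norm z \<le> B"
  shows "norm (exp z * z powr of_real p) \<le> exp a * B powr p"
  unfolding norm_exp_powr using assms by (intro mult_mono) (auto intro: powr_mono2)

text \<open>The passage from \<open>e\<close> to \<open>- e\<close> goes around the origin by way of
  \<open>e * \<i>\<close>, which keeps it in the punctured closed upper half-plane where the
  primitive is available.\<close>

lemma small_segments:
  assumes "0 < e" "z \<in> closed_segment (of_real e) (of_real e * \<i>) \<union> closed_segment (of_real e * \<i>) (- of_real e)"
  shows "0 \<le> Im z" "z \<noteq> 0" "norm z \<le> e"
proof -
  have "(\<exists>u. 0 \<le> u \<and> u \<le> 1 \<and> (z = Complex ((1 - u) * e) (u * e) \<or> z = Complex (- (u * e)) ((1 - u) * e)))"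
    using assms(2) by (auto simp: closed_segment_def complex_eq_iff)
  then obtain u where u: "0 \<le> u" "u \<le> 1" "z = Complex ((1 - u) * e) (u * e) \<or> z = Complex (- (u * e)) ((1 - u) * e)"
    by blast
  show "0 \<le> Im z" using u assms(1) by auto
  show "z \<noteq> 0" using u assms(1) by (auto simp: complex_eq_iff)
  have "norm z \<le> \<bar>Re z\<bar> + \<bar>Im z\<bar>" by (rule cmod_le)
  also have "\<dots> = e" using u assms(1) by (auto simp: abs_mult algebra_simps)
  finally show "norm z \<le> e" .
qed

text \<open>Meant for the link between the far ends of the two rays, one end on the negative axis
  and the other above the axis: such a segment cannot meet the origin. The remaining bounds hold
  because half-planes and discs are convex.\<close>

lemma upper_segment_bounds:
  assumes "Im a = 0" "a \<noteq> 0" "0 < Im b" "Re a \<le> A" "Re b \<le> A" "norm a \<le> B" "norm b \<le> B"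
    and z: "z \<in> closed_segment a b"
  shows "0 \<le> Im z" "z \<noteq> 0" "Re z \<le> A" "norm z \<le> B"
proof -
  obtain u where u: "0 \<le> u" "u \<le> 1" "z = (1 - u) *\<^sub>R a + u *\<^sub>R b"
    using z by (auto simp: in_segment)
  have Im: "Im z = u * Im b" using assms(1) by (simp add: u(3))
  show "0 \<le> Im z" unfolding Im using u assms(3) by simp
  show "z \<noteq> 0"
  proof
    assume "z = 0"
    then have "u = 0" using Im assms(3) by simp
    then show False using \<open>z = 0\<close> u(3) assms(2) by simp
  qed
  have "closed_segment a b \<subseteq> {z. Re z \<le> A}"
    by (rule closed_segment_subset) (use assms convex_halfspace_Re_le in auto)
  then show "Re z \<le> A" using z by auto
  have "closed_segment a b \<subseteq> cball 0 B"
    by (rule closed_segment_subset) (use assms in auto)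
  then show "norm z \<le> B" using z by auto
qed

text \<open>The ray is turned onto the upper edge of the negative real axis, where the integral is Euler's
  integral for \<open>\<Gamma>(1 + p)\<close>; the reflection formula does the rest.\<close>

lemma Im_ray_integral_exp_powr:
  fixes p :: real
  assumes th: "pi / 2 < \<theta>" "\<theta> < pi" and R: "0 < R" and p: "0 < p" "p \<le> 1"
  shows "Im (ray_integral (\<lambda>z. exp z * z powr of_real p) (cis \<theta>) (of_real R)) = pi * rGamma (- p)"
proof -
  let ?f = "\<lambda>z::complex. exp z * z powr of_real p" and ?w = "cis \<theta>"
  define k where "k = - cos \<theta>"
  have "cos \<theta> < cos (pi / 2)" using th by (intro cos_monotone_0_pi) auto
  then have k: "0 < k" "k \<le> 1" by (auto simp: k_def)
  obtain F where F: "\<And>z. 0 \<le> Im z \<Longrightarrow> z \<noteq> 0 \<Longrightarrow> (F has_field_derivative ?f z) (at z)"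
    using slit_exp_powr_primitive by blast
  note pt = ray_points[OF th R]
  have nz: "of_real R + of_real r * ?w \<noteq> 0" if "0 \<le> r" for r using pt(5)[OF that] by auto
  have cont: "continuous_on (- \<real>\<^sub>\<le>\<^sub>0) ?f" by (auto intro!: holomorphic_on_imp_continuous_on holomorphic_intros)
  obtain A where A: "\<And>r. 0 \<le> r \<Longrightarrow> (1 + R + r) * exp (- k * r) \<le> A * exp (- (k / 2) * r)"
    using linear_exp_le_exp[OF k(1), of "1 + R"] R by auto
  have lim1: "((\<lambda>r. F (of_real R + of_real r * ?w)) \<longlongrightarrow> F (of_real R) + ray_integral ?f ?w (of_real R)) at_top"
  proof (rule ray_primitive_tendsto[OF continuous_on_ray[OF th R cont]])
    fix r :: real assume r: "0 \<le> r"
    show "(F has_field_derivative ?f (of_real R + of_real r * ?w)) (at (of_real R + of_real r * ?w))"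
      using F pt(1)[OF r] nz[OF r] by blast
    have "norm (?f (of_real R + of_real r * ?w)) \<le> exp (R + r * cos \<theta>) * (R + r) powr p"
      using pt(2,3)[OF r] p by (intro exp_powr_upper_bound) auto
    also have "\<dots> \<le> exp (R + r * cos \<theta>) * (1 + R + r)"
      using powr_le_one_plus[of "R + r" p] p R r by (intro mult_left_mono) auto
    also have "\<dots> = exp R * ((1 + R + r) * exp (- k * r))"
      by (simp add: k_def exp_add mult_ac)
    also have "\<dots> \<le> exp R * (A * exp (- (k / 2) * r))" by (intro mult_left_mono A r) auto
    finally show "norm (?f (of_real R + of_real r * ?w)) \<le> exp R * A * exp (- (k / 2) * r)" by simp
  qed (use k in auto)
  obtain A' where A': "\<And>r::real. 0 \<le> r \<Longrightarrow> (2 + r) * exp (- 1 * r) \<le> A' * exp (- (1 / 2) * r)"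
    using linear_exp_le_exp[of 1 2] by auto
  \<comment> \<open>The integral along the upper edge of the cut from \<open>- e\<close> to minus
    infinity.\<close>
  define N where "N e = ray_integral ?f (- 1) (- of_real e)" for e :: real
  have eq: "F (of_real R) + ray_integral ?f ?w (of_real R) = F (- of_real e) + N e" if e: "0 < e" "e \<le> 1" for e
  proof -
    have lim2: "((\<lambda>r. F (- of_real e + of_real r * (- 1))) \<longlongrightarrow> F (- of_real e) + N e) at_top"
      unfolding N_def
    proof (rule ray_primitive_tendsto)
      have "continuous_on {0..} (\<lambda>r. exp (- of_real (e + r)) * (of_real ((e + r) powr p) * cis (pi * p)))"
        using e by (intro continuous_intros) auto
      then show "continuous_on {0..} (\<lambda>r. ?f (- of_real e + of_real r * (- 1)))"
      proof (rule continuous_on_eq)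
        fix r :: real assume "r \<in> {0..}"
        then show "exp (- of_real (e + r)) * (of_real ((e + r) powr p) * cis (pi * p)) = ?f (- of_real e + of_real r * (- 1))"
          using powr_minus_real[of "e + r" p] e by simp
      qed
      fix r :: real assume r: "0 \<le> r"
      have "norm (- of_real e + of_real r * (- 1) :: complex) = norm (of_real (e + r) :: complex)"
        by (metis add_uminus_conv_diff minus_add_distrib mult.commute mult_minus1 norm_minus_cancel of_real_add)
      also have "\<dots> = e + r" unfolding norm_of_real using e r by simp
      finally have n: "norm (- of_real e + of_real r * (- 1) :: complex) = e + r" .
      show "(F has_field_derivative ?f (- of_real e + of_real r * (- 1))) (at (- of_real e + of_real r * (- 1)))"
        using n e r by (intro F) auto
      have "norm (?f (- of_real e + of_real r * (- 1))) \<le> exp (- r) * (e + r) powr p"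
        using p n e by (intro exp_powr_upper_bound) auto
      also have "\<dots> \<le> exp (- r) * (2 + r)"
        using powr_le_one_plus[of "e + r" p] p e r by (intro mult_left_mono) auto
      finally show "norm (?f (- of_real e + of_real r * (- 1))) \<le> A' * exp (- (1 / 2) * r)"
        using A'[OF r] by (simp add: mult.commute)
    qed auto
    \<comment> \<open>The connecting segment now grows, but only linearly in \<open>r\<close>, while
      \<open>Re z <= R - k * r\<close> on all of it; the exponential wins.\<close>
    have lim0: "((\<lambda>r. F (of_real R + of_real r * ?w) - F (- of_real e + of_real r * (- 1))) \<longlongrightarrow> 0) at_top"
    proof (rule Lim_null_comparison)
      show "\<forall>\<^sub>F r in at_top. norm (F (of_real R + of_real r * ?w) - F (- of_real e + of_real r * (- 1)))
         \<le> exp (R - k * r) * (1 + R + e + r) * (R + e + 2 * r)"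
      proof (rule eventually_mono[OF eventually_gt_at_top[of 0]])
        fix r :: real assume r: "0 < r"
        let ?a = "- of_real e + of_real r * (- 1) :: complex" and ?b = "of_real R + of_real r * ?w"
        have "0 < sin \<theta>" using th pi_gt_zero by (intro sin_gt_zero) linarith+
        then have Imb: "0 < Im ?b" using r by simp
        have a: "?a = of_real (- e - r)" by simp
        have na: "norm ?a = e + r" unfolding a norm_of_real using e r by simp
        have Reb: "Re ?a \<le> R - k * r"
        proof -
          have "k * r \<le> r" using mult_right_mono[OF k(2) less_imp_le[OF r]] by (simp only: mult_1)
          moreover have "Re ?a = - e - r" by simp
          ultimately show ?thesis using e r R by linarith
        qed
        have seg: "0 \<le> Im z \<and> z \<noteq> 0 \<and> Re z \<le> R - k * r \<and> norm z \<le> R + e + r"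
          if "z \<in> closed_segment ?a ?b" for z
        proof -
          have "Re ?b \<le> R - k * r" using pt(2)[of r] r by (simp add: k_def)
          moreover have "norm ?a \<le> R + e + r" "norm ?b \<le> R + e + r"
            using na pt(3)[of r] R e r by linarith+
          moreover have "?a \<noteq> 0" using na e r by auto
          moreover have "Im ?a = 0" by simp
          ultimately show ?thesis using upper_segment_bounds[OF _ _ Imb Reb _ _ _ that] by blast
        qed
        have "norm (F ?b - F ?a) \<le> exp (R - k * r) * (R + e + r) powr p * norm (?b - ?a)"
        proof (rule segment_primitive_bound)
          fix z assume "z \<in> closed_segment ?a ?b"
          note s = seg[OF this]
          show "(F has_field_derivative ?f z) (at z)" using F s by blast
          show "norm (?f z) \<le> exp (R - k * r) * (R + e + r) powr p"
            using s p by (intro exp_powr_upper_bound) auto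
        qed
        also have "\<dots> \<le> exp (R - k * r) * (1 + R + e + r) * (R + e + 2 * r)"
        proof (intro mult_mono)
          show "(R + e + r) powr p \<le> 1 + R + e + r" using powr_le_one_plus[of "R + e + r" p] p R e r by simp
          show "norm (?b - ?a) \<le> R + e + 2 * r" using norm_triangle_ineq4[of ?b ?a] pt(3)[of r] na r by linarith
        qed (use R e r in auto)
        finally show "norm (F ?b - F ?a) \<le> exp (R - k * r) * (1 + R + e + r) * (R + e + 2 * r)" .
      qed
      show "((\<lambda>r. exp (R - k * r) * (1 + R + e + r) * (R + e + 2 * r)) \<longlongrightarrow> 0) at_top"
        using k by real_asymp
    qed
    have "F (of_real R) + ray_integral ?f ?w (of_real R) - (F (- of_real e) + N e) = 0"
      by (rule tendsto_unique[OF trivial_limit_at_top_linorder tendsto_diff[OF lim1 lim2] lim0])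
    then show ?thesis by simp
  qed
  define e where "e n = inverse (real (Suc n))" for n
  have e: "0 < e n" "e n \<le> 1" for n by (auto simp: e_def field_simps)
  have e0: "e \<longlonglongrightarrow> 0" unfolding e_def using LIMSEQ_inverse_real_of_nat .
  \<comment> \<open>Since \<open>p\<close> is positive, the integrand stays bounded near the branch
    point, and passing from \<open>e n\<close> to \<open>- e n\<close> changes the primitive by at
    most a multiple of \<open>e n\<close>.\<close>
  have small: "(\<lambda>n. F (- of_real (e n)) - F (of_real (e n))) \<longlonglongrightarrow> 0"
  proof (rule Lim_null_comparison)
    show "\<forall>\<^sub>F n in sequentially. norm (F (- of_real (e n)) - F (of_real (e n))) \<le> exp 1 * 4 * e n"
    proof (intro always_eventually allI)
      fix n
      let ?e = "complex_of_real (e n)"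
      have b: "norm (F b - F a) \<le> exp 1 * 1 * norm (b - a)"
        if "closed_segment a b \<subseteq> closed_segment ?e (?e * \<i>) \<union> closed_segment (?e * \<i>) (- ?e)" for a b
      proof (rule segment_primitive_bound)
        fix z assume "z \<in> closed_segment a b"
        then have s: "0 \<le> Im z" "z \<noteq> 0" "norm z \<le> e n" using small_segments[OF e(1)] that by blast+
        show "(F has_field_derivative ?f z) (at z)" using F s by blast
        have "norm (?f z) \<le> exp 1 * 1 powr p"
          using s p e(2)[of n] complex_Re_le_cmod[of z] by (intro exp_powr_upper_bound) auto
        then show "norm (?f z) \<le> exp 1 * 1" by simp
      qed
      have "norm (F (- ?e) - F ?e) \<le> norm (F (- ?e) - F (?e * \<i>)) + norm (F (?e * \<i>) - F ?e)"
        by (rule norm_diff_triangle_ineq[of "F (- ?e)" "F (?e * \<i>)" "F (?e * \<i>)" "F ?e", simplified])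
      also have "\<dots> \<le> exp 1 * 1 * norm (- ?e - ?e * \<i>) + exp 1 * 1 * norm (?e * \<i> - ?e)"
        by (intro add_mono b) auto
      also have "\<dots> \<le> exp 1 * 1 * (2 * e n) + exp 1 * 1 * (2 * e n)"
      proof (intro add_mono mult_left_mono)
        show "norm (- ?e - ?e * \<i>) \<le> 2 * e n" using norm_triangle_ineq4[of "- ?e" "?e * \<i>"] e(1)[of n] by (simp add: norm_mult)
        show "norm (?e * \<i> - ?e) \<le> 2 * e n" using norm_triangle_ineq4[of "?e * \<i>" "?e"] e(1)[of n] by (simp add: norm_mult)
      qed auto
      finally show "norm (F (- ?e) - F ?e) \<le> exp 1 * 4 * e n" by simp
    qed
    show "(\<lambda>n. exp 1 * 4 * e n) \<longlonglongrightarrow> 0" by (rule tendsto_mult_right_zero[OF e0])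
  qed
  have N: "Im (N (e n)) = - sin (pi * p) * (LINT r:{0..}|lborel. exp (- (e n + r)) * (e n + r) powr p)" for n
  proof -
    have "N (e n) = (LINT r:{0..}|lborel. - cis (pi * p) * of_real (exp (- (e n + r)) * (e n + r) powr p))"
      unfolding N_def ray_integral_def
    proof (rule set_lebesgue_integral_cong)
      show "\<forall>r. r \<in> {0..} \<longrightarrow> ?f (- of_real (e n) + of_real r * (- 1)) * (- 1)
        = - cis (pi * p) * of_real (exp (- (e n + r)) * (e n + r) powr p)"
      proof (intro allI impI)
        fix r :: real assume "r \<in> {0..}"
        then show "?f (- of_real (e n) + of_real r * (- 1)) * (- 1)
          = - cis (pi * p) * of_real (exp (- (e n + r)) * (e n + r) powr p)"
          using powr_minus_real[of "e n + r" p] e(1)[of n] by (simp flip: exp_of_real)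
      qed
    qed auto
    also have "\<dots> = - cis (pi * p) * (LINT r:{0..}|lborel. complex_of_real (exp (- (e n + r)) * (e n + r) powr p))"
      by (rule set_integral_mult_right)
    also have "\<dots> = - cis (pi * p) * of_real (LINT r:{0..}|lborel. exp (- (e n + r)) * (e n + r) powr p)"
      by (subst set_integral_complex_of_real) simp
    finally show ?thesis by simp
  qed
  have "(\<lambda>n. Im (F (- of_real (e n)) - F (of_real (e n))) + Im (N (e n)))
    \<longlonglongrightarrow> Im 0 + - sin (pi * p) * Gamma (1 + p)"
    unfolding N by (intro tendsto_add tendsto_mult tendsto_Im small tendsto_const)
      (use gamma_tail_tendsto[OF p] in \<open>simp add: e_def\<close>)
  moreover have "Im (F (- of_real (e n)) - F (of_real (e n))) + Im (N (e n)) = Im (ray_integral ?f ?w (of_real R))" for n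
  proof -
    \<comment> \<open>The last piece, between \<open>e n\<close> and \<open>R\<close>, lies on the
      positive axis, where the integrand is real.\<close>
    have "Im (F (of_real (e n))) = Im (F (of_real R))"
    proof (rule Im_const_of_real_derivative[of F ?f])
      show "?f (of_real x) \<in> \<real>" if "0 < x" for x
        using that by (auto simp: powr_of_real exp_of_real)
    qed (use F R e in auto)
    then show ?thesis using arg_cong[OF eq[OF e, of n], of Im] by simp
  qed
  ultimately have "Im (ray_integral ?f ?w (of_real R)) = - sin (pi * p) * Gamma (1 + p)"
    using LIMSEQ_unique[OF tendsto_const] by fastforce
  also have "\<dots> = pi * rGamma (- p)"
  proof -
    have "rGamma (complex_of_real (- p)) * rGamma (1 - complex_of_real (- p)) = sin (of_real pi * of_real (- p)) / of_real pi"
      by (rule rGamma_reflection_complex)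
    then have "complex_of_real (rGamma (- p) * rGamma (1 + p)) = complex_of_real (sin (pi * (- p)) / pi)"
      by (simp add: rGamma_complex_of_real[symmetric] sin_of_real[symmetric])
    then have "rGamma (- p) * rGamma (1 + p) = sin (pi * (- p)) / pi"
      by (simp only: of_real_eq_iff)
    moreover have "0 < Gamma (1 + p)" using p by (intro Gamma_real_pos) auto
    moreover have "rGamma (1 + p) = 1 / Gamma (1 + p)" by (simp add: rGamma_inverse_Gamma inverse_eq_divide)
    ultimately show ?thesis by (simp add: field_simps)
  qed
  finally show ?thesis .
qed

section \<open>Hankel's formula for all arguments from -1 on, and the decay of the reciprocal Gamma
  function\<close>

lemma powr_le_linear:
  assumes "0 < m" "m \<le> x" "q \<le> (1::real)"
  shows "x powr q \<le> (1 + m powr q) * (1 + x)"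
proof (cases "0 < q")
  case True
  have "x powr q \<le> 1 * (1 + x)" using powr_le_one_plus[of x q] assms True by simp
  also have "\<dots> \<le> (1 + m powr q) * (1 + x)" using assms by (intro mult_right_mono) auto
  finally show ?thesis .
next
  case False
  have "x powr q \<le> m powr q * 1" using assms False by (simp add: powr_mono2')
  also have "\<dots> \<le> (1 + m powr q) * (1 + x)" using assms by (intro mult_mono) auto
  finally show ?thesis .
qed

text \<open>The constants are uniform in the starting point \<open>a\<close>, as shifting the ray
  from \<open>R1\<close> to \<open>R2\<close> requires. The factor \<open>1 + norm z\<close> leaves
  room for every power with exponent at most 1.\<close>

lemma ray_exp_bound:
  assumes th: "pi / 2 < \<theta>" "\<theta> < pi" and R: "0 < R1"
  obtains A c where "0 < A" "0 < c" "\<And>a r z. R1 \<le> a \<Longrightarrow> a \<le> R2 \<Longrightarrow> 0 \<le> r \<Longrightarrow> z = of_real a + of_real r * cis \<theta> \<Longrightarrow>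
      exp (Re z) * (1 + norm z) \<le> A * exp (- c * r)"
proof -
  define k where "k = - cos \<theta>"
  have "cos \<theta> < cos (pi / 2)" using th by (intro cos_monotone_0_pi) auto
  then have k: "0 < k" by (simp add: k_def)
  define R where "R = max R1 R2"
  obtain A where A: "\<And>r. 0 \<le> r \<Longrightarrow> (1 + R + r) * exp (- k * r) \<le> A * exp (- (k / 2) * r)"
    using linear_exp_le_exp[OF k, of "1 + R"] R by (auto simp: R_def)
  have A0: "0 < A" using A[of 0] R by (simp add: R_def)
  show ?thesis
  proof (rule that[of "exp R * A" "k / 2"])
    fix a r z assume a: "R1 \<le> a" "a \<le> R2" and r: "0 \<le> (r::real)" and z: "z = of_real a + of_real r * cis \<theta>"
    have a0: "0 < a" "a \<le> R" using a R by (auto simp: R_def)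
    note pt = ray_points[OF th a0(1) r, folded z]
    have "exp (Re z) * (1 + norm z) \<le> exp (R - k * r) * (1 + R + r)"
      using pt a0 by (intro mult_mono) (auto simp: k_def)
    also have "\<dots> = exp R * ((1 + R + r) * exp (- k * r))" by (simp add: exp_diff exp_minus field_simps)
    also have "\<dots> \<le> exp R * (A * exp (- (k / 2) * r))" by (intro mult_left_mono A r) auto
    finally show "exp (Re z) * (1 + norm z) \<le> exp R * A * exp (- (k / 2) * r)" by simp
  qed (use k A0 in auto)
qed

lemma exp_powr_ray_le:
  assumes th: "pi / 2 < \<theta>" "\<theta> < pi" and R: "0 < R" "R \<le> a" "0 \<le> r" and q: "q \<le> 1"
    and z: "z = of_real a + of_real r * cis \<theta>"
  shows "exp (Re z) * norm z powr q \<le> (1 + (R * sin \<theta>) powr q) * (exp (Re z) * (1 + norm z))"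
proof -
  have s: "0 < sin \<theta>" using th pi_gt_zero by (intro sin_gt_zero) linarith+
  have "a * sin \<theta> \<le> norm z" using ray_points(4)[OF th _ R(3), of a] R z by simp
  moreover have "R * sin \<theta> \<le> a * sin \<theta>" using s R by (intro mult_right_mono) auto
  ultimately have "norm z powr q \<le> (1 + (R * sin \<theta>) powr q) * (1 + norm z)"
    using s R q by (intro powr_le_linear) (auto elim: order_trans[rotated])
  then have "exp (Re z) * norm z powr q \<le> exp (Re z) * ((1 + (R * sin \<theta>) powr q) * (1 + norm z))"
    by (intro mult_left_mono) auto
  then show ?thesis by (simp add: mult_ac)
qed

lemma exp_powr_ray_exp_bound:
  assumes th: "pi / 2 < \<theta>" "\<theta> < pi" and R: "0 < R" and q: "q \<le> 1"
  obtains A c where "0 < A" "0 < c" "\<And>r. 0 \<le> r \<Longrightarrow>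
     norm (exp (of_real R + of_real r * cis \<theta>) * (of_real R + of_real r * cis \<theta>) powr of_real q) \<le> A * exp (- c * r)"
proof -
  obtain A c where A: "0 < A" "0 < c" "\<And>r z. 0 \<le> r \<Longrightarrow> z = of_real R + of_real r * cis \<theta> \<Longrightarrow>
      exp (Re z) * (1 + norm z) \<le> A * exp (- c * r)"
    using ray_exp_bound[OF th R, of R] by (metis order_refl)
  show ?thesis
  proof (rule that[of "(1 + (R * sin \<theta>) powr q) * A" c])
    fix r :: real assume r: "0 \<le> r"
    define z where "z = of_real R + of_real r * cis \<theta>"
    have "norm (exp z * z powr of_real q) \<le> (1 + (R * sin \<theta>) powr q) * (exp (Re z) * (1 + norm z))"
      unfolding norm_exp_powr by (rule exp_powr_ray_le[OF th R order_refl r q z_def])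
    also have "\<dots> \<le> (1 + (R * sin \<theta>) powr q) * (A * exp (- c * r))"
      by (intro mult_left_mono A(3)[OF r z_def] add_nonneg_nonneg) auto
    finally show "norm (exp z * z powr of_real q) \<le> (1 + (R * sin \<theta>) powr q) * A * exp (- c * r)" by simp
  qed (use A in \<open>auto intro!: mult_pos_pos add_pos_nonneg\<close>)
qed

lemma continuous_on_exp_powr: "continuous_on (- \<real>\<^sub>\<le>\<^sub>0) (\<lambda>z::complex. exp z * z powr p)"
  by (auto intro!: holomorphic_on_imp_continuous_on holomorphic_intros)

lemma exp_powr_ray_integrable:
  assumes th: "pi / 2 < \<theta>" "\<theta> < pi" and R: "0 < R" and q: "q \<le> 1"
  shows "set_integrable lborel {0..} (\<lambda>r. exp (of_real R + of_real r * cis \<theta>) * (of_real R + of_real r * cis \<theta>) powr of_real q * cis \<theta>)"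
proof -
  obtain A c where "0 < c" "\<And>r. 0 \<le> r \<Longrightarrow>
     norm (exp (of_real R + of_real r * cis \<theta>) * (of_real R + of_real r * cis \<theta>) powr of_real q) \<le> A * exp (- c * r)"
    using exp_powr_ray_exp_bound[OF th R q] by metis
  from ray_integrable[OF continuous_on_ray[OF th R continuous_on_exp_powr] this(2,1)] show ?thesis .
qed

text \<open>The contribution of the lower ray is minus the conjugate of that of the upper one, so the imaginary part
  over the upper ray is the whole contour integral up to the factor \<open>2\<i>\<close>.\<close>

definition hankel :: "real \<Rightarrow> real \<Rightarrow> real \<Rightarrow> real" where
  "hankel \<theta> R z = Im (ray_integral (\<lambda>\<zeta>. exp \<zeta> * \<zeta> powr of_real (- z)) (cis \<theta>) (of_real R))"

text \<open>Integration by parts: \<open>g\<close> below is the derivative of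
  \<open>exp \<zeta> * \<zeta> powr (- z)\<close>. This function vanishes at the far end of the ray
  and is real at the starting point, so the boundary terms have no imaginary part.\<close>

lemma hankel_plus1:
  assumes th: "pi / 2 < \<theta>" "\<theta> < pi" and R: "0 < R" and z: "-1 \<le> z"
  shows "hankel \<theta> R z = z * hankel \<theta> R (z + 1)"
proof -
  let ?w = "cis \<theta>"
  define f where "f q \<zeta> = exp \<zeta> * \<zeta> powr of_real q" for q :: real and \<zeta> :: complex
  define g where "g \<zeta> = f (- z) \<zeta> + of_real (- z) * f (- (z + 1)) \<zeta>" for \<zeta>
  let ?p = "\<lambda>r. of_real R + of_real r * ?w"
  obtain A c where A: "0 < A" "0 < c" "\<And>r. 0 \<le> r \<Longrightarrow> norm (f (- z) (?p r)) \<le> A * exp (- c * r)"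
    using exp_powr_ray_exp_bound[OF th R, of "- z"] z unfolding f_def by (metis minus_le_iff)
  obtain B d where B: "0 < B" "0 < d" "\<And>r. 0 \<le> r \<Longrightarrow> norm (f (- (z + 1)) (?p r)) \<le> B * exp (- d * r)"
    using exp_powr_ray_exp_bound[OF th R, of "- (z + 1)"] z unfolding f_def by auto
  have "((\<lambda>r. f (- z) (?p r)) \<longlongrightarrow> f (- z) (of_real R) + ray_integral g ?w (of_real R)) at_top"
  proof (rule ray_primitive_tendsto)
    show "continuous_on {0..} (\<lambda>r. g (?p r))"
      unfolding g_def f_def
      by (rule continuous_on_ray[OF th R])
        (intro continuous_on_add continuous_on_mult continuous_on_const continuous_on_exp_powr)
    fix r :: real assume r: "0 \<le> r"
    have "norm (g (?p r)) \<le> norm (f (- z) (?p r)) + \<bar>z\<bar> * norm (f (- (z + 1)) (?p r))"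
      unfolding g_def by (rule order_trans[OF norm_triangle_ineq]) (simp add: norm_mult)
    also have "\<dots> \<le> A * exp (- c * r) + \<bar>z\<bar> * (B * exp (- d * r))"
      by (intro add_mono mult_left_mono A B r) auto
    also have "\<dots> \<le> A * exp (- min c d * r) + \<bar>z\<bar> * (B * exp (- min c d * r))"
      using A B r by (intro add_mono mult_left_mono) (auto intro: mult_right_mono)
    finally show "norm (g (?p r)) \<le> (A + \<bar>z\<bar> * B) * exp (- min c d * r)" by (simp add: algebra_simps)
    have "?p r \<notin> \<real>\<^sub>\<le>\<^sub>0" by (rule ray_points(5)[OF th R r])
    then have "((\<lambda>\<zeta>. \<zeta> powr of_real (- z)) has_field_derivative of_real (- z) * ?p r powr (of_real (- z) - 1)) (at (?p r))"
      by (rule has_field_derivative_powr)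
    moreover have "of_real (- z) - 1 = complex_of_real (- (z + 1))" by simp
    ultimately have "((\<lambda>\<zeta>. \<zeta> powr of_real (- z)) has_field_derivative of_real (- z) * ?p r powr of_real (- (z + 1))) (at (?p r))"
      by (simp only:)
    from DERIV_mult[OF DERIV_exp this]
    show "(f (- z) has_field_derivative g (?p r)) (at (?p r))"
      unfolding f_def g_def by (rule DERIV_cong) (simp only: mult_ac)
  qed (use A B in auto)
  moreover have "((\<lambda>r. f (- z) (?p r)) \<longlongrightarrow> 0) at_top"
  proof (rule Lim_null_comparison)
    show "\<forall>\<^sub>F r in at_top. norm (f (- z) (?p r)) \<le> A * exp (- c * r)"
      using eventually_mono[OF eventually_ge_at_top[of 0] A(3)] by simp
    show "((\<lambda>r. A * exp (- c * r)) \<longlongrightarrow> 0) at_top" using A by real_asymp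
  qed
  ultimately have "f (- z) (of_real R) + ray_integral g ?w (of_real R) = 0"
    using tendsto_unique trivial_limit_at_top_linorder by blast
  moreover have "Im (f (- z) (of_real R)) = 0"
    using R powr_of_real[of R "- z"] by (simp add: f_def exp_of_real flip: of_real_minus)
  ultimately have "Im (ray_integral g ?w (of_real R)) = 0"
    by (metis add_0 plus_complex.sel(2) zero_complex.sel(2))
  moreover have "ray_integral g ?w (of_real R) = ray_integral (f (- z)) ?w (of_real R)
      + of_real (- z) * ray_integral (f (- (z + 1))) ?w (of_real R)"
  proof -
    have i: "set_integrable lborel {0..} (\<lambda>r. f (- z) (?p r) * ?w)"
       "set_integrable lborel {0..} (\<lambda>r. f (- (z + 1)) (?p r) * ?w)"
      unfolding f_def using z by (intro exp_powr_ray_integrable th R; simp)+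
    have "ray_integral g ?w (of_real R) = (LINT r:{0..}|lborel. f (- z) (?p r) * ?w + of_real (- z) * (f (- (z + 1)) (?p r) * ?w))"
      unfolding ray_integral_def g_def by (simp only: distrib_right mult.assoc)
    also have "\<dots> = (LINT r:{0..}|lborel. f (- z) (?p r) * ?w) + (LINT r:{0..}|lborel. of_real (- z) * (f (- (z + 1)) (?p r) * ?w))"
      by (rule set_integral_add(2)[OF i(1) set_integrable_mult_right[OF i(2)]])
    finally show ?thesis by (simp only: ray_integral_def set_integral_mult_right)
  qed
  ultimately show ?thesis unfolding hankel_def f_def by simp
qed

text \<open>Both sides obey the recurrence of the reciprocal Gamma function, so the values on [-1,
  0) propagate upwards in unit steps. The only gap is the step from 0 to 1, where the recurrence
  reads 0 = 0. The value at 1 is obtained instead as a limit from within (0, 1), by dominated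
  convergence on one side and continuity of \<open>rGamma\<close> on the other.\<close>

lemma rGamma_hankel:
  assumes th: "pi / 2 < \<theta>" "\<theta> < pi" and R: "0 < R" and z: "-1 \<le> z"
  shows "hankel \<theta> R z = pi * rGamma z"
proof -
  let ?P = "\<lambda>z. hankel \<theta> R z = pi * rGamma z"
  have base: "?P z" if "-1 \<le> z" "z < 0" for z
    using Im_ray_integral_exp_powr[OF th R, of "- z"] that by (simp add: hankel_def)
  have step: "?P (z + 1)" if "?P z" "-1 \<le> z" "z \<noteq> 0" for z
  proof -
    have "z * hankel \<theta> R (z + 1) = z * (pi * rGamma (z + 1))"
      using hankel_plus1[OF th R that(2)] that(1) rGamma_plus1[of z] by (simp add: mult_ac)
    then show ?thesis using that(3) by simp
  qed
  have one: "?P 1"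
  proof -
    define e where "e n = 1 - inverse (real (Suc (Suc n)))" for n
    have e: "0 < e n" "e n < 1" for n by (auto simp: e_def field_simps)
    have e1: "e \<longlonglongrightarrow> 1"
      using tendsto_diff[OF tendsto_const[of 1] LIMSEQ_Suc[OF LIMSEQ_inverse_real_of_nat]]
      unfolding e_def by simp
    have eq: "hankel \<theta> R (e n) = pi * rGamma (e n)" for n
      using step[OF base, of "e n - 1"] e[of n] by simp
    have s: "0 < sin \<theta>" using th pi_gt_zero by (intro sin_gt_zero) linarith+
    obtain A c where A: "0 < A" "0 < c" "\<And>r z. 0 \<le> r \<Longrightarrow> z = of_real R + of_real r * cis \<theta> \<Longrightarrow>
      exp (Re z) * (1 + norm z) \<le> A * exp (- c * r)"
      using ray_exp_bound[OF th R, of R] by (metis order_refl)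
    let ?p = "\<lambda>r. of_real R + of_real r * cis \<theta>"
    \<comment> \<open>The dominating function must serve all exponents \<open>q\<close> in [-1, 0]
      at once. Whether or not \<open>R * sin \<theta>\<close> exceeds 1, its power with exponent
      \<open>q\<close> is at most 1 plus its reciprocal; a further 1 comes from
      \<open>exp_powr_ray_le\<close>.\<close>
    define B where "B = (2 + (R * sin \<theta>) powr - 1) * A"
    have bound: "norm (exp (?p r) * ?p r powr of_real q) \<le> B * exp (- c * r)"
      if q: "-1 \<le> q" "q \<le> 0" and r: "0 \<le> r" for q r
    proof -
      have "(R * sin \<theta>) powr q \<le> 1 + (R * sin \<theta>) powr - 1"
      proof (cases "R * sin \<theta> \<le> 1")
        case True
        have "(R * sin \<theta>) powr q \<le> (R * sin \<theta>) powr - 1"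
          using R s q True by (intro powr_mono') auto
        then show ?thesis by simp
      next
        case False
        then have "(R * sin \<theta>) powr q \<le> (R * sin \<theta>) powr 0" using q by (intro powr_mono) auto
        also have "\<dots> \<le> 1 + (R * sin \<theta>) powr - 1" using False by simp
        finally show ?thesis .
      qed
      moreover have "norm (exp (?p r) * ?p r powr of_real q)
          \<le> (1 + (R * sin \<theta>) powr q) * (exp (Re (?p r)) * (1 + norm (?p r)))"
        unfolding norm_exp_powr by (rule exp_powr_ray_le[OF th R order_refl r _ refl]) (use q in auto)
      moreover have "(1 + (R * sin \<theta>) powr q) * (exp (Re (?p r)) * (1 + norm (?p r)))
          \<le> (2 + (R * sin \<theta>) powr - 1) * (A * exp (- c * r))"
        using calculation(1) A by (intro mult_mono A(3)[OF r refl]) auto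
      ultimately show ?thesis unfolding B_def by simp
    qed
    have "(\<lambda>n. ray_integral (\<lambda>\<zeta>. exp \<zeta> * \<zeta> powr of_real (- e n)) (cis \<theta>) (of_real R))
        \<longlonglongrightarrow> ray_integral (\<lambda>\<zeta>. exp \<zeta> * \<zeta> powr of_real (- 1)) (cis \<theta>) (of_real R)"
      unfolding ray_integral_def set_lebesgue_integral_def
    proof (rule integral_dominated_convergence)
      show "integrable lborel (\<lambda>r. indicator {0..} r *\<^sub>R (B * exp (- c * r)))"
        using set_integrable_exp_minus[OF A(2), of B] by (simp add: set_integrable_def)
      have i: "integrable lborel (\<lambda>r. indicat_real {0..} r *\<^sub>R (exp (?p r) * ?p r powr of_real q * cis \<theta>))" if "q \<le> 1" for q
        using exp_powr_ray_integrable[OF th R that] by (simp add: set_integrable_def)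
      show "(\<lambda>r. indicat_real {0..} r *\<^sub>R (exp (?p r) * ?p r powr of_real (- 1) * cis \<theta>)) \<in> borel_measurable lborel"
        using borel_measurable_integrable[OF i[of "- 1"]] by simp
      show "(\<lambda>r. indicat_real {0..} r *\<^sub>R (exp (?p r) * ?p r powr of_real (- e n) * cis \<theta>)) \<in> borel_measurable lborel" for n
        using borel_measurable_integrable[OF i[of "- e n"]] e[of n] by simp
      show "AE r in lborel. (\<lambda>n. indicat_real {0..} r *\<^sub>R (exp (?p r) * ?p r powr of_real (- e n) * cis \<theta>))
           \<longlonglongrightarrow> indicat_real {0..} r *\<^sub>R (exp (?p r) * ?p r powr of_real (- 1) * cis \<theta>)"
      proof (intro AE_I2)
        fix r :: real
        have "(\<lambda>n. exp (?p r) * ?p r powr of_real (- e n) * cis \<theta>) \<longlonglongrightarrow> exp (?p r) * ?p r powr of_real (- 1) * cis \<theta>"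
          if "0 \<le> r"
        proof -
          have "?p r \<noteq> 0" using ray_points(5)[OF th R that] by auto
          moreover have "(\<lambda>n. of_real (e n) * Ln (?p r)) \<longlonglongrightarrow> Ln (?p r)"
            using tendsto_mult_right[OF tendsto_of_real[OF e1, where 'a = complex], of "Ln (?p r)"] by simp
          ultimately show ?thesis unfolding powr_def by (auto intro!: tendsto_intros)
        qed
        then show "(\<lambda>n. indicat_real {0..} r *\<^sub>R (exp (?p r) * ?p r powr of_real (- e n) * cis \<theta>))
           \<longlonglongrightarrow> indicat_real {0..} r *\<^sub>R (exp (?p r) * ?p r powr of_real (- 1) * cis \<theta>)"
          by (cases "0 \<le> r") (auto simp: indicator_def)
      qed
      show "AE r in lborel. norm (indicat_real {0..} r *\<^sub>R (exp (?p r) * ?p r powr of_real (- e n) * cis \<theta>))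
          \<le> indicat_real {0..} r *\<^sub>R (B * exp (- c * r))" for n
      proof (intro AE_I2)
        fix r :: real
        show "norm (indicat_real {0..} r *\<^sub>R (exp (?p r) * ?p r powr of_real (- e n) * cis \<theta>))
          \<le> indicat_real {0..} r *\<^sub>R (B * exp (- c * r))"
          using bound[of "- e n" r] e[of n] by (cases "0 \<le> r") (auto simp: indicator_def norm_mult)
      qed
    qed
    then have "(\<lambda>n. hankel \<theta> R (e n)) \<longlonglongrightarrow> hankel \<theta> R 1"
      unfolding hankel_def by (rule tendsto_Im)
    moreover have "(\<lambda>n. pi * rGamma (e n)) \<longlonglongrightarrow> pi * rGamma 1"
      by (intro tendsto_mult tendsto_const isCont_tendsto_compose[OF _ e1] continuous_intros)
    ultimately show ?thesis unfolding eq using LIMSEQ_unique by blast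
  qed
  have "\<forall>z. real n - 1 \<le> z \<and> z < real n \<longrightarrow> ?P z" for n
  proof (induction n)
    case 0 then show ?case using base by simp
  next
    case (Suc n)
    show ?case
    proof (intro allI impI)
      fix z assume z: "real (Suc n) - 1 \<le> z \<and> z < real (Suc n)"
      show "?P z"
      proof (cases "z = 1")
        case True then show ?thesis using one by simp
      next
        case False
        then show ?thesis using step[of "z - 1"] Suc.IH z by force
      qed
    qed
  qed
  from this[of "nat (\<lfloor>z\<rfloor> + 1)"] z show ?thesis
    using floor_correct[of z] by (auto simp: of_nat_nat)
qed

text \<open>The reciprocal Gamma function decays faster than any geometric rate. Any angle between
  \<pi> / 2 and \<pi> would do; \<open>R\<close> is chosen so that the ray keeps distance
  \<open>m\<close> from the origin, and the factor \<open>m powr (- z)\<close> then comes straight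
  out of the Hankel integrand.\<close>

lemma rGamma_le_powr:
  assumes "0 < (m::real)"
  obtains C where "0 < C" "\<And>z. 0 \<le> z \<Longrightarrow> \<bar>rGamma z\<bar> \<le> C * m powr (- z)"
proof -
  define \<theta> where "\<theta> = 3 * pi / 4"
  have th: "pi / 2 < \<theta>" "\<theta> < pi" using pi_gt_zero by (auto simp: \<theta>_def)
  have s: "0 < sin \<theta>" using th pi_gt_zero by (intro sin_gt_zero) linarith+
  define R where "R = m / sin \<theta>"
  have R: "0 < R" "R * sin \<theta> = m" using s assms by (auto simp: R_def)
  obtain A c where A: "0 < A" "0 < c" "\<And>r z. 0 \<le> r \<Longrightarrow> z = of_real R + of_real r * cis \<theta> \<Longrightarrow>
      exp (Re z) * (1 + norm z) \<le> A * exp (- c * r)"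
    using ray_exp_bound[OF th R(1), of R] by (metis order_refl)
  define I where "I = (LINT r:{0..}|lborel. exp (- c * r))"
  have I: "0 \<le> I" unfolding I_def set_lebesgue_integral_def by (rule integral_nonneg_AE) auto
  show ?thesis
  proof (rule that[of "A * I / pi + 1"])
    show "0 < A * I / pi + 1" using A I by (intro add_nonneg_pos) auto
    fix z :: real assume z: "0 \<le> z"
    have "\<bar>pi * rGamma z\<bar> = \<bar>hankel \<theta> R z\<bar>" using rGamma_hankel[OF th R(1), of z] z by simp
    also have "\<dots> \<le> norm (ray_integral (\<lambda>\<zeta>. exp \<zeta> * \<zeta> powr of_real (- z)) (cis \<theta>) (of_real R))"
      unfolding hankel_def by (rule abs_Im_le_cmod)
    also have "\<dots> \<le> A * m powr (- z) * norm (cis \<theta>) * (LINT r:{0..}|lborel. exp (- c * r))"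
    proof (rule norm_ray_integral_le[OF continuous_on_ray[OF th R(1) continuous_on_exp_powr] _ A(2)])
      fix r :: real assume r: "0 \<le> r"
      let ?p = "of_real R + of_real r * cis \<theta>"
      have "norm ?p powr (- z) \<le> m powr (- z)"
        using ray_points(4)[OF th R(1) r] R(2) assms z by (intro powr_mono2') auto
      then have "exp (Re ?p) * norm ?p powr (- z) \<le> exp (Re ?p) * (1 + norm ?p) * m powr (- z)"
        by (intro mult_mono) auto
      also have "\<dots> \<le> A * exp (- c * r) * m powr (- z)" by (intro mult_right_mono A(3)[OF r refl]) auto
      finally show "norm (exp ?p * ?p powr of_real (- z)) \<le> A * m powr (- z) * exp (- c * r)"
        unfolding norm_exp_powr by (simp add: mult_ac)
    qed
    finally have "\<bar>rGamma z\<bar> * pi \<le> A * I * m powr (- z)" by (simp add: abs_mult I_def mult_ac)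
    then have "\<bar>rGamma z\<bar> \<le> A * I / pi * m powr (- z)" by (simp add: field_simps)
    also have "\<dots> \<le> (A * I / pi + 1) * m powr (- z)" by (intro mult_right_mono) auto
    finally show "\<bar>rGamma z\<bar> \<le> (A * I / pi + 1) * m powr (- z)" .
  qed
qed

section \<open>Mittag-Leffler functions\<close>

lemma Im_Ln_halfplane:
  assumes th: "pi / 2 < \<theta>" "\<theta> < pi" and z: "Im (z * cnj (cis \<theta>)) < 0"
  shows "\<theta> - pi < Im (Ln z)" "Im (Ln z) < \<theta>" "z \<noteq> 0"
proof -
  show z0: "z \<noteq> 0" using z by auto
  define \<psi> where "\<psi> = Im (Ln z)"
  have \<psi>: "- pi < \<psi>" "\<psi> \<le> pi" using mpi_less_Im_Ln[OF z0] Im_Ln_le_pi[OF z0] by (auto simp: \<psi>_def)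
  have "z = exp (Ln z)" using z0 by simp
  then have zz: "z = of_real (exp (Re (Ln z))) * cis \<psi>"
    unfolding \<psi>_def by (metis exp_eq_polar)
  have "Im (z * cnj (cis \<theta>)) = exp (Re (Ln z)) * sin (\<psi> - \<theta>)"
    unfolding arg_cong[OF zz, of "\<lambda>u. Im (u * cnj (cis \<theta>))"] by (simp add: sin_diff algebra_simps)
  then have neg: "sin (\<psi> - \<theta>) < 0" using z by (simp add: mult_less_0_iff)
  show "\<psi> < \<theta>"
  proof (rule ccontr)
    assume "\<not> \<psi> < \<theta>"
    then have "0 \<le> sin (\<psi> - \<theta>)" using \<psi> th by (intro sin_ge_zero) auto
    then show False using neg by simp
  qed
  show "\<theta> - pi < \<psi>"
  proof (rule ccontr)
    assume "\<not> \<theta> - pi < \<psi>"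
    then have "0 \<le> sin (\<psi> - \<theta> + 2 * pi)" using \<psi> th by (intro sin_ge_zero) auto
    then show False using neg by simp
  qed
qed

text \<open>On the half-plane the argument of \<open>z\<close> is at most \<open>\<theta>\<close> in
  modulus, so that of \<open>z powr \<alpha>\<close> is at most
  \<open>\<alpha> * \<theta> < pi\<close>. The squared distance from \<open>z powr \<alpha>\<close>
  to \<open>- x\<close> is then bounded below by a quadratic form in
  \<open>norm z powr \<alpha>\<close> and \<open>x\<close>; completing the square in the one
  variable or in the other gives the two bounds.\<close>

lemma sector_resolvent_bound:
  fixes \<alpha> \<theta> x :: real
  assumes th: "pi / 2 < \<theta>" "\<theta> < pi" and a: "0 < \<alpha>" "\<alpha> * \<theta> < pi"
    and z: "Im (z * cnj (cis \<theta>)) < 0" and x: "0 \<le> x"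
  shows "sin (\<alpha> * \<theta>) * norm z powr \<alpha> \<le> norm (z powr of_real \<alpha> + of_real x)"
    "sin (\<alpha> * \<theta>) * \<bar>x\<bar> \<le> norm (z powr of_real \<alpha> + of_real x)"
proof -
  define \<psi> where "\<psi> = Im (Ln z)"
  note arg = Im_Ln_halfplane[OF th z, folded \<psi>_def]
  define \<rho> where "\<rho> = norm z powr \<alpha>"
  define \<kappa> where "\<kappa> = cos (\<alpha> * \<theta>)"
  have zz: "z powr of_real \<alpha> = of_real \<rho> * cis (\<alpha> * \<psi>)"
  proof -
    have "z powr of_real \<alpha> = of_real (exp (Re (of_real \<alpha> * Ln z))) * cis (Im (of_real \<alpha> * Ln z))"
      using arg(3) by (simp add: powr_def exp_eq_polar)
    then show ?thesis using arg(3) by (simp add: \<rho>_def \<psi>_def powr_def)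
  qed
  have "\<bar>\<psi>\<bar> \<le> \<theta>" using arg th by linarith
  then have "\<bar>\<alpha> * \<psi>\<bar> \<le> \<alpha> * \<theta>" using a by (simp add: abs_mult)
  then have "cos (\<alpha> * \<theta>) \<le> cos \<bar>\<alpha> * \<psi>\<bar>" using a by (intro cos_monotone_0_pi_le) auto
  then have k: "\<kappa> \<le> cos (\<alpha> * \<psi>)" by (simp add: \<kappa>_def)
  have s: "0 \<le> sin (\<alpha> * \<theta>)" using a th by (intro sin_ge_zero mult_nonneg_nonneg) auto
  have rho: "0 \<le> \<rho>" by (simp add: \<rho>_def)
  have "(norm (z powr of_real \<alpha> + of_real x))\<^sup>2 = (\<rho> * cos (\<alpha> * \<psi>) + x)\<^sup>2 + (\<rho> * sin (\<alpha> * \<psi>))\<^sup>2"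
    by (simp add: zz cmod_power2)
  also have "\<dots> = \<rho>\<^sup>2 * ((cos (\<alpha> * \<psi>))\<^sup>2 + (sin (\<alpha> * \<psi>))\<^sup>2) + 2 * (\<rho> * x) * cos (\<alpha> * \<psi>) + x\<^sup>2"
    by algebra
  also have "\<dots> \<ge> \<rho>\<^sup>2 + 2 * (\<rho> * x) * \<kappa> + x\<^sup>2"
    using x rho k by (simp add: mult_left_mono)
  finally have n: "\<rho>\<^sup>2 + 2 * (\<rho> * x) * \<kappa> + x\<^sup>2 \<le> (norm (z powr of_real \<alpha> + of_real x))\<^sup>2" .
  have ss: "(sin (\<alpha> * \<theta>))\<^sup>2 = 1 - \<kappa>\<^sup>2" by (simp add: \<kappa>_def sin_squared_eq)
  have "(sin (\<alpha> * \<theta>) * \<rho>)\<^sup>2 + (x + \<kappa> * \<rho>)\<^sup>2 = \<rho>\<^sup>2 + 2 * (\<rho> * x) * \<kappa> + x\<^sup>2"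
    unfolding power_mult_distrib ss by (simp add: power2_eq_square algebra_simps)
  then have "(sin (\<alpha> * \<theta>) * \<rho>)\<^sup>2 \<le> (norm (z powr of_real \<alpha> + of_real x))\<^sup>2"
    using n zero_le_power2[of "x + \<kappa> * \<rho>"] by linarith
  then show "sin (\<alpha> * \<theta>) * norm z powr \<alpha> \<le> norm (z powr of_real \<alpha> + of_real x)"
    unfolding \<rho>_def by (rule power2_le_imp_le) simp
  have "(sin (\<alpha> * \<theta>) * x)\<^sup>2 + (\<rho> + \<kappa> * x)\<^sup>2 = \<rho>\<^sup>2 + 2 * (\<rho> * x) * \<kappa> + x\<^sup>2"
    unfolding power_mult_distrib ss by (simp add: power2_eq_square algebra_simps)
  then have "(sin (\<alpha> * \<theta>) * x)\<^sup>2 \<le> (norm (z powr of_real \<alpha> + of_real x))\<^sup>2"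
    using n zero_le_power2[of "\<rho> + \<kappa> * x"] by linarith
  then have "sin (\<alpha> * \<theta>) * x \<le> norm (z powr of_real \<alpha> + of_real x)"
    by (rule power2_le_imp_le) simp
  then show "sin (\<alpha> * \<theta>) * \<bar>x\<bar> \<le> norm (z powr of_real \<alpha> + of_real x)" using x by simp
qed

lemma summable_mittag_leffler:
  fixes \<alpha> \<beta> z :: real
  assumes "0 < \<alpha>"
  shows "summable (\<lambda>k. \<bar>z ^ k * rGamma (real k * \<alpha> + \<beta>)\<bar>)"
proof -
  \<comment> \<open>Chosen so that \<open>\<bar>z\<bar> * m powr (- \<alpha>)\<close> is at most
    1/2: the bound on \<open>rGamma\<close> then dominates the series by a geometric one with ratio
    1/2.\<close>
  define m where "m = (2 * (\<bar>z\<bar> + 1)) powr (1 / \<alpha>)"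
  have m: "0 < m" "m powr - \<alpha> = 1 / (2 * (\<bar>z\<bar> + 1))"
    using assms by (auto simp: m_def powr_powr powr_minus field_simps)
  obtain C where C: "0 < C" "\<And>z. 0 \<le> z \<Longrightarrow> \<bar>rGamma z\<bar> \<le> C * m powr (- z)"
    using rGamma_le_powr[OF m(1)] by blast
  \<comment> \<open>From \<open>N\<close> on the argument of \<open>rGamma\<close> is nonnegative,
    as its bound demands.\<close>
  obtain N where N: "\<bar>\<beta>\<bar> / \<alpha> \<le> real N" using real_arch_simple by blast
  have "summable (\<lambda>k. C * m powr (- \<beta>) * (1 / 2) ^ k)" by (intro summable_mult summable_geometric) simp
  then show ?thesis
  proof (rule summable_comparison_test')
    fix k assume "N \<le> k"
    then have "\<bar>\<beta>\<bar> / \<alpha> \<le> real k" using N by linarith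
    then have "\<bar>\<beta>\<bar> \<le> real k * \<alpha>" using assms by (simp add: field_simps)
    then have "\<bar>rGamma (real k * \<alpha> + \<beta>)\<bar> \<le> C * m powr (- (real k * \<alpha> + \<beta>))" by (intro C) linarith
    also have "m powr (- (real k * \<alpha> + \<beta>)) = m powr (- \<beta>) * (m powr - \<alpha>) powr real k"
      by (simp add: powr_powr powr_add[symmetric] algebra_simps)
    also have "(m powr - \<alpha>) powr real k = (1 / (2 * (\<bar>z\<bar> + 1))) ^ k"
      unfolding m(2) by (rule powr_realpow) simp
    finally have "\<bar>z ^ k * rGamma (real k * \<alpha> + \<beta>)\<bar> \<le> \<bar>z\<bar> ^ k * (C * (m powr (- \<beta>) * (1 / (2 * (\<bar>z\<bar> + 1))) ^ k))"
      by (simp add: abs_mult power_abs mult_left_mono)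
    also have "\<dots> = C * m powr (- \<beta>) * (\<bar>z\<bar> * (1 / (2 * (\<bar>z\<bar> + 1)))) ^ k"
      by (simp add: power_mult_distrib power_divide)
    also have "\<dots> \<le> C * m powr (- \<beta>) * (1 / 2) ^ k"
      using C(1) by (intro mult_left_mono power_mono) (auto simp: field_simps)
    finally show "norm (\<bar>z ^ k * rGamma (real k * \<alpha> + \<beta>)\<bar>) \<le> C * m powr (- \<beta>) * (1 / 2) ^ k" by simp
  qed
qed

lemma mittag_leffler_sums:
  assumes "0 < \<alpha>"
  shows "(\<lambda>k. z ^ k * rGamma (real k * \<alpha> + \<beta>)) sums mittag_leffler \<alpha> \<beta> z"
proof -
  have "mittag_leffler \<alpha> \<beta> z = (\<Sum>k. z ^ k * rGamma (real k * \<alpha> + \<beta>))"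
    by (simp add: mittag_leffler_def rGamma_inverse_Gamma field_simps)
  then show ?thesis
    using summable_rabs_cancel[OF summable_mittag_leffler[OF assms]] by (simp add: summable_sums)
qed

text \<open>The condition \<open>0 <= \<beta>\<close> puts all arguments of \<open>rGamma\<close> in
  the series within reach of Hankel's formula, and \<open>\<alpha> - \<beta> <= 1\<close> keeps the
  power in the numerator of the kernel at most linear. For \<alpha> < 2 both hold at \<beta> = 1 and
  \<beta> = 2.\<close>

context
  fixes \<alpha> \<beta> \<theta> :: real
  assumes a: "0 < \<alpha>" "\<alpha> * \<theta> < pi" and th: "pi / 2 < \<theta>" "\<theta> < pi" and b: "0 \<le> \<beta>" "\<alpha> - \<beta> \<le> 1"
begin

lemma sin_sector_pos: "0 < sin (\<alpha> * \<theta>)"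
  using a th pi_gt_zero by (intro sin_gt_zero mult_pos_pos) linarith+

lemma ray_in_halfplane:
  assumes "0 < R"
  shows "Im ((of_real R + of_real r * cis \<theta>) * cnj (cis \<theta>)) < 0"
proof -
  have "Im ((of_real R + of_real r * cis \<theta>) * cnj (cis \<theta>)) = - (R * sin \<theta>)" by (simp add: algebra_simps)
  moreover have "0 < sin \<theta>" using th pi_gt_zero by (intro sin_gt_zero) linarith+
  ultimately show ?thesis using assms by simp
qed

lemma resolvent_nonzero:
  assumes "0 \<le> x" "Im (z * cnj (cis \<theta>)) < 0"
  shows "z powr of_real \<alpha> + of_real x \<noteq> 0"
proof
  assume "z powr of_real \<alpha> + of_real x = 0"
  then have "sin (\<alpha> * \<theta>) * norm z powr \<alpha> \<le> 0"
    using sector_resolvent_bound(1)[OF th a assms(2,1)] by simp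
  then show False using sin_sector_pos Im_Ln_halfplane(3)[OF th assms(2)] by (simp add: mult_le_0_iff)
qed

lemma halfplane_slit:
  assumes "Im (z * cnj (cis \<theta>)) < 0"
  shows "z \<notin> \<real>\<^sub>\<le>\<^sub>0"
proof
  assume "z \<in> \<real>\<^sub>\<le>\<^sub>0"
  then obtain y where y: "z = of_real y" "y \<le> 0" by (auto elim: nonpos_Reals_cases)
  have "0 < sin \<theta>" using th pi_gt_zero by (intro sin_gt_zero) linarith+
  then show False using assms y by (simp add: zero_less_mult_iff)
qed

definition ml_kernel :: "real \<Rightarrow> complex \<Rightarrow> complex" where
  "ml_kernel x z = exp z * z powr of_real (\<alpha> - \<beta>) / (z powr of_real \<alpha> + of_real x)"

lemma ml_kernel_holomorphic:
  assumes "0 \<le> x"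
  shows "ml_kernel x holomorphic_on {z. Im (z * cnj (cis \<theta>)) < 0}"
  unfolding ml_kernel_def
proof (intro holomorphic_intros)
  show "z powr of_real \<alpha> + of_real x \<noteq> 0" if "z \<in> {z. Im (z * cnj (cis \<theta>)) < 0}" for z
    using resolvent_nonzero[OF assms] that by simp
qed (use halfplane_slit in auto)

lemma ml_kernel_continuous:
  assumes "0 \<le> x" "0 < R"
  shows "continuous_on {0..} (\<lambda>r. ml_kernel x (of_real R + of_real r * cis \<theta>))"
proof (rule continuous_on_compose2[OF holomorphic_on_imp_continuous_on[OF ml_kernel_holomorphic[OF assms(1)]]])
  show "continuous_on {0..} (\<lambda>r. of_real R + of_real r * cis \<theta>)" by (intro continuous_intros)
qed (use ray_in_halfplane[OF assms(2)] in auto)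

text \<open>The two bounds have different tasks: the first is free of \<open>x\<close> and justifies
  moving the ray, the second carries the factor \<open>x\<close> and becomes the decay.\<close>

lemma norm_ml_kernel_le:
  assumes "0 \<le> x" and z: "Im (z * cnj (cis \<theta>)) < 0"
  shows "norm (ml_kernel x z) \<le> exp (Re z) * norm z powr (- \<beta>) / sin (\<alpha> * \<theta>)"
    "x * norm (ml_kernel x z) \<le> exp (Re z) * norm z powr (\<alpha> - \<beta>) / sin (\<alpha> * \<theta>)"
proof -
  have z0: "0 < norm z" using Im_Ln_halfplane(3)[OF th z] by simp
  let ?d = "norm (z powr of_real \<alpha> + of_real x)"
  have d: "0 < ?d" using resolvent_nonzero[OF assms] by simp
  have n: "norm (ml_kernel x z) = exp (Re z) * norm z powr (\<alpha> - \<beta>) / ?d"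
    unfolding ml_kernel_def norm_divide by (simp only: norm_exp_powr)
  have "exp (Re z) * norm z powr (\<alpha> - \<beta>) / ?d \<le> exp (Re z) * norm z powr (\<alpha> - \<beta>) / (sin (\<alpha> * \<theta>) * norm z powr \<alpha>)"
    using sector_resolvent_bound(1)[OF th a z assms(1)] sin_sector_pos z0 d
    by (intro divide_left_mono mult_pos_pos) auto
  also have "\<dots> = exp (Re z) * norm z powr (- \<beta>) / sin (\<alpha> * \<theta>)"
    using z0 by (simp add: powr_diff powr_minus field_simps)
  finally show "norm (ml_kernel x z) \<le> exp (Re z) * norm z powr (- \<beta>) / sin (\<alpha> * \<theta>)" unfolding n .
  have "sin (\<alpha> * \<theta>) * x \<le> ?d" using sector_resolvent_bound(2)[OF th a z assms(1)] assms(1) by simp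
  then have "sin (\<alpha> * \<theta>) * x * (exp (Re z) * norm z powr (\<alpha> - \<beta>)) \<le> ?d * (exp (Re z) * norm z powr (\<alpha> - \<beta>))"
    by (intro mult_right_mono) auto
  then show "x * norm (ml_kernel x z) \<le> exp (Re z) * norm z powr (\<alpha> - \<beta>) / sin (\<alpha> * \<theta>)"
    unfolding n using sin_sector_pos d by (simp add: field_simps)
qed

lemma Im_ml_kernel_shift:
  assumes x: "0 \<le> x" and R: "0 < R1" "R1 \<le> R2"
  shows "Im (ray_integral (ml_kernel x) (cis \<theta>) (of_real R1)) = Im (ray_integral (ml_kernel x) (cis \<theta>) (of_real R2))"
proof -
  obtain A c where A: "0 < A" "0 < c" "\<And>a r z. R1 \<le> a \<Longrightarrow> a \<le> R2 \<Longrightarrow> 0 \<le> r \<Longrightarrow> z = of_real a + of_real r * cis \<theta> \<Longrightarrow>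
      exp (Re z) * (1 + norm z) \<le> A * exp (- c * r)"
    using ray_exp_bound[OF th R(1), of R2] by metis
  define B where "B = (1 + (R1 * sin \<theta>) powr - \<beta>) / sin (\<alpha> * \<theta>)"
  have B: "0 \<le> B" unfolding B_def using sin_sector_pos by (intro divide_nonneg_pos add_nonneg_nonneg) auto
  show ?thesis
  proof (rule Im_ray_integral_shift[OF _ _ R ml_kernel_holomorphic[OF x] _ _ A(2)])
    show "ml_kernel x (of_real y) \<in> \<real>" if "0 < y" for y
      using that by (auto simp: ml_kernel_def powr_of_real exp_of_real simp flip: of_real_add of_real_diff)
    fix a r :: real assume ar: "R1 \<le> a" "a \<le> R2" "0 \<le> r"
    define z where "z = of_real a + of_real r * cis \<theta>"
    have a0: "0 < a" using ar R by simp
    have "norm (ml_kernel x z) \<le> exp (Re z) * norm z powr (- \<beta>) / sin (\<alpha> * \<theta>)"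
      by (rule norm_ml_kernel_le(1)[OF x]) (unfold z_def, rule ray_in_halfplane[OF a0])
    also have "\<dots> \<le> (1 + (R1 * sin \<theta>) powr - \<beta>) * (exp (Re z) * (1 + norm z)) / sin (\<alpha> * \<theta>)"
      using sin_sector_pos b by (intro divide_right_mono exp_powr_ray_le[OF th R(1) ar(1,3) _ z_def]) auto
    also have "\<dots> = B * (exp (Re z) * (1 + norm z))" by (simp add: B_def)
    also have "\<dots> \<le> B * (A * exp (- c * r))" by (intro mult_left_mono A(3)[OF ar z_def] B)
    finally show "norm (ml_kernel x (of_real a + of_real r * cis \<theta>)) \<le> B * A * exp (- c * r)"
      by (simp add: z_def)
  qed (use th pi_gt_zero in linarith)+
qed

text \<open>The condition on \<open>R\<close> says that \<open>x * norm z powr (- \<alpha>)\<close>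
  stays below a number \<open>q < 1\<close> on the whole ray. The terms
  \<open>(- x) ^ k * z powr (- k * \<alpha>)\<close> therefore form a geometric series that may be
  integrated term by term: its sum gives the kernel, and Hankel's formula evaluates each
  term.\<close>

lemma mittag_leffler_ray_large:
  assumes x: "0 \<le> x" and R: "0 < R" "x * (R * sin \<theta>) powr - \<alpha> < 1"
  shows "pi * mittag_leffler \<alpha> \<beta> (- x) = Im (ray_integral (ml_kernel x) (cis \<theta>) (of_real R))"
proof -
  define m where "m = R * sin \<theta>"
  have "0 < sin \<theta>" using th pi_gt_zero by (intro sin_gt_zero) linarith+
  then have m: "0 < m" using R by (simp add: m_def)
  define q where "q = x * m powr - \<alpha>"
  have q: "0 \<le> q" "q < 1" using R x by (auto simp: q_def m_def)
  let ?p = "\<lambda>r. of_real R + of_real r * cis \<theta>"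
  obtain A c where A: "0 < A" "0 < c" "\<And>r z. 0 \<le> r \<Longrightarrow> z = of_real R + of_real r * cis \<theta> \<Longrightarrow>
      exp (Re z) * (1 + norm z) \<le> A * exp (- c * r)"
    using ray_exp_bound[OF th R(1), of R] by (metis order_refl)
  define g where "g k r = of_real ((- x) ^ k) * (exp (?p r) * ?p r powr of_real (- (real k * \<alpha> + \<beta>)) * cis \<theta>)" for k r
  define f where "f k r = indicat_real {0..} r *\<^sub>R g k r" for k r
  have int: "integrable lborel (f k)" for k
    unfolding f_def g_def set_integrable_def[symmetric]
  proof (intro set_integrable_mult_right exp_powr_ray_integrable th R)
    have "0 \<le> real k * \<alpha>" using a by simp
    then show "- (real k * \<alpha> + \<beta>) \<le> 1" using b by linarith
  qed
  have bound: "norm (f k r) \<le> indicat_real {0..} r *\<^sub>R (q ^ k * (m powr - \<beta> * A) * exp (- c * r))" for k r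
  proof (cases "0 \<le> r")
    case True
    have "0 \<le> real k * \<alpha> + \<beta>" using a b by simp
    then have "norm (?p r) powr (- (real k * \<alpha> + \<beta>)) \<le> m powr (- (real k * \<alpha> + \<beta>))"
      by (intro powr_mono2' m ray_points(4)[OF th R(1) True, folded m_def]) linarith
    also have "\<dots> = (m powr - \<alpha>) ^ k * m powr - \<beta>"
      using m by (simp add: powr_add[symmetric] powr_powr algebra_simps flip: powr_realpow)
    finally have 1: "norm (?p r) powr (- (real k * \<alpha> + \<beta>)) \<le> (m powr - \<alpha>) ^ k * m powr - \<beta>" .
    have 2: "exp (Re (?p r)) \<le> A * exp (- c * r)"
      by (rule order_trans[OF _ A(3)[OF True refl]]) simp
    have "norm (g k r) = x ^ k * (exp (Re (?p r)) * norm (?p r) powr (- (real k * \<alpha> + \<beta>)))"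
      unfolding g_def norm_mult[of "of_real _"] norm_mult[of _ "cis _"] norm_exp_powr using x by (simp add: norm_power)
    also have "\<dots> \<le> x ^ k * ((A * exp (- c * r)) * ((m powr - \<alpha>) ^ k * m powr - \<beta>))"
      using x A(1) by (intro mult_left_mono mult_mono 1 2) auto
    also have "\<dots> = q ^ k * (m powr - \<beta> * A) * exp (- c * r)"
      by (simp add: q_def power_mult_distrib mult_ac)
    finally show ?thesis using True by (simp add: f_def)
  qed (simp add: f_def)
  have geo: "summable (\<lambda>k. q ^ k)" using q by (simp add: summable_geometric)
  have sumf: "(\<lambda>k. f k r) sums (indicat_real {0..} r *\<^sub>R (ml_kernel x (?p r) * cis \<theta>))" for r
  proof (cases "0 \<le> r")
    case True
    define z where "z = ?p r"
    have z0: "z \<noteq> 0" using ray_points(5)[OF th R(1) True] by (auto simp: z_def)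
    define w where "w = - of_real x * z powr of_real (- \<alpha>)"
    have "norm w = x * norm z powr - \<alpha>" using x by (simp add: w_def norm_mult norm_powr_real_powr')
    also have "\<dots> \<le> x * m powr - \<alpha>"
      using ray_points(4)[OF th R(1) True] m a x by (intro mult_left_mono powr_mono2') (auto simp: m_def z_def)
    finally have w: "norm w < 1" using q by (simp add: q_def)
    have "g k r = exp z * z powr of_real (- \<beta>) * cis \<theta> * w ^ k" for k
    proof -
      have "z powr of_real (- (real k * \<alpha> + \<beta>)) = z powr of_real (- \<beta>) * (z powr of_real (- \<alpha>)) ^ k"
        using z0 by (simp add: powr_def exp_add[symmetric] exp_of_nat_mult[symmetric] algebra_simps)
      then show ?thesis by (simp add: g_def w_def z_def power_mult_distrib power_minus' mult_ac)
    qed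
    then have "(\<lambda>k. g k r) sums (exp z * z powr of_real (- \<beta>) * cis \<theta> * (1 / (1 - w)))"
      using sums_mult[OF geometric_sums[OF w]] by presburger
    also have "exp z * z powr of_real (- \<beta>) * cis \<theta> * (1 / (1 - w)) = ml_kernel x z * cis \<theta>"
    proof -
      have za: "z powr of_real \<alpha> \<noteq> 0" using z0 by simp
      have "1 - w = (z powr of_real \<alpha> + of_real x) / z powr of_real \<alpha>"
        using za by (simp add: w_def powr_minus field_simps)
      moreover have "z powr of_real (\<alpha> - \<beta>) = z powr of_real (- \<beta>) * z powr of_real \<alpha>"
        using z0 by (simp add: powr_def exp_add[symmetric] algebra_simps)
      ultimately show ?thesis unfolding ml_kernel_def by simp
    qed
    finally show ?thesis using True by (simp add: f_def z_def)
  qed (simp add: f_def)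
  have I: "(\<lambda>k. integral\<^sup>L lborel (f k)) sums (\<integral>r. (\<Sum>k. f k r) \<partial>lborel)"
  proof (rule sums_integral[OF int])
    show "AE r in lborel. summable (\<lambda>k. norm (f k r))"
    proof (intro AE_I2)
      fix r :: real
      have "summable (\<lambda>k. indicat_real {0..} r *\<^sub>R (q ^ k * (m powr - \<beta> * A) * exp (- c * r)))"
        by (intro summable_scaleR_right summable_mult2 geo)
      then show "summable (\<lambda>k. norm (f k r))"
        by (rule summable_comparison_test'[where N = 0]) (use bound in simp)
    qed
    define J where "J = (\<integral>r. indicat_real {0..} r *\<^sub>R (m powr - \<beta> * A * exp (- c * r)) \<partial>lborel)"
    have "summable (\<lambda>k. q ^ k * J)" by (intro summable_mult2 geo)
    then show "summable (\<lambda>k. \<integral>r. norm (f k r) \<partial>lborel)"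
    proof (rule summable_comparison_test'[where N = 0])
      fix k
      have "(\<integral>r. norm (f k r) \<partial>lborel) \<le> (\<integral>r. indicat_real {0..} r *\<^sub>R (q ^ k * (m powr - \<beta> * A) * exp (- c * r)) \<partial>lborel)"
        using set_integrable_exp_minus[OF A(2), of "q ^ k * (m powr - \<beta> * A)"]
        by (intro integral_mono integrable_norm int bound) (simp add: set_integrable_def)
      also have "\<dots> = (\<integral>r. q ^ k * (indicat_real {0..} r *\<^sub>R (m powr - \<beta> * A * exp (- c * r))) \<partial>lborel)"
        by (intro Bochner_Integration.integral_cong) (auto simp: mult_ac)
      also have "\<dots> = q ^ k * J" unfolding J_def by (rule integral_mult_right_zero)
      finally show "norm (\<integral>r. norm (f k r) \<partial>lborel) \<le> q ^ k * J"
        by (simp add: integral_nonneg_AE)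
    qed
  qed
  moreover have "(\<integral>r. (\<Sum>k. f k r) \<partial>lborel) = ray_integral (ml_kernel x) (cis \<theta>) (of_real R)"
    unfolding ray_integral_def set_lebesgue_integral_def using sums_unique[OF sumf] by simp
  ultimately have "(\<lambda>k. Im (integral\<^sup>L lborel (f k))) sums Im (ray_integral (ml_kernel x) (cis \<theta>) (of_real R))"
    by (metis sums_Im)
  moreover have "Im (integral\<^sup>L lborel (f k)) = pi * ((- x) ^ k * rGamma (real k * \<alpha> + \<beta>))" for k
  proof -
    have "integral\<^sup>L lborel (f k) = (LINT r:{0..}|lborel. g k r)"
      unfolding f_def set_lebesgue_integral_def by simp
    also have "\<dots> = of_real ((- x) ^ k) * ray_integral (\<lambda>\<zeta>. exp \<zeta> * \<zeta> powr of_real (- (real k * \<alpha> + \<beta>))) (cis \<theta>) (of_real R)"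
      unfolding g_def ray_integral_def by (rule set_integral_mult_right)
    finally have "Im (integral\<^sup>L lborel (f k)) = (- x) ^ k * hankel \<theta> R (real k * \<alpha> + \<beta>)"
      unfolding hankel_def by simp
    moreover have "0 \<le> real k * \<alpha> + \<beta>" using a b by simp
    then have "hankel \<theta> R (real k * \<alpha> + \<beta>) = pi * rGamma (real k * \<alpha> + \<beta>)"
      by (intro rGamma_hankel[OF th R(1)]) linarith
    ultimately show ?thesis by (simp add: mult_ac)
  qed
  ultimately have "(\<lambda>k. pi * ((- x) ^ k * rGamma (real k * \<alpha> + \<beta>))) sums Im (ray_integral (ml_kernel x) (cis \<theta>) (of_real R))"
    by simp
  then show ?thesis
    using sums_unique2[OF sums_mult[OF mittag_leffler_sums[OF a(1), of "- x" \<beta>], of pi]] by simp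
qed

lemma mittag_leffler_ray:
  assumes x: "0 \<le> x"
  shows "pi * mittag_leffler \<alpha> \<beta> (- x) = Im (ray_integral (ml_kernel x) (cis \<theta>) 1)"
proof -
  have s: "0 < sin \<theta>" using th pi_gt_zero by (intro sin_gt_zero) linarith+
  have "((\<lambda>R. x * (R * sin \<theta>) powr - \<alpha>) \<longlongrightarrow> 0) at_top"
    using s a by real_asymp
  then have "\<forall>\<^sub>F R in at_top. x * (R * sin \<theta>) powr - \<alpha> < 1"
    by (rule order_tendstoD) simp
  then obtain R where "x * (R * sin \<theta>) powr - \<alpha> < 1" "1 \<le> R"
    using eventually_happens[OF eventually_conj[OF _ eventually_ge_at_top[of 1]]] by force
  then show ?thesis
    using mittag_leffler_ray_large[OF x, of R] Im_ml_kernel_shift[OF x, of 1 R] by simp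
qed

lemma mittag_leffler_decay_aux: "\<exists>K>0. \<forall>x\<ge>0. x * \<bar>mittag_leffler \<alpha> \<beta> (- x)\<bar> \<le> K"
proof -
  obtain A c where A: "0 < A" "0 < c" "\<And>r. 0 \<le> r \<Longrightarrow>
     norm (exp (of_real 1 + of_real r * cis \<theta>) * (of_real 1 + of_real r * cis \<theta>) powr of_real (\<alpha> - \<beta>)) \<le> A * exp (- c * r)"
    using exp_powr_ray_exp_bound[OF th zero_less_one b(2)] by metis
  define I where "I = (LINT r:{0..}|lborel. exp (- c * r))"
  have I: "0 \<le> I" unfolding I_def set_lebesgue_integral_def by (rule integral_nonneg_AE) auto
  define K where "K = A / sin (\<alpha> * \<theta>) * I / pi"
  \<comment> \<open>At this point \<open>K\<close> is only known to be nonnegative; adding 1 makes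
    the constant positive.\<close>
  have "x * \<bar>mittag_leffler \<alpha> \<beta> (- x)\<bar> \<le> K + 1" if x: "0 \<le> x" for x
  proof (cases "x = 0")
    case True
    then show ?thesis using I A sin_sector_pos by (auto simp: K_def intro!: add_nonneg_nonneg divide_nonneg_nonneg mult_nonneg_nonneg)
  next
    case False
    then have x0: "0 < x" using x by simp
    have "\<bar>pi * mittag_leffler \<alpha> \<beta> (- x)\<bar> \<le> norm (ray_integral (ml_kernel x) (cis \<theta>) 1)"
      unfolding mittag_leffler_ray[OF x] by (rule abs_Im_le_cmod)
    also have "\<dots> \<le> A / sin (\<alpha> * \<theta>) / x * norm (cis \<theta>) * I"
      unfolding I_def
    proof (rule norm_ray_integral_le[OF _ _ A(2)])
      show "continuous_on {0..} (\<lambda>r. ml_kernel x (1 + of_real r * cis \<theta>))"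
        using ml_kernel_continuous[OF x zero_less_one] by simp
      fix r :: real assume r: "0 \<le> r"
      define z where "z = of_real 1 + of_real r * cis \<theta>"
      have "x * norm (ml_kernel x z) \<le> exp (Re z) * norm z powr (\<alpha> - \<beta>) / sin (\<alpha> * \<theta>)"
        by (rule norm_ml_kernel_le(2)[OF x]) (unfold z_def, rule ray_in_halfplane[OF zero_less_one])
      also have "\<dots> \<le> A * exp (- c * r) / sin (\<alpha> * \<theta>)"
        using A(3)[OF r, folded z_def] sin_sector_pos unfolding norm_exp_powr by (intro divide_right_mono) auto
      finally have "norm (ml_kernel x z) * x \<le> A * exp (- c * r) / sin (\<alpha> * \<theta>)" by (simp add: mult.commute)
      then have "norm (ml_kernel x z) \<le> A * exp (- c * r) / sin (\<alpha> * \<theta>) / x"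
        using x0 by (subst pos_le_divide_eq) auto
      then show "norm (ml_kernel x (1 + of_real r * cis \<theta>)) \<le> A / sin (\<alpha> * \<theta>) / x * exp (- c * r)"
        by (simp add: z_def mult_ac)
    qed
    finally have "\<bar>pi * mittag_leffler \<alpha> \<beta> (- x)\<bar> \<le> A / sin (\<alpha> * \<theta>) / x * norm (cis \<theta>) * I" .
    then have "x * \<bar>mittag_leffler \<alpha> \<beta> (- x)\<bar> \<le> K"
      unfolding K_def using x0 sin_sector_pos by (simp add: abs_mult field_simps)
    then show ?thesis by simp
  qed
  moreover have "0 < K + 1" unfolding K_def using A I sin_sector_pos by (intro add_nonneg_pos divide_nonneg_nonneg mult_nonneg_nonneg) auto
  ultimately show ?thesis by blast
qed

end

lemma mittag_leffler_decay:
  assumes "1 < \<alpha>" "\<alpha> < 2" "0 \<le> \<beta>" "\<alpha> - \<beta> \<le> 1"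
  obtains K where "0 < K" "\<And>x. 0 \<le> x \<Longrightarrow> x * \<bar>mittag_leffler \<alpha> \<beta> (- x)\<bar> \<le> K"
proof -
  \<comment> \<open>The midpoint of the admissible interval, which is nonempty because \<alpha> < 2
    and lies below \<pi> because \<alpha> > 1.\<close>
  define \<theta> where "\<theta> = (pi / 2 + pi / \<alpha>) / 2"
  have "pi / 2 < pi / \<alpha>" using assms pi_gt_zero by (intro divide_strict_left_mono) auto
  moreover have "pi / \<alpha> < pi / 1" using assms pi_gt_zero by (intro divide_strict_left_mono) auto
  moreover from this have "pi / \<alpha> < pi" by simp
  ultimately have th: "pi / 2 < \<theta>" "\<theta> < pi" "\<theta> < pi / \<alpha>" unfolding \<theta>_def by argo+
  then have "\<alpha> * \<theta> < pi" using assms by (simp add: field_simps)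
  from mittag_leffler_decay_aux[OF _ this th(1,2) assms(3,4)] assms that show ?thesis by auto
qed

section \<open>Differentiation and fractional integration of the modes, and the Caputo
  equation\<close>

lemma mittag_leffler_0:
  assumes "0 < \<alpha>"
  shows "mittag_leffler \<alpha> \<beta> 0 = rGamma \<beta>"
  using sums_unique2[OF mittag_leffler_sums[OF assms, of 0 \<beta>]
      powser_sums_zero[of "\<lambda>k. rGamma (real k * \<alpha> + \<beta>)", unfolded mult.commute[of _ "0 ^ _"]]]
  by simp

text \<open>The relation matters more than the value of the derivative: it is the recurrence of
  \<open>rGamma\<close> applied to each coefficient of the power series, and it involves no division
  by \<open>y\<close>.\<close>

lemma mittag_leffler_derivative:
  assumes "0 < \<alpha>"
  obtains d where "(mittag_leffler \<alpha> \<beta> has_real_derivative d) (at y)"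
    "\<alpha> * y * d + (\<beta> - 1) * mittag_leffler \<alpha> \<beta> y = mittag_leffler \<alpha> (\<beta> - 1) y"
proof -
  define c where "c n = rGamma (real n * \<alpha> + \<beta>)" for n
  have ml: "(\<lambda>n. c n * z ^ n) sums mittag_leffler \<alpha> \<beta> z" for z
    using mittag_leffler_sums[OF assms, of z \<beta>] by (simp add: c_def mult.commute)
  then have ml_eq: "mittag_leffler \<alpha> \<beta> = (\<lambda>z. \<Sum>n. c n * z ^ n)" by (simp add: sums_iff fun_eq_iff)
  define d where "d = (\<Sum>n. diffs c n * y ^ n)"
  have sc: "summable (\<lambda>n. c n * z ^ n)" for z using ml sums_summable by blast
  have "((\<lambda>z. \<Sum>n. c n * z ^ n) has_real_derivative d) (at y)"
    unfolding d_def by (rule termdiffs_strong_converges_everywhere[OF sc])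
  moreover have "\<alpha> * y * d + (\<beta> - 1) * mittag_leffler \<alpha> \<beta> y = mittag_leffler \<alpha> (\<beta> - 1) y"
  proof -
    have "(\<lambda>n. diffs c n * y ^ n) sums d"
      unfolding d_def by (rule summable_sums[OF termdiff_converges_all[OF sc]])
    then have "(\<lambda>n. y * (real (Suc n) * c (Suc n) * y ^ n)) sums (y * d)"
      by (intro sums_mult) (simp add: diffs_def)
    then have "(\<lambda>n. real (Suc n) * c (Suc n) * y ^ Suc n) sums (y * d)"
      by (simp add: mult_ac)
    then have "(\<lambda>n. real n * c n * y ^ n) sums (y * d)"
      by (subst (asm) sums_Suc_iff) simp
    then have "(\<lambda>n. \<alpha> * (real n * c n * y ^ n) + (\<beta> - 1) * (c n * y ^ n)) sums (\<alpha> * (y * d) + (\<beta> - 1) * mittag_leffler \<alpha> \<beta> y)"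
      by (intro sums_add sums_mult ml)
    moreover have "\<alpha> * (real n * c n * y ^ n) + (\<beta> - 1) * (c n * y ^ n) = y ^ n * rGamma (real n * \<alpha> + (\<beta> - 1))" for n
    proof -
      have "rGamma (real n * \<alpha> + (\<beta> - 1)) = (real n * \<alpha> + (\<beta> - 1)) * c n"
        using rGamma_plus1[of "real n * \<alpha> + (\<beta> - 1)"] by (simp add: c_def)
      then show ?thesis by (simp only:) (simp add: algebra_simps)
    qed
    ultimately show ?thesis
      using sums_unique2[OF _ mittag_leffler_sums[OF assms, of y "\<beta> - 1"]] by (simp add: mult.assoc)
  qed
  ultimately show ?thesis using that by (simp add: ml_eq)
qed

lemma continuous_on_mittag_leffler: "0 < \<alpha> \<Longrightarrow> continuous_on UNIV (mittag_leffler \<alpha> \<beta>)"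
  by (intro continuous_at_imp_continuous_on ballI) (metis mittag_leffler_derivative DERIV_isCont)

text \<open>At \<open>s = 0\<close> this is \<open>0\<close> even for \<open>\<beta> = 1\<close>, where the limit is \<open>1\<close>.\<close>

definition ml_mode :: "real \<Rightarrow> real \<Rightarrow> real \<Rightarrow> real \<Rightarrow> real" where
  "ml_mode \<alpha> \<beta> \<mu> s = s powr (\<beta> - 1) * mittag_leffler \<alpha> \<beta> (- \<mu> * s powr \<alpha>)"

lemma ml_mode_sums:
  assumes "0 < \<alpha>" "0 < s"
  shows "(\<lambda>k. (- \<mu>) ^ k * rGamma (real k * \<alpha> + \<beta>) * s powr (real k * \<alpha> + \<beta> - 1)) sums ml_mode \<alpha> \<beta> \<mu> s"
proof -
  have "(\<lambda>k. s powr (\<beta> - 1) * ((- \<mu> * s powr \<alpha>) ^ k * rGamma (real k * \<alpha> + \<beta>))) sums ml_mode \<alpha> \<beta> \<mu> s"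
    unfolding ml_mode_def by (intro sums_mult mittag_leffler_sums assms)
  moreover have "s powr (\<beta> - 1) * ((- \<mu> * s powr \<alpha>) ^ k * rGamma (real k * \<alpha> + \<beta>))
      = (- \<mu>) ^ k * rGamma (real k * \<alpha> + \<beta>) * s powr (real k * \<alpha> + \<beta> - 1)" for k
  proof -
    have "(s powr \<alpha>) ^ k = s powr (real k * \<alpha>)" using assms by (simp add: powr_powr mult.commute flip: powr_realpow)
    then have "s powr (\<beta> - 1) * (s powr \<alpha>) ^ k = s powr (real k * \<alpha> + \<beta> - 1)"
      by (simp add: powr_add[symmetric] algebra_simps)
    then show ?thesis unfolding power_mult_distrib by (simp add: mult_ac)
  qed
  ultimately show ?thesis by (simp only:)
qed

lemma ml_mode_summable:
  assumes "0 < \<alpha>" "0 < s"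
  shows "summable (\<lambda>k. \<bar>(- \<mu>) ^ k * rGamma (real k * \<alpha> + \<beta>) * s powr (real k * \<alpha> + \<beta> - 1)\<bar>)"
proof -
  have "summable (\<lambda>k. s powr (\<beta> - 1) * \<bar>(- \<mu> * s powr \<alpha>) ^ k * rGamma (real k * \<alpha> + \<beta>)\<bar>)"
    by (intro summable_mult summable_mittag_leffler assms)
  moreover have "s powr (\<beta> - 1) * \<bar>(- \<mu> * s powr \<alpha>) ^ k * rGamma (real k * \<alpha> + \<beta>)\<bar>
      = \<bar>(- \<mu>) ^ k * rGamma (real k * \<alpha> + \<beta>) * s powr (real k * \<alpha> + \<beta> - 1)\<bar>" for k
  proof -
    have "(s powr \<alpha>) ^ k = s powr (real k * \<alpha>)" using assms by (simp add: powr_powr mult.commute flip: powr_realpow)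
    then have "s powr (\<beta> - 1) * (s powr \<alpha>) ^ k = s powr (real k * \<alpha> + \<beta> - 1)"
      by (simp add: powr_add[symmetric] algebra_simps)
    then show ?thesis unfolding power_mult_distrib abs_mult by (simp add: mult_ac)
  qed
  ultimately show ?thesis by (simp only:)
qed

text \<open>The powers \<open>s powr (c - 1) * rGamma c\<close> are differentiated by lowering
  \<open>c\<close> by one, and a mode is a series of such powers with
  \<open>c = k * \<alpha> + \<beta>\<close>. The factor \<open>s powr (\<beta> - 1)\<close> in the
  mode is there for this purpose.\<close>

lemma ml_mode_derivative:
  assumes "0 < \<alpha>" "0 < s"
  shows "(ml_mode \<alpha> \<beta> \<mu> has_real_derivative ml_mode \<alpha> (\<beta> - 1) \<mu> s) (at s)"
proof -
  let ?y = "- \<mu> * s powr \<alpha>"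
  obtain d where d: "(mittag_leffler \<alpha> \<beta> has_real_derivative d) (at ?y)"
    "\<alpha> * ?y * d + (\<beta> - 1) * mittag_leffler \<alpha> \<beta> ?y = mittag_leffler \<alpha> (\<beta> - 1) ?y"
    using mittag_leffler_derivative[OF assms(1)] by blast
  have "((\<lambda>s. - \<mu> * s powr \<alpha>) has_real_derivative - \<mu> * (\<alpha> * s powr (\<alpha> - 1))) (at s)"
    using assms by (intro DERIV_cmult has_real_derivative_powr)
  from DERIV_mult[OF has_real_derivative_powr[OF assms(2)] DERIV_chain2[OF d(1) this], of "\<beta> - 1"]
  have "(ml_mode \<alpha> \<beta> \<mu> has_real_derivative
      (\<beta> - 1) * s powr (\<beta> - 1 - 1) * mittag_leffler \<alpha> \<beta> ?y + d * (- \<mu> * (\<alpha> * s powr (\<alpha> - 1))) * s powr (\<beta> - 1)) (at s)"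
    unfolding ml_mode_def .
  also have "s powr (\<alpha> - 1) * s powr (\<beta> - 1) = s powr (\<beta> - 1 - 1) * s powr \<alpha>"
    by (simp add: powr_add[symmetric] algebra_simps)
  then have "(\<beta> - 1) * s powr (\<beta> - 1 - 1) * mittag_leffler \<alpha> \<beta> ?y + d * (- \<mu> * (\<alpha> * s powr (\<alpha> - 1))) * s powr (\<beta> - 1)
      = s powr (\<beta> - 1 - 1) * (\<alpha> * ?y * d + (\<beta> - 1) * mittag_leffler \<alpha> \<beta> ?y)"
    by (simp add: algebra_simps)
  also have "\<dots> = ml_mode \<alpha> (\<beta> - 1) \<mu> s" unfolding d(2) ml_mode_def by simp
  finally show ?thesis .
qed

text \<open>At a pole of Gamma the zeroth term of the series vanishes, and reindexing the others
  gains a factor \<open>- \<mu>\<close> and raises \<beta> by \<alpha>. Modes that differentiation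
  has brought to index 0 or -1 thus return to the positive indices \<alpha> and
  \<open>\<alpha> - 1\<close>, and the equation itself appears.\<close>

lemma ml_mode_shift:
  assumes "0 < \<alpha>" "0 < s" "rGamma \<beta> = 0"
  shows "ml_mode \<alpha> \<beta> \<mu> s = - \<mu> * ml_mode \<alpha> (\<alpha> + \<beta>) \<mu> s"
proof -
  have "(\<lambda>k. - \<mu> * ((- \<mu>) ^ k * rGamma (real k * \<alpha> + (\<alpha> + \<beta>)) * s powr (real k * \<alpha> + (\<alpha> + \<beta>) - 1))) sums (- \<mu> * ml_mode \<alpha> (\<alpha> + \<beta>) \<mu> s)"
    by (intro sums_mult ml_mode_sums assms)
  then have "(\<lambda>k. (- \<mu>) ^ Suc k * rGamma (real (Suc k) * \<alpha> + \<beta>) * s powr (real (Suc k) * \<alpha> + \<beta> - 1)) sums (- \<mu> * ml_mode \<alpha> (\<alpha> + \<beta>) \<mu> s)"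
    by (simp add: algebra_simps)
  then have "(\<lambda>k. (- \<mu>) ^ k * rGamma (real k * \<alpha> + \<beta>) * s powr (real k * \<alpha> + \<beta> - 1)) sums (- \<mu> * ml_mode \<alpha> (\<alpha> + \<beta>) \<mu> s)"
    by (subst (asm) sums_Suc_iff) (simp add: assms)
  from sums_unique2[OF ml_mode_sums[OF assms(1,2)] this] show ?thesis .
qed

lemma has_bochner_integral_beta:
  fixes a b t :: real
  assumes "0 < a" "0 < b" "0 < t"
  shows "has_bochner_integral lborel (\<lambda>s. indicator {0<..<t} s *\<^sub>R ((t - s) powr (b - 1) * s powr (a - 1))) (Beta a b * t powr (a + b - 1))"
proof -
  have h: "((\<lambda>s. s powr (a - 1) * (1 - s) powr (b - 1)) has_integral Beta a b) {0<..<1}"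
    using has_integral_Beta_real[OF assms(1,2)] by (simp add: has_integral_Icc_iff_Ioo)
  have "set_integrable lebesgue {0<..<1} (\<lambda>s. s powr (a - 1) * (1 - s) powr (b - 1))"
    by (rule nonnegative_absolutely_integrable_1) (use h in auto)
  then have i: "set_integrable lborel {0<..<1} (\<lambda>s. s powr (a - 1) * (1 - s) powr (b - 1))"
    unfolding set_integrable_def by (subst (asm) integrable_completion) simp_all
  have "has_bochner_integral lborel (\<lambda>u. indicator {0<..<1} u *\<^sub>R (u powr (a - 1) * (1 - u) powr (b - 1))) (Beta a b)"
    using i set_borel_integral_eq_integral(2)[OF i] integral_unique[OF h]
    unfolding set_integrable_def set_lebesgue_integral_def by (simp add: has_bochner_integral_iff)
  from has_bochner_integral_mult_right[OF this, of "t powr (a + b - 2)"]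
  have "has_bochner_integral lborel (\<lambda>u. t powr (a + b - 2) * (indicator {0<..<1} u *\<^sub>R (u powr (a - 1) * (1 - u) powr (b - 1))))
      (t powr (a + b - 2) * Beta a b)" by simp
  moreover have "t powr (a + b - 2) * (indicator {0<..<1} u *\<^sub>R (u powr (a - 1) * (1 - u) powr (b - 1)))
     = indicator {0<..<t} (0 + t * u) *\<^sub>R ((t - (0 + t * u)) powr (b - 1) * (0 + t * u) powr (a - 1))" for u
  proof (cases "0 < u \<and> u < 1")
    case True
    then have "(t - t * u) powr (b - 1) = t powr (b - 1) * (1 - u) powr (b - 1)"
      using assms powr_mult[of t "1 - u" "b - 1"] by (simp add: algebra_simps)
    moreover have "(t * u) powr (a - 1) = t powr (a - 1) * u powr (a - 1)"
      using assms True by (simp add: powr_mult)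
    moreover have "t powr (b - 1) * t powr (a - 1) = t powr (a + b - 2)"
      by (simp add: powr_add[symmetric] algebra_simps)
    ultimately show ?thesis using True assms by (simp add: mult_ac)
  next
    case False
    then show ?thesis using assms by (auto simp: indicator_def zero_less_mult_iff)
  qed
  moreover have "t powr (a + b - 2) * Beta a b = (Beta a b * t powr (a + b - 1)) /\<^sub>R \<bar>t\<bar>"
    using assms powr_add[of t "a + b - 2" 1] by (simp add: field_simps)
  ultimately show ?thesis
    using lborel_has_bochner_integral_real_affine_iff[of t "\<lambda>s. indicator {0<..<t} s *\<^sub>R ((t - s) powr (b - 1) * s powr (a - 1))" _ 0] assms
    by simp
qed

text \<open>Up to the factor \<open>Gamma \<delta>\<close> this is the Riemann-Liouville integral of
  order \<delta>, which raises the index by \<delta>. Each power contributes a Beta integral. The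
  integrals of the absolute values of the terms form, up to a factor, the absolutely convergent
  series of the new mode, so sum and integral may be exchanged.\<close>

lemma ml_mode_fractional_integral:
  assumes "0 < \<alpha>" "0 < \<gamma>" "0 < \<delta>" "0 < t"
  shows "has_bochner_integral lborel (\<lambda>s. indicator {0<..<t} s *\<^sub>R ((t - s) powr (\<delta> - 1) * ml_mode \<alpha> \<gamma> \<mu> s))
     (Gamma \<delta> * ml_mode \<alpha> (\<gamma> + \<delta>) \<mu> t)"
proof -
  define c where "c k = (- \<mu>) ^ k * rGamma (real k * \<alpha> + \<gamma>)" for k
  define f where "f k s = c k * (indicat_real {0<..<t} s *\<^sub>R ((t - s) powr (\<delta> - 1) * s powr (real k * \<alpha> + \<gamma> - 1)))" for k s
  have pos: "0 < real k * \<alpha> + \<gamma>" for k using assms by (simp add: add_nonneg_pos)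
  have B: "rGamma (real k * \<alpha> + \<gamma>) * Beta (real k * \<alpha> + \<gamma>) \<delta> = Gamma \<delta> * rGamma (real k * \<alpha> + \<gamma> + \<delta>)" for k
    using Gamma_real_pos[OF pos[of k]] by (simp add: Beta_def rGamma_inverse_Gamma field_simps)
  note beta = has_bochner_integral_beta[OF pos assms(3,4)]
  have has: "has_bochner_integral lborel (f k) ((- \<mu>) ^ k * (Gamma \<delta> * rGamma (real k * \<alpha> + (\<gamma> + \<delta>))) * t powr (real k * \<alpha> + (\<gamma> + \<delta>) - 1))" for k
  proof -
    have "has_bochner_integral lborel (f k) (c k * (Beta (real k * \<alpha> + \<gamma>) \<delta> * t powr (real k * \<alpha> + \<gamma> + \<delta> - 1)))"
      unfolding f_def by (intro has_bochner_integral_mult_right beta)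
    also have "c k * (Beta (real k * \<alpha> + \<gamma>) \<delta> * t powr (real k * \<alpha> + \<gamma> + \<delta> - 1))
       = (- \<mu>) ^ k * (rGamma (real k * \<alpha> + \<gamma>) * Beta (real k * \<alpha> + \<gamma>) \<delta>) * t powr (real k * \<alpha> + \<gamma> + \<delta> - 1)"
      by (simp add: c_def mult_ac)
    finally show ?thesis unfolding B by (simp add: add.assoc)
  qed
  have normf: "norm (f k s) = \<bar>c k\<bar> * (indicat_real {0<..<t} s *\<^sub>R ((t - s) powr (\<delta> - 1) * s powr (real k * \<alpha> + \<gamma> - 1)))" for k s
    by (simp add: f_def abs_mult indicator_def)
  have int_norm: "(\<integral>s. norm (f k s) \<partial>lborel) = \<bar>(- \<mu>) ^ k * rGamma (real k * \<alpha> + (\<gamma> + \<delta>)) * t powr (real k * \<alpha> + (\<gamma> + \<delta>) - 1)\<bar> * \<bar>Gamma \<delta>\<bar>" for k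
  proof -
    have "(\<integral>s. norm (f k s) \<partial>lborel) = \<bar>c k\<bar> * (Beta (real k * \<alpha> + \<gamma>) \<delta> * t powr (real k * \<alpha> + \<gamma> + \<delta> - 1))"
      unfolding normf using has_bochner_integral_integral_eq[OF has_bochner_integral_mult_right[OF beta]] by blast
    also have "\<dots> = \<bar>c k * (Beta (real k * \<alpha> + \<gamma>) \<delta> * t powr (real k * \<alpha> + \<gamma> + \<delta> - 1))\<bar>"
      using Gamma_real_pos[OF pos[of k]] Gamma_real_pos[OF assms(3)] Gamma_real_pos[OF add_pos_pos[OF pos[of k] assms(3)]]
      by (simp add: abs_mult Beta_def)
    also have "c k * (Beta (real k * \<alpha> + \<gamma>) \<delta> * t powr (real k * \<alpha> + \<gamma> + \<delta> - 1))
       = (- \<mu>) ^ k * (rGamma (real k * \<alpha> + \<gamma>) * Beta (real k * \<alpha> + \<gamma>) \<delta>) * t powr (real k * \<alpha> + \<gamma> + \<delta> - 1)"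
      by (simp add: c_def mult_ac)
    finally show ?thesis unfolding B by (simp add: abs_mult add.assoc mult_ac)
  qed
  have sumf: "(\<lambda>k. f k s) sums (indicator {0<..<t} s *\<^sub>R ((t - s) powr (\<delta> - 1) * ml_mode \<alpha> \<gamma> \<mu> s))" for s
  proof (cases "s \<in> {0<..<t}")
    case True
    then have "(\<lambda>k. (t - s) powr (\<delta> - 1) * (c k * s powr (real k * \<alpha> + \<gamma> - 1))) sums ((t - s) powr (\<delta> - 1) * ml_mode \<alpha> \<gamma> \<mu> s)"
      unfolding c_def by (intro sums_mult ml_mode_sums assms) auto
    then show ?thesis using True by (simp add: f_def mult_ac)
  qed (simp add: f_def)
  have i: "integrable lborel (f k)" for k using has by (rule integrable.intros)
  have AE: "AE s in lborel. summable (\<lambda>k. norm (f k s))"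
  proof (intro AE_I2)
    fix s :: real
    show "summable (\<lambda>k. norm (f k s))"
    proof (cases "s \<in> {0<..<t}")
      case True
      then have "summable (\<lambda>k. (t - s) powr (\<delta> - 1) * \<bar>c k * s powr (real k * \<alpha> + \<gamma> - 1)\<bar>)"
        unfolding c_def by (intro summable_mult ml_mode_summable assms) auto
      then show ?thesis using True by (simp add: f_def abs_mult mult_ac)
    qed (simp add: f_def)
  qed
  have sm: "summable (\<lambda>k. \<integral>s. norm (f k s) \<partial>lborel)"
    unfolding int_norm by (intro summable_mult2 ml_mode_summable assms)
  have "(\<lambda>k. integral\<^sup>L lborel (f k)) sums (\<integral>s. (\<Sum>k. f k s) \<partial>lborel)"
    by (rule sums_integral[OF i AE sm])
  moreover have "integral\<^sup>L lborel (f k) = Gamma \<delta> * ((- \<mu>) ^ k * rGamma (real k * \<alpha> + (\<gamma> + \<delta>)) * t powr (real k * \<alpha> + (\<gamma> + \<delta>) - 1))" for k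
    using has_bochner_integral_integral_eq[OF has[of k]] by (simp add: mult_ac)
  moreover have "(\<lambda>k. Gamma \<delta> * ((- \<mu>) ^ k * rGamma (real k * \<alpha> + (\<gamma> + \<delta>)) * t powr (real k * \<alpha> + (\<gamma> + \<delta>) - 1)))
      sums (Gamma \<delta> * ml_mode \<alpha> (\<gamma> + \<delta>) \<mu> t)"
    by (intro sums_mult ml_mode_sums assms)
  ultimately have "(\<integral>s. (\<Sum>k. f k s) \<partial>lborel) = Gamma \<delta> * ml_mode \<alpha> (\<gamma> + \<delta>) \<mu> t"
    using sums_unique2 by simp
  moreover have "integrable lborel (\<lambda>s. (\<Sum>k. f k s))"
    by (rule integrable_suminf[OF i AE sm])
  ultimately show ?thesis
    using sums_unique[OF sumf] by (simp add: has_bochner_integral_iff)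
qed

lemma powr_derivative_0:
  assumes "1 < (\<alpha>::real)"
  shows "((\<lambda>s. s powr \<alpha>) has_real_derivative 0) (at 0 within {0..t})"
proof -
  have "((\<lambda>s. s powr (\<alpha> - 1)) \<longlongrightarrow> 0) (at 0 within {0..t})"
  proof -
    have "((\<lambda>s::real. s powr (\<alpha> - 1)) \<longlongrightarrow> 0 powr (\<alpha> - 1)) (at 0 within {0..t})"
      by (rule tendsto_powr'[OF tendsto_ident_at tendsto_const])
        (use assms in \<open>auto simp: eventually_at_filter\<close>)
    then show ?thesis by simp
  qed
  moreover have "\<forall>\<^sub>F s in at 0 within {0..t}. s powr (\<alpha> - 1) = (s powr \<alpha> - 0 powr \<alpha>) / (s - 0)"
    using assms by (auto simp: eventually_at_filter powr_diff)
  ultimately show ?thesis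
    unfolding has_field_derivative_iff by (rule Lim_transform_eventually)
qed

text \<open>Since \<alpha> > 1, the argument \<open>- \<mu> * s powr \<alpha>\<close> is stationary
  at 0. Only the explicit factor \<open>s\<close> contributes, and it is multiplied by the value
  \<open>rGamma 2 = 1\<close> of the second function at 0.\<close>

lemma mittag_leffler_mode_derivative_0:
  assumes "1 < \<alpha>"
  shows "((\<lambda>s. A * mittag_leffler \<alpha> 1 (- \<mu> * s powr \<alpha>) + B * (s * mittag_leffler \<alpha> 2 (- \<mu> * s powr \<alpha>)))
    has_real_derivative B) (at 0 within {0..t})"
proof -
  have "0 < \<alpha>" using assms by simp
  have "((\<lambda>s. - \<mu> * s powr \<alpha>) has_real_derivative - \<mu> * 0) (at 0 within {0..t})"
    by (intro DERIV_cmult powr_derivative_0 assms)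
  then have y: "((\<lambda>s. - \<mu> * s powr \<alpha>) has_real_derivative 0) (at 0 within {0..t})" by simp
  have ml: "((\<lambda>s. mittag_leffler \<alpha> \<beta> (- \<mu> * s powr \<alpha>)) has_real_derivative 0) (at 0 within {0..t})" for \<beta>
  proof -
    obtain d where d: "(mittag_leffler \<alpha> \<beta> has_real_derivative d) (at (- \<mu> * 0 powr \<alpha>))"
      using mittag_leffler_derivative[OF \<open>0 < \<alpha>\<close>] by blast
    show ?thesis using DERIV_chain2[OF d y] by simp
  qed
  have "rGamma (2::real) = 1" using rGamma_plus1[of "1::real"] by simp
  then show ?thesis
    using \<open>0 < \<alpha>\<close>
    by (intro DERIV_cong[OF DERIV_add[OF DERIV_cmult[OF ml] DERIV_cmult[OF DERIV_mult[OF DERIV_ident ml]]]])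
      (simp add: mittag_leffler_0)
qed

text \<open>Two derivatives take the modes of index 1 and 2 to \<open>- \<mu>\<close> times those of
  index \<open>\<alpha> - 1\<close> and \<open>\<alpha>\<close>. The Caputo derivative then applies
  the fractional integral of order \<open>2 - \<alpha>\<close>, which restores the indices 1 and
  2.\<close>

lemma mittag_leffler_caputo:
  assumes a: "1 < \<alpha>" "\<alpha> < 2" and t: "0 < t"
    and w: "\<And>s. s \<in> {0..t} \<Longrightarrow> w s = A * mittag_leffler \<alpha> 1 (- \<mu> * s powr \<alpha>) + B * (s * mittag_leffler \<alpha> 2 (- \<mu> * s powr \<alpha>))"
  shows "has_caputo_derivative \<alpha> w (- \<mu> * w t) t"
proof -
  have a0: "0 < \<alpha>" using a by simp
  define v where "v s = A * mittag_leffler \<alpha> 1 (- \<mu> * s powr \<alpha>) + B * (s * mittag_leffler \<alpha> 2 (- \<mu> * s powr \<alpha>))" for s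
  \<comment> \<open>The second summand is not written as the mode of index 1, whose value at 0 is 0
    rather than 1. In this form \<open>w'\<close> is continuous at 0 with the value
    \<open>B\<close>.\<close>
  define w' where "w' s = A * (- \<mu> * ml_mode \<alpha> \<alpha> \<mu> s) + B * mittag_leffler \<alpha> 1 (- \<mu> * s powr \<alpha>)" for s
  define w'' where "w'' s = A * (- \<mu> * ml_mode \<alpha> (\<alpha> - 1) \<mu> s) + B * (- \<mu> * ml_mode \<alpha> \<alpha> \<mu> s)" for s
  have mode: "mittag_leffler \<alpha> 1 (- \<mu> * s powr \<alpha>) = ml_mode \<alpha> 1 \<mu> s" "s * mittag_leffler \<alpha> 2 (- \<mu> * s powr \<alpha>) = ml_mode \<alpha> 2 \<mu> s"
    if "0 < s" for s using that by (simp_all add: ml_mode_def)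
  have rG: "rGamma (0::real) = 0" "rGamma (-1::real) = 0"
    using rGamma_plus1[of "-1::real"] by simp_all
  have sh: "ml_mode \<alpha> 0 \<mu> s = - \<mu> * ml_mode \<alpha> \<alpha> \<mu> s" "ml_mode \<alpha> (- 1) \<mu> s = - \<mu> * ml_mode \<alpha> (\<alpha> - 1) \<mu> s"
    if "0 < s" for s
    using ml_mode_shift[OF a0 that rG(1)] ml_mode_shift[OF a0 that rG(2)] by simp_all
  have d1: "(ml_mode \<alpha> 1 \<mu> has_real_derivative - \<mu> * ml_mode \<alpha> \<alpha> \<mu> s) (at s)" if "0 < s" for s
    using ml_mode_derivative[OF a0 that, of 1 \<mu>] sh[OF that] by simp
  have d2: "(ml_mode \<alpha> 2 \<mu> has_real_derivative ml_mode \<alpha> 1 \<mu> s) (at s)" if "0 < s" for s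
    using ml_mode_derivative[OF a0 that, of 2 \<mu>] by simp
  have d0: "((\<lambda>s. - \<mu> * ml_mode \<alpha> \<alpha> \<mu> s) has_real_derivative - \<mu> * ml_mode \<alpha> (\<alpha> - 1) \<mu> s) (at s)" if "0 < s" for s
    by (intro DERIV_cmult ml_mode_derivative a0 that)
  have ev: "\<forall>\<^sub>F x in nhds s. 0 < x" if "0 < s" for s :: real
    using eventually_nhds_in_open[OF open_greaterThan, of s 0] that by simp
  have dv: "(v has_real_derivative w' s) (at s)" if s: "0 < s" for s
  proof -
    have "((\<lambda>s. A * ml_mode \<alpha> 1 \<mu> s + B * ml_mode \<alpha> 2 \<mu> s) has_real_derivative
        A * (- \<mu> * ml_mode \<alpha> \<alpha> \<mu> s) + B * ml_mode \<alpha> 1 \<mu> s) (at s)"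
      by (intro DERIV_add DERIV_cmult d1 d2 s)
    moreover have "\<forall>\<^sub>F s in nhds s. v s = A * ml_mode \<alpha> 1 \<mu> s + B * ml_mode \<alpha> 2 \<mu> s"
      using ev[OF s] by eventually_elim (simp only: v_def mode)
    ultimately show ?thesis
      using DERIV_cong_ev[OF refl _ refl, of v "\<lambda>s. A * ml_mode \<alpha> 1 \<mu> s + B * ml_mode \<alpha> 2 \<mu> s" s]
      by (simp only: w'_def mode[OF s])
  qed
  have D1: "(v has_real_derivative w' s) (at s within {0..t})" if "s \<in> {0..t}" for s
  proof (cases "s = 0")
    case True
    have "w' 0 = B" using a0 by (simp add: w'_def ml_mode_def mittag_leffler_0)
    then show ?thesis using mittag_leffler_mode_derivative_0[OF a(1), of A \<mu> B t] True
      by (simp add: v_def[abs_def])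
  next
    case False
    then show ?thesis using dv[of s] that by (auto intro: has_field_derivative_at_within)
  qed
  have D1: "(w has_real_derivative w' s) (at s within {0..t})" if "s \<in> {0..t}" for s
  proof (rule has_field_derivative_transform_within[OF D1[OF that] zero_less_one that])
    show "v x = w x" if "x \<in> {0..t}" for x using w[OF that] by (simp add: v_def)
  qed
  have D2: "continuous_on {0..t} w'"
  proof -
    have pw: "continuous_on {0..t} (\<lambda>s. s powr p)" if "0 < p" for p :: real
      using that by (intro continuous_on_powr' continuous_intros) auto
    have ml: "continuous_on {0..t} (\<lambda>s. mittag_leffler \<alpha> \<beta> (- \<mu> * s powr \<alpha>))" for \<beta>
      by (rule continuous_on_compose2[OF continuous_on_mittag_leffler[OF a0]])
        (intro continuous_intros pw a0, simp)
    show ?thesis unfolding w'_def ml_mode_def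
      by (intro continuous_on_add continuous_on_mult continuous_on_const ml pw) (use a in auto)
  qed
  have D3: "(w' has_real_derivative w'' s) (at s)" if s: "0 < s" for s
  proof -
    have "((\<lambda>s. A * (- \<mu> * ml_mode \<alpha> \<alpha> \<mu> s) + B * ml_mode \<alpha> 1 \<mu> s) has_real_derivative w'' s) (at s)"
      unfolding w''_def by (intro DERIV_add DERIV_cmult d1 d0 ml_mode_derivative a0 s)
    moreover have "\<forall>\<^sub>F s in nhds s. w' s = A * (- \<mu> * ml_mode \<alpha> \<alpha> \<mu> s) + B * ml_mode \<alpha> 1 \<mu> s"
      using ev[OF s] by eventually_elim (simp only: w'_def mode)
    ultimately show ?thesis
      using DERIV_cong_ev[OF refl _ refl, of w' "\<lambda>s. A * (- \<mu> * ml_mode \<alpha> \<alpha> \<mu> s) + B * ml_mode \<alpha> 1 \<mu> s" s] by simp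
  qed
  define I where "I \<gamma> s = indicator {0<..<t} s *\<^sub>R ((t - s) powr (2 - \<alpha> - 1) * ml_mode \<alpha> \<gamma> \<mu> s)" for \<gamma> s
  have I: "has_bochner_integral lborel (I \<gamma>) (Gamma (2 - \<alpha>) * ml_mode \<alpha> (\<gamma> + (2 - \<alpha>)) \<mu> t)" if "0 < \<gamma>" for \<gamma>
    unfolding I_def by (rule ml_mode_fractional_integral) (use a t that in auto)
  have "has_bochner_integral lborel (\<lambda>s. A * - \<mu> * I (\<alpha> - 1) s + B * - \<mu> * I \<alpha> s)
     (A * - \<mu> * (Gamma (2 - \<alpha>) * ml_mode \<alpha> (\<alpha> - 1 + (2 - \<alpha>)) \<mu> t) + B * - \<mu> * (Gamma (2 - \<alpha>) * ml_mode \<alpha> (\<alpha> + (2 - \<alpha>)) \<mu> t))"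
    by (intro has_bochner_integral_add has_bochner_integral_mult_right I) (use a in auto)
  moreover have "(\<lambda>s. A * - \<mu> * I (\<alpha> - 1) s + B * - \<mu> * I \<alpha> s) = (\<lambda>s. indicator {0<..<t} s *\<^sub>R ((t - s) powr (1 - \<alpha>) * w'' s))"
    by (rule ext) (simp add: I_def w''_def algebra_simps)
  moreover have "A * - \<mu> * (Gamma (2 - \<alpha>) * ml_mode \<alpha> (\<alpha> - 1 + (2 - \<alpha>)) \<mu> t) + B * - \<mu> * (Gamma (2 - \<alpha>) * ml_mode \<alpha> (\<alpha> + (2 - \<alpha>)) \<mu> t)
     = Gamma (2 - \<alpha>) * (- \<mu> * w t)"
    using w[of t] t mode[OF t] by (simp add: algebra_simps)
  ultimately have D4: "has_bochner_integral lborel (\<lambda>s. indicator {0<..<t} s *\<^sub>R ((t - s) powr (1 - \<alpha>) * w'' s)) (Gamma (2 - \<alpha>) * (- \<mu> * w t))"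
    by simp
  have G: "0 < Gamma (2 - \<alpha>)" using a by (intro Gamma_real_pos) simp
  show ?thesis
    unfolding has_caputo_derivative_def
  proof (intro exI conjI ballI)
    show "set_integrable lborel {0<..<t} (\<lambda>s. (t - s) powr (1 - \<alpha>) * w'' s)"
      using D4 unfolding set_integrable_def by (rule integrable.intros)
    show "- \<mu> * w t = 1 / Gamma (2 - \<alpha>) * (LINT s:{0<..<t}|lborel. (t - s) powr (1 - \<alpha>) * w'' s)"
      using has_bochner_integral_integral_eq[OF D4] G unfolding set_lebesgue_integral_def by simp
  qed (use D1 D2 D3 in auto)
qed

section \<open>The Hilbert space of square-integrable functions\<close>

lemma L2_measurable: "f \<in> L2 \<Omega> \<Longrightarrow> f \<in> borel_measurable (lebesgue_on \<Omega>)"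
  and L2_integrable: "f \<in> L2 \<Omega> \<Longrightarrow> integrable (lebesgue_on \<Omega>) (\<lambda>x. (norm (f x))\<^sup>2)"
  by (simp_all add: L2_def)

lemma L2_inner_integrable:
  assumes "f \<in> L2 \<Omega>" "g \<in> L2 \<Omega>"
  shows "integrable (lebesgue_on \<Omega>) (\<lambda>x. f x \<bullet> g x)"
proof (rule Bochner_Integration.integrable_bound)
  show "integrable (lebesgue_on \<Omega>) (\<lambda>x. (norm (f x))\<^sup>2 + (norm (g x))\<^sup>2)"
    by (intro Bochner_Integration.integrable_add L2_integrable assms)
  show "(\<lambda>x. f x \<bullet> g x) \<in> borel_measurable (lebesgue_on \<Omega>)"
    by (intro borel_measurable_inner L2_measurable assms)
  have "\<bar>a \<bullet> b\<bar> \<le> (norm a)\<^sup>2 + (norm b)\<^sup>2" for a b :: 'b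
  proof -
    have "2 * norm a * norm b \<le> (norm a)\<^sup>2 + (norm b)\<^sup>2" by (rule sum_squares_bound)
    moreover have "0 \<le> norm a * norm b" by simp
    ultimately show ?thesis using Cauchy_Schwarz_ineq2[of a b] by linarith
  qed
  then show "AE x in lebesgue_on \<Omega>. norm (f x \<bullet> g x) \<le> norm ((norm (f x))\<^sup>2 + (norm (g x))\<^sup>2)"
    by simp
qed

lemma L2_add:
  assumes "f \<in> L2 \<Omega>" "g \<in> L2 \<Omega>"
  shows "(\<lambda>x. f x + g x) \<in> L2 \<Omega>"
proof -
  have "(\<lambda>x. f x + g x) \<in> borel_measurable (lebesgue_on \<Omega>)"
    by (intro borel_measurable_add L2_measurable assms)
  moreover have "(norm (f x + g x))\<^sup>2 = (norm (f x))\<^sup>2 + 2 * (f x \<bullet> g x) + (norm (g x))\<^sup>2" for x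
    by (simp add: power2_norm_eq_inner inner_commute algebra_simps)
  then have "integrable (lebesgue_on \<Omega>) (\<lambda>x. (norm (f x + g x))\<^sup>2)"
    by (simp only:) (intro Bochner_Integration.integrable_add integrable_mult_right L2_integrable L2_inner_integrable assms)
  ultimately show ?thesis by (simp add: L2_def)
qed

lemma L2_scaleR:
  assumes "f \<in> L2 \<Omega>"
  shows "(\<lambda>x. c *\<^sub>R f x) \<in> L2 \<Omega>"
proof -
  have "(\<lambda>x. c *\<^sub>R f x) \<in> borel_measurable (lebesgue_on \<Omega>)"
    by (intro borel_measurable_scaleR borel_measurable_const L2_measurable assms)
  moreover have "integrable (lebesgue_on \<Omega>) (\<lambda>x. c\<^sup>2 * (norm (f x))\<^sup>2)"
    by (intro integrable_mult_right L2_integrable assms)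
  ultimately show ?thesis by (simp add: L2_def power_mult_distrib)
qed

lemma L2_mult: "f \<in> L2 \<Omega> \<Longrightarrow> (\<lambda>x. c * f x) \<in> L2 \<Omega>" for f :: "'a::euclidean_space \<Rightarrow> real"
  using L2_scaleR[of f \<Omega> c] by simp

lemma L2_diff:
  assumes "f \<in> L2 \<Omega>" "g \<in> L2 \<Omega>"
  shows "(\<lambda>x. f x - g x) \<in> L2 \<Omega>"
  using L2_add[OF assms(1) L2_scaleR[OF assms(2), of "-1"]] by simp

lemma L2_zero: "(\<lambda>x. 0) \<in> L2 \<Omega>"
  by (simp add: L2_def)

lemma L2_sum: "(\<And>j. j \<in> A \<Longrightarrow> f j \<in> L2 \<Omega>) \<Longrightarrow> (\<lambda>x. \<Sum>j\<in>A. f j x) \<in> L2 \<Omega>"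
  by (induction A rule: infinite_finite_induct) (auto intro!: L2_zero L2_add)

lemma l2_inner_commute: "l2_inner \<Omega> f g = l2_inner \<Omega> g f"
  by (simp add: l2_inner_def inner_commute)

lemma l2_inner_add_left:
  assumes "f \<in> L2 \<Omega>" "g \<in> L2 \<Omega>" "h \<in> L2 \<Omega>"
  shows "l2_inner \<Omega> (\<lambda>x. f x + g x) h = l2_inner \<Omega> f h + l2_inner \<Omega> g h"
  unfolding l2_inner_def inner_add_left
  by (intro Bochner_Integration.integral_add L2_inner_integrable assms)

lemma l2_inner_scaleR_left: "l2_inner \<Omega> (\<lambda>x. c *\<^sub>R f x) g = c * l2_inner \<Omega> f g"
  by (simp add: l2_inner_def)

lemma l2_inner_mult_left: "l2_inner \<Omega> (\<lambda>x. c * f x) g = c * l2_inner \<Omega> f g"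
  for f :: "'a::euclidean_space \<Rightarrow> real"
  using l2_inner_scaleR_left[of \<Omega> c f] by simp

lemma l2_inner_add_right:
  assumes "f \<in> L2 \<Omega>" "g \<in> L2 \<Omega>" "h \<in> L2 \<Omega>"
  shows "l2_inner \<Omega> h (\<lambda>x. f x + g x) = l2_inner \<Omega> h f + l2_inner \<Omega> h g"
  unfolding l2_inner_def inner_add_right
  by (intro Bochner_Integration.integral_add L2_inner_integrable assms)

lemma l2_inner_scaleR_right: "l2_inner \<Omega> g (\<lambda>x. c *\<^sub>R f x) = c * l2_inner \<Omega> g f"
  by (simp add: l2_inner_def)

lemma l2_inner_diff_left:
  assumes "f \<in> L2 \<Omega>" "g \<in> L2 \<Omega>" "h \<in> L2 \<Omega>"
  shows "l2_inner \<Omega> (\<lambda>x. f x - g x) h = l2_inner \<Omega> f h - l2_inner \<Omega> g h"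
  unfolding l2_inner_def inner_diff_left
  by (intro Bochner_Integration.integral_diff L2_inner_integrable assms)

lemma l2_inner_sum_left:
  assumes "\<And>j. j \<in> A \<Longrightarrow> f j \<in> L2 \<Omega>" "h \<in> L2 \<Omega>"
  shows "l2_inner \<Omega> (\<lambda>x. \<Sum>j\<in>A. f j x) h = (\<Sum>j\<in>A. l2_inner \<Omega> (f j) h)"
  unfolding l2_inner_def inner_sum_left
  by (intro Bochner_Integration.integral_sum L2_inner_integrable assms)

lemma l2_norm_nonneg: "0 \<le> l2_norm \<Omega> f"
  by (simp add: l2_norm_def)

lemma l2_norm_power2: "(l2_norm \<Omega> f)\<^sup>2 = l2_inner \<Omega> f f"
  by (simp add: l2_norm_def l2_inner_def power2_norm_eq_inner)

lemma quadratic_nonneg_discriminant: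
  fixes a b c :: real
  assumes "\<And>t. 0 \<le> a + 2 * t * b + t\<^sup>2 * c"
  shows "b\<^sup>2 \<le> a * c"
proof (cases "c = 0")
  case True
  have "b = 0"
  proof (rule ccontr)
    assume "b \<noteq> 0"
    then have "2 * (- (a + 1) / (2 * b)) * b = - (a + 1)" by (simp add: field_simps)
    then show False using assms[of "- (a + 1) / (2 * b)"] True by simp
  qed
  then show ?thesis using True by simp
next
  case False
  have "0 \<le> c"
  proof (rule ccontr)
    assume "\<not> 0 \<le> c"
    \<comment> \<open>With this \<open>t\<close> the quadratic term is
      \<open>- (\<bar>a\<bar> + 1)\<close>; the inequalities at \<open>t\<close> and
      \<open>- t\<close> have opposite linear terms and contradict each other.\<close>
    define t where "t = sqrt ((\<bar>a\<bar> + 1) / - c)"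
    have "t\<^sup>2 * c = - (\<bar>a\<bar> + 1)" using \<open>\<not> 0 \<le> c\<close> by (simp add: t_def field_simps)
    then have "0 \<le> a - (\<bar>a\<bar> + 1) + 2 * t * b" "0 \<le> a - (\<bar>a\<bar> + 1) - 2 * t * b"
      using assms[of t] assms[of "- t"] by simp_all
    then show False by linarith
  qed
  then have c: "0 < c" using False by simp
  have "0 \<le> a + 2 * (- b / c) * b + (- b / c)\<^sup>2 * c" by (rule assms)
  also have "\<dots> = a - b\<^sup>2 / c" using c by (simp add: power2_eq_square field_simps)
  finally show ?thesis using c by (simp add: field_simps)
qed

lemma l2_Cauchy_Schwarz:
  assumes f: "f \<in> L2 \<Omega>" and g: "g \<in> L2 \<Omega>"
  shows "\<bar>l2_inner \<Omega> f g\<bar> \<le> l2_norm \<Omega> f * l2_norm \<Omega> g"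
proof -
  have "(l2_inner \<Omega> f g)\<^sup>2 \<le> l2_inner \<Omega> f f * l2_inner \<Omega> g g"
  proof (rule quadratic_nonneg_discriminant)
    fix t
    note tg = L2_scaleR[OF g, of t]
    have "0 \<le> l2_inner \<Omega> (\<lambda>x. f x + t *\<^sub>R g x) (\<lambda>x. f x + t *\<^sub>R g x)"
      by (metis l2_norm_power2 zero_le_power2)
    also have "\<dots> = l2_inner \<Omega> f (\<lambda>x. f x + t *\<^sub>R g x) + t * l2_inner \<Omega> g (\<lambda>x. f x + t *\<^sub>R g x)"
      by (simp only: l2_inner_add_left[OF f tg L2_add[OF f tg]] l2_inner_scaleR_left)
    also have "l2_inner \<Omega> f (\<lambda>x. f x + t *\<^sub>R g x) = l2_inner \<Omega> f f + t * l2_inner \<Omega> f g"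
      by (simp only: l2_inner_add_right[OF f tg f] l2_inner_scaleR_right)
    also have "l2_inner \<Omega> g (\<lambda>x. f x + t *\<^sub>R g x) = l2_inner \<Omega> f g + t * l2_inner \<Omega> g g"
      by (simp only: l2_inner_add_right[OF f tg g] l2_inner_scaleR_right l2_inner_commute[of \<Omega> g f])
    finally show "0 \<le> l2_inner \<Omega> f f + 2 * t * l2_inner \<Omega> f g + t\<^sup>2 * l2_inner \<Omega> g g"
      by (simp add: power2_eq_square algebra_simps)
  qed
  also have "\<dots> = (l2_norm \<Omega> f * l2_norm \<Omega> g)\<^sup>2" by (simp add: power_mult_distrib l2_norm_power2)
  finally have "\<bar>l2_inner \<Omega> f g\<bar>\<^sup>2 \<le> (l2_norm \<Omega> f * l2_norm \<Omega> g)\<^sup>2" by simp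
  then show ?thesis by (rule power2_le_imp_le) (simp add: l2_norm_nonneg)
qed

lemma l2_norm_triangle:
  assumes f: "f \<in> L2 \<Omega>" and g: "g \<in> L2 \<Omega>"
  shows "l2_norm \<Omega> (\<lambda>x. f x + g x) \<le> l2_norm \<Omega> f + l2_norm \<Omega> g"
proof (rule power2_le_imp_le)
  have "(l2_norm \<Omega> (\<lambda>x. f x + g x))\<^sup>2 = l2_inner \<Omega> f (\<lambda>x. f x + g x) + l2_inner \<Omega> g (\<lambda>x. f x + g x)"
    by (simp only: l2_norm_power2 l2_inner_add_left[OF f g L2_add[OF f g]])
  also have "l2_inner \<Omega> f (\<lambda>x. f x + g x) = l2_inner \<Omega> f f + l2_inner \<Omega> f g"
    by (rule l2_inner_add_right[OF f g f])
  also have "l2_inner \<Omega> g (\<lambda>x. f x + g x) = l2_inner \<Omega> f g + l2_inner \<Omega> g g"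
    by (simp only: l2_inner_add_right[OF f g g] l2_inner_commute[of \<Omega> g f])
  also have "l2_inner \<Omega> f f + l2_inner \<Omega> f g + (l2_inner \<Omega> f g + l2_inner \<Omega> g g)
      \<le> (l2_norm \<Omega> f + l2_norm \<Omega> g)\<^sup>2"
    using l2_Cauchy_Schwarz[OF f g] by (simp add: power2_sum l2_norm_power2)
  finally show "(l2_norm \<Omega> (\<lambda>x. f x + g x))\<^sup>2 \<le> (l2_norm \<Omega> f + l2_norm \<Omega> g)\<^sup>2" .
qed (simp add: l2_norm_nonneg)

lemma l2_norm_minus_commute: "l2_norm \<Omega> (\<lambda>x. f x - g x) = l2_norm \<Omega> (\<lambda>x. g x - f x)"
  by (simp add: l2_norm_def norm_minus_commute)

lemma l2_norm_eq_0_AE: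
  assumes "f \<in> L2 \<Omega>" "l2_norm \<Omega> f = 0"
  shows "AE x in lebesgue_on \<Omega>. f x = 0"
proof -
  have "(LINT x|lebesgue_on \<Omega>. (norm (f x))\<^sup>2) = 0" using assms by (simp add: l2_norm_def)
  then show ?thesis
    using integral_nonneg_eq_0_iff_AE[OF L2_integrable[OF assms(1)]] by simp
qed

lemma l2_tendsto_unique_AE:
  assumes "l2_tendsto \<Omega> f v" "l2_tendsto \<Omega> f w"
  shows "AE x in lebesgue_on \<Omega>. v x = w x"
proof -
  have L: "f n \<in> L2 \<Omega>" "v \<in> L2 \<Omega>" "w \<in> L2 \<Omega>" for n using assms by (auto simp: l2_tendsto_def)
  have "l2_norm \<Omega> (\<lambda>x. v x - w x) \<le> l2_norm \<Omega> (\<lambda>x. f n x - v x) + l2_norm \<Omega> (\<lambda>x. f n x - w x)" for n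
    using l2_norm_triangle[OF L2_diff[OF L(2,1)] L2_diff[OF L(1,3)], of n n]
    by (simp add: l2_norm_minus_commute[of \<Omega> v])
  moreover have "(\<lambda>n. l2_norm \<Omega> (\<lambda>x. f n x - v x) + l2_norm \<Omega> (\<lambda>x. f n x - w x)) \<longlonglongrightarrow> 0 + 0"
    using assms by (intro tendsto_add) (auto simp: l2_tendsto_def)
  ultimately have "l2_norm \<Omega> (\<lambda>x. v x - w x) \<le> 0 + 0"
    by (intro LIMSEQ_le_const) auto
  then have "l2_norm \<Omega> (\<lambda>x. v x - w x) = 0" using l2_norm_nonneg[of \<Omega> "\<lambda>x. v x - w x"] by simp
  from l2_norm_eq_0_AE[OF L2_diff[OF L(2,3)] this] show ?thesis by simp
qed

lemma l2_tendsto_inner: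
  assumes f: "l2_tendsto \<Omega> f w" and g: "g \<in> L2 \<Omega>"
  shows "(\<lambda>n. l2_inner \<Omega> (f n) g) \<longlonglongrightarrow> l2_inner \<Omega> w g"
proof -
  have L: "f n \<in> L2 \<Omega>" "w \<in> L2 \<Omega>" for n using f by (auto simp: l2_tendsto_def)
  have "(\<lambda>n. l2_inner \<Omega> (f n) g - l2_inner \<Omega> w g) \<longlonglongrightarrow> 0"
  proof (rule Lim_null_comparison)
    show "\<forall>\<^sub>F n in sequentially. norm (l2_inner \<Omega> (f n) g - l2_inner \<Omega> w g) \<le> l2_norm \<Omega> (\<lambda>x. f n x - w x) * l2_norm \<Omega> g"
      using l2_Cauchy_Schwarz[OF L2_diff[OF L] g] by (simp add: l2_inner_diff_left[OF L g])
    show "(\<lambda>n. l2_norm \<Omega> (\<lambda>x. f n x - w x) * l2_norm \<Omega> g) \<longlonglongrightarrow> 0"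
      using f by (intro tendsto_mult_left_zero) (simp add: l2_tendsto_def)
  qed
  then show ?thesis by (simp add: LIM_zero_iff)
qed

lemma l2_norm_triangle_diff:
  assumes "f \<in> L2 \<Omega>" "g \<in> L2 \<Omega>"
  shows "\<bar>l2_norm \<Omega> f - l2_norm \<Omega> g\<bar> \<le> l2_norm \<Omega> (\<lambda>x. f x - g x)"
  using l2_norm_triangle[OF L2_diff[OF assms] assms(2)] l2_norm_triangle[OF L2_diff[OF assms(2,1)] assms(1)]
  by (simp add: l2_norm_minus_commute[of \<Omega> g])

lemma l2_tendsto_norm:
  assumes "l2_tendsto \<Omega> f w"
  shows "(\<lambda>n. l2_norm \<Omega> (f n)) \<longlonglongrightarrow> l2_norm \<Omega> w"
proof -
  have L: "f n \<in> L2 \<Omega>" "w \<in> L2 \<Omega>" for n using assms by (auto simp: l2_tendsto_def)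
  have "(\<lambda>n. l2_norm \<Omega> (f n) - l2_norm \<Omega> w) \<longlonglongrightarrow> 0"
  proof (rule Lim_null_comparison)
    show "\<forall>\<^sub>F n in sequentially. norm (l2_norm \<Omega> (f n) - l2_norm \<Omega> w) \<le> l2_norm \<Omega> (\<lambda>x. f n x - w x)"
      using l2_norm_triangle_diff[OF L] by simp
    show "(\<lambda>n. l2_norm \<Omega> (\<lambda>x. f n x - w x)) \<longlonglongrightarrow> 0" using assms by (simp add: l2_tendsto_def)
  qed
  then show ?thesis by (simp add: LIM_zero_iff)
qed

text \<open>As the measure is finite, Cauchy-Schwarz against the constant 1 makes the sequence
  Cauchy in the mean, and a subsequence converges almost everywhere. Fatou's lemma along this
  subsequence bounds the distance from each late member to the limit.\<close>

lemma l2_complete: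
  fixes f :: "nat \<Rightarrow> 'a::euclidean_space \<Rightarrow> real"
  assumes fin: "finite_measure (lebesgue_on \<Omega>)" and L: "\<And>n. f n \<in> L2 \<Omega>"
    and C: "\<And>e. 0 < e \<Longrightarrow> \<exists>N. \<forall>i\<ge>N. \<forall>j\<ge>N. l2_norm \<Omega> (\<lambda>x. f i x - f j x) < e"
  obtains w where "l2_tendsto \<Omega> f w"
proof -
  let ?M = "lebesgue_on \<Omega>"
  interpret finite_measure ?M by (rule fin)
  have one: "(\<lambda>x. 1::real) \<in> L2 \<Omega>" by (simp add: L2_def)
  have int: "integrable ?M (f n)" for n using L2_inner_integrable[OF L one] by simp
  have absL: "(\<lambda>x. \<bar>g x\<bar>) \<in> L2 \<Omega>" if "g \<in> L2 \<Omega>" for g :: "'a \<Rightarrow> real"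
    using that unfolding L2_def by auto
  have L1: "(LINT x|?M. norm (f i x - f j x)) \<le> l2_norm \<Omega> (\<lambda>x. f i x - f j x) * l2_norm \<Omega> (\<lambda>x. 1::real)" for i j
    using l2_Cauchy_Schwarz[OF absL[OF L2_diff[OF L L]] one, of i j]
    by (simp add: l2_inner_def l2_norm_def)
  obtain r where r: "strict_mono r" "AE x in ?M. Cauchy (\<lambda>i. f (r i) x)"
  proof (rule cauchy_L1_AE_cauchy_subseq[of ?M f])
    fix e :: real assume "0 < e"
    \<comment> \<open>The added 1 keeps the divisor positive even if the domain is a null
      set.\<close>
    define K where "K = l2_norm \<Omega> (\<lambda>x. 1::real) + 1"
    have K: "0 < K" using l2_norm_nonneg[of \<Omega> "\<lambda>x. 1::real"] by (simp add: K_def)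
    obtain N where N: "\<And>i j. N \<le> i \<Longrightarrow> N \<le> j \<Longrightarrow> l2_norm \<Omega> (\<lambda>x. f i x - f j x) < e / K"
      using C[of "e / K"] \<open>0 < e\<close> K by auto
    have "(LINT x|?M. norm (f i x - f j x)) < e" if "N \<le> i" "N \<le> j" for i j
    proof -
      have "l2_norm \<Omega> (\<lambda>x. f i x - f j x) * l2_norm \<Omega> (\<lambda>x. 1::real) \<le> l2_norm \<Omega> (\<lambda>x. f i x - f j x) * K"
        by (intro mult_left_mono l2_norm_nonneg) (simp add: K_def)
      also have "\<dots> < e / K * K" by (intro mult_strict_right_mono N that K)
      also have "\<dots> = e" using K by simp
      finally show ?thesis using L1[of i j] by linarith
    qed
    then show "\<exists>N. \<forall>i\<ge>N. \<forall>j\<ge>N. (LINT x|?M. norm (f i x - f j x)) < e" by blast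
  qed (use int in auto)
  have [measurable]: "f n \<in> borel_measurable ?M" for n by (rule L2_measurable[OF L])
  define w where "w x = lim (\<lambda>i. f (r i) x)" for x
  have wm: "w \<in> borel_measurable ?M" unfolding w_def by measurable
  have lim: "AE x in ?M. (\<lambda>i. f (r i) x) \<longlonglongrightarrow> w x"
    using r(2) by eventually_elim (simp add: w_def Cauchy_convergent_iff convergent_LIMSEQ_iff)
  have key: "(\<lambda>x. f n x - w x) \<in> L2 \<Omega> \<and> l2_norm \<Omega> (\<lambda>x. f n x - w x) \<le> e"
    if e: "0 < e" and n: "\<And>j. N \<le> j \<Longrightarrow> l2_norm \<Omega> (\<lambda>x. f n x - f j x) < e" for n N e
  proof -
    have nn: "(\<integral>\<^sup>+x. ennreal ((f n x - f j x)\<^sup>2) \<partial>?M) = ennreal ((l2_norm \<Omega> (\<lambda>x. f n x - f j x))\<^sup>2)" for j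
      using L2_integrable[OF L2_diff[OF L L], of n j]
      by (subst nn_integral_eq_integral) (auto simp: l2_norm_def)
    have "(\<integral>\<^sup>+x. ennreal ((f n x - w x)\<^sup>2) \<partial>?M) = (\<integral>\<^sup>+x. liminf (\<lambda>i. ennreal ((f n x - f (r i) x)\<^sup>2)) \<partial>?M)"
    proof (rule nn_integral_cong_AE)
      show "AE x in ?M. ennreal ((f n x - w x)\<^sup>2) = liminf (\<lambda>i. ennreal ((f n x - f (r i) x)\<^sup>2))"
        using lim
      proof eventually_elim
        case (elim x)
        have "(\<lambda>i. ennreal ((f n x - f (r i) x)\<^sup>2)) \<longlonglongrightarrow> ennreal ((f n x - w x)\<^sup>2)"
          by (intro tendsto_ennrealI tendsto_intros elim)
        from lim_imp_Liminf[OF sequentially_bot this] show ?case by simp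
      qed
    qed
    also have "\<dots> \<le> liminf (\<lambda>i. \<integral>\<^sup>+x. ennreal ((f n x - f (r i) x)\<^sup>2) \<partial>?M)"
      by (rule nn_integral_liminf) measurable
    also have "\<dots> \<le> ennreal (e\<^sup>2)"
    proof (rule Liminf_le)
      show "\<forall>\<^sub>F i in sequentially. (\<integral>\<^sup>+x. ennreal ((f n x - f (r i) x)\<^sup>2) \<partial>?M) \<le> ennreal (e\<^sup>2)"
        unfolding nn
      proof (rule eventually_sequentiallyI[of N])
        fix i assume "N \<le> i"
        then have "N \<le> r i" using seq_suble[OF r(1), of i] by linarith
        then show "ennreal ((l2_norm \<Omega> (\<lambda>x. f n x - f (r i) x))\<^sup>2) \<le> ennreal (e\<^sup>2)"
          using n[of "r i"] l2_norm_nonneg by (intro ennreal_leI power_mono) auto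
      qed
    qed simp
    finally have fin: "(\<integral>\<^sup>+x. ennreal ((f n x - w x)\<^sup>2) \<partial>?M) \<le> ennreal (e\<^sup>2)" .
    have mm: "(\<lambda>x. f n x - w x) \<in> borel_measurable ?M" using wm by measurable
    have i: "integrable ?M (\<lambda>x. (f n x - w x)\<^sup>2)"
    proof (rule integrableI_bounded)
      show "(\<lambda>x. (f n x - w x)\<^sup>2) \<in> borel_measurable ?M" using mm by measurable
      show "(\<integral>\<^sup>+x. ennreal (norm ((f n x - w x)\<^sup>2)) \<partial>?M) < \<infinity>"
        using fin by (simp add: le_less_trans[OF _ ennreal_less_top])
    qed
    then have "(\<lambda>x. f n x - w x) \<in> L2 \<Omega>" using mm by (simp add: L2_def)
    moreover have "(l2_norm \<Omega> (\<lambda>x. f n x - w x))\<^sup>2 \<le> e\<^sup>2"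
      using fin nn_integral_eq_integral[OF i] by (simp add: l2_norm_def)
    then have "l2_norm \<Omega> (\<lambda>x. f n x - w x) \<le> e" by (rule power2_le_imp_le) (use e in simp)
    ultimately show ?thesis by simp
  qed
  have wL: "w \<in> L2 \<Omega>"
  proof -
    obtain N where "\<forall>i\<ge>N. \<forall>j\<ge>N. l2_norm \<Omega> (\<lambda>x. f i x - f j x) < 1" using C[of 1] by auto
    then have "(\<lambda>x. f N x - w x) \<in> L2 \<Omega>" using key[of 1 N N] by auto
    from L2_diff[OF L[of N] this] show ?thesis by simp
  qed
  have "(\<lambda>n. l2_norm \<Omega> (\<lambda>x. f n x - w x)) \<longlonglongrightarrow> 0"
  proof (rule LIMSEQ_I)
    fix e :: real assume e: "0 < e"
    then obtain N where N: "\<And>i j. N \<le> i \<Longrightarrow> N \<le> j \<Longrightarrow> l2_norm \<Omega> (\<lambda>x. f i x - f j x) < e / 2"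
      using C[of "e / 2"] by auto
    have "norm (l2_norm \<Omega> (\<lambda>x. f n x - w x) - 0) < e" if "N \<le> n" for n
      using key[of "e / 2" N n] N[OF that] e l2_norm_nonneg[of \<Omega> "\<lambda>x. f n x - w x"] by force
    then show "\<exists>N. \<forall>n\<ge>N. norm (l2_norm \<Omega> (\<lambda>x. f n x - w x) - 0) < e" by blast
  qed
  then show ?thesis using that wL L by (auto simp: l2_tendsto_def)
qed

section \<open>Orthonormal expansions\<close>

context
  fixes \<Omega> :: "'a::euclidean_space set" and \<phi> :: "nat \<Rightarrow> 'a \<Rightarrow> real"
  assumes \<phi>: "\<And>j. \<phi> j \<in> L2 \<Omega>"
    and orthonormal: "\<And>i j. l2_inner \<Omega> (\<phi> i) (\<phi> j) = (if i = j then 1 else 0)"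
begin

lemma orthonormal_sum_L2: "(\<lambda>x. \<Sum>j\<in>A. c j * \<phi> j x) \<in> L2 \<Omega>"
  by (intro L2_sum L2_mult \<phi>)

lemma orthonormal_sum_inner:
  assumes "finite A"
  shows "l2_inner \<Omega> (\<lambda>x. \<Sum>j\<in>A. c j * \<phi> j x) (\<phi> k) = (if k \<in> A then c k else 0)"
proof -
  have "l2_inner \<Omega> (\<lambda>x. \<Sum>j\<in>A. c j * \<phi> j x) (\<phi> k) = (\<Sum>j\<in>A. l2_inner \<Omega> (\<lambda>x. c j * \<phi> j x) (\<phi> k))"
    by (intro l2_inner_sum_left L2_mult \<phi>)
  also have "\<dots> = (\<Sum>j\<in>A. if j = k then c j else 0)"
    by (intro sum.cong refl) (simp add: l2_inner_mult_left orthonormal)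
  also have "\<dots> = (if k \<in> A then c k else 0)" using assms by simp
  finally show ?thesis .
qed

lemma orthonormal_sum_norm:
  assumes "finite A"
  shows "(l2_norm \<Omega> (\<lambda>x. \<Sum>j\<in>A. c j * \<phi> j x))\<^sup>2 = (\<Sum>j\<in>A. (c j)\<^sup>2)"
proof -
  let ?s = "\<lambda>x. \<Sum>j\<in>A. c j * \<phi> j x"
  have "(l2_norm \<Omega> ?s)\<^sup>2 = (\<Sum>j\<in>A. l2_inner \<Omega> (\<lambda>x. c j * \<phi> j x) ?s)"
    unfolding l2_norm_power2 by (intro l2_inner_sum_left orthonormal_sum_L2 L2_mult \<phi>)
  also have "\<dots> = (\<Sum>j\<in>A. (c j)\<^sup>2)"
  proof (intro sum.cong refl)
    fix j assume "j \<in> A"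
    then show "l2_inner \<Omega> (\<lambda>x. c j * \<phi> j x) ?s = (c j)\<^sup>2"
      using orthonormal_sum_inner[OF assms, of c j]
      by (simp add: l2_inner_mult_left l2_inner_commute[of \<Omega> "\<phi> j"] power2_eq_square)
  qed
  finally show ?thesis .
qed

lemma l2_sums_coefficient:
  assumes "l2_sums \<Omega> (\<lambda>j x. c j * \<phi> j x) w"
  shows "l2_inner \<Omega> w (\<phi> k) = c k"
proof -
  have "(\<lambda>n. l2_inner \<Omega> (\<lambda>x. \<Sum>j<n. c j * \<phi> j x) (\<phi> k)) \<longlonglongrightarrow> l2_inner \<Omega> w (\<phi> k)"
    using l2_tendsto_inner[OF assms[unfolded l2_sums_def] \<phi>] .
  moreover have "(\<lambda>n. l2_inner \<Omega> (\<lambda>x. \<Sum>j<n. c j * \<phi> j x) (\<phi> k)) \<longlonglongrightarrow> c k"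
  proof (rule tendsto_eventually)
    show "\<forall>\<^sub>F n in sequentially. l2_inner \<Omega> (\<lambda>x. \<Sum>j<n. c j * \<phi> j x) (\<phi> k) = c k"
      using eventually_gt_at_top[of k] by eventually_elim (simp add: orthonormal_sum_inner)
  qed
  ultimately show ?thesis by (rule LIMSEQ_unique)
qed

lemma l2_sums_norm:
  assumes "l2_sums \<Omega> (\<lambda>j x. c j * \<phi> j x) w"
  shows "(\<lambda>j. (c j)\<^sup>2) sums (l2_norm \<Omega> w)\<^sup>2"
proof -
  have "(\<lambda>n. (l2_norm \<Omega> (\<lambda>x. \<Sum>j<n. c j * \<phi> j x))\<^sup>2) \<longlonglongrightarrow> (l2_norm \<Omega> w)\<^sup>2"
    by (intro tendsto_power l2_tendsto_norm assms[unfolded l2_sums_def])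
  then show ?thesis by (simp add: sums_def orthonormal_sum_norm)
qed

lemma riesz_fischer:
  assumes fin: "finite_measure (lebesgue_on \<Omega>)" and c: "summable (\<lambda>j. (c j)\<^sup>2)"
  obtains w where "l2_sums \<Omega> (\<lambda>j x. c j * \<phi> j x) w"
proof -
  let ?s = "\<lambda>n x. \<Sum>j<n. c j * \<phi> j x"
  have cauchy: "\<exists>N. \<forall>i\<ge>N. \<forall>j\<ge>N. l2_norm \<Omega> (\<lambda>x. ?s i x - ?s j x) < e" if e: "0 < e" for e
  proof -
    obtain N where N: "\<And>m n. N \<le> m \<Longrightarrow> norm (\<Sum>j\<in>{m..<n}. (c j)\<^sup>2) < e\<^sup>2"
      using c e unfolding summable_Cauchy by (meson zero_less_power)
    have le: "l2_norm \<Omega> (\<lambda>x. ?s j x - ?s i x) < e" if "N \<le> i" "i \<le> j" for i j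
    proof -
      have "?s j x - ?s i x = (\<Sum>k\<in>{i..<j}. c k * \<phi> k x)" for x
        using sum_diff_nat_ivl[of 0 i j "\<lambda>k. c k * \<phi> k x"] that by (simp add: atLeast0LessThan)
      then have "(l2_norm \<Omega> (\<lambda>x. ?s j x - ?s i x))\<^sup>2 = (\<Sum>k\<in>{i..<j}. (c k)\<^sup>2)"
        using orthonormal_sum_norm[of "{i..<j}" c] by simp
      also have "\<dots> < e\<^sup>2" using N[OF that(1), of j] by simp
      finally show ?thesis by (rule power2_less_imp_less) (use e in simp)
    qed
    have "l2_norm \<Omega> (\<lambda>x. ?s i x - ?s j x) < e" if "N \<le> i" "N \<le> j" for i j
      using le[of i j] le[of j i] that l2_norm_minus_commute[of \<Omega> "?s i" "?s j"] by (cases "i \<le> j") auto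
    then show ?thesis by blast
  qed
  obtain w where "l2_tendsto \<Omega> ?s w"
    by (rule l2_complete[of \<Omega> ?s, OF fin orthonormal_sum_L2 cauchy])
  then show ?thesis by (intro that) (simp only: l2_sums_def)
qed

text \<open>\<open>l2_suminf\<close> is a choice and says nothing unless some limit exists;
  Riesz-Fischer supplies one.\<close>

lemma l2_sums_suminf:
  assumes fin: "finite_measure (lebesgue_on \<Omega>)" and c: "summable (\<lambda>j. (c j)\<^sup>2)"
  shows "l2_sums \<Omega> (\<lambda>j x. c j * \<phi> j x) (l2_suminf \<Omega> (\<lambda>j x. c j * \<phi> j x))"
proof -
  obtain w where "l2_sums \<Omega> (\<lambda>j x. c j * \<phi> j x) w" by (rule riesz_fischer[OF assms])
  then show ?thesis unfolding l2_suminf_def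
    by (rule someI[of "l2_sums \<Omega> (\<lambda>j x. c j * \<phi> j x)"])
qed

end

section \<open>Positivity of the Dirichlet eigenvalues\<close>

lemma smoothD:
  assumes "smooth f"
  shows "f differentiable (at x)" "i \<in> Basis \<Longrightarrow> smooth (\<lambda>x. frechet_derivative f (at x) i)"
  using assms by (auto elim: smooth.cases)

lemma smooth_continuous: "smooth f \<Longrightarrow> continuous_on S f"
  by (intro continuous_at_imp_continuous_on ballI differentiable_imp_continuous_within smoothD(1))

lemma directional_derivative:
  fixes v :: "'a::euclidean_space \<Rightarrow> real"
  assumes "v differentiable (at (x + s *\<^sub>R i))"
  shows "((\<lambda>s. v (x + s *\<^sub>R i)) has_real_derivative frechet_derivative v (at (x + s *\<^sub>R i)) i) (at s)"
proof -
  have D: "(v has_derivative frechet_derivative v (at (x + s *\<^sub>R i))) (at (x + s *\<^sub>R i))"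
    using assms by (simp add: frechet_derivative_works)
  have "((\<lambda>s. x + s *\<^sub>R i) has_derivative (\<lambda>h. h *\<^sub>R i)) (at s)"
    by (auto intro!: derivative_eq_intros)
  from diff_chain_at[OF this D]
  have "((\<lambda>s. v (x + s *\<^sub>R i)) has_derivative (\<lambda>h. frechet_derivative v (at (x + s *\<^sub>R i)) (h *\<^sub>R i))) (at s)"
    by (simp add: o_def)
  moreover have "frechet_derivative v (at (x + s *\<^sub>R i)) (h *\<^sub>R i) = frechet_derivative v (at (x + s *\<^sub>R i)) i * h" for h
    using linear_scale[OF has_derivative_linear[OF D], of h i] by (simp add: mult.commute)
  ultimately show ?thesis by (simp add: has_field_derivative_def)
qed

text \<open>Translation invariance makes the integral of every difference quotient vanish.\<close>

lemma integral_directional_derivative_0: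
  fixes h D :: "'a::euclidean_space \<Rightarrow> real"
  assumes K: "compact K" "\<And>x. x \<notin> K \<Longrightarrow> h x = 0"
    and h: "continuous_on UNIV h"
    and D: "\<And>x s. ((\<lambda>s. h (x + s *\<^sub>R i)) has_real_derivative D (x + s *\<^sub>R i)) (at s)"
    and C: "\<And>x. \<bar>D x\<bar> \<le> C" and i: "norm i = 1"
  shows "(\<integral>x. D x \<partial>lborel) = 0"
proof -
  define d where "d n = inverse (real (Suc n))" for n
  have d: "0 < d n" "d n \<le> 1" for n by (auto simp: d_def field_simps)
  have d0: "d \<longlonglongrightarrow> 0" unfolding d_def by (rule LIMSEQ_inverse_real_of_nat)
  have hint: "integrable lborel h"
  proof -
    have "integrable lborel (\<lambda>x. indicator K x *\<^sub>R h x)"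
      by (rule borel_integrable_compact[OF K(1) continuous_on_subset[OF h]]) simp
    moreover have "indicator K x *\<^sub>R h x = h x" for x using K(2) by (auto simp: indicator_def)
    ultimately show ?thesis by (simp only:)
  qed
  have hm [measurable]: "h \<in> borel_measurable borel" by (rule borel_measurable_continuous_onI[OF h])
  define q where "q n x = (h (x + d n *\<^sub>R i) - h x) / d n" for n x
  have qm: "q n \<in> borel_measurable lborel" for n unfolding q_def by measurable
  have qlim: "(\<lambda>n. q n x) \<longlonglongrightarrow> D x" for x
  proof -
    have "((\<lambda>s. (h (x + (0 + s) *\<^sub>R i) - h (x + 0 *\<^sub>R i)) / s) \<longlongrightarrow> D (x + 0 *\<^sub>R i)) (at 0)"
      using D[of x 0] unfolding DERIV_def .
    moreover have "filterlim d (at 0) sequentially"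
      using d(1) by (intro filterlim_atI d0) (simp add: less_imp_neq[THEN not_sym])
    ultimately show ?thesis unfolding q_def using filterlim_compose by fastforce
  qed
  obtain B where B: "\<And>x. x \<in> K \<Longrightarrow> norm x \<le> B"
    using compact_imp_bounded[OF K(1)] unfolding bounded_iff by blast
  \<comment> \<open>As \<open>d n <= 1\<close>, both points of the quotient lie off \<open>K\<close>
    once \<open>x\<close> is outside the ball of radius \<open>B + 1\<close>. Inside it, the mean
    value theorem reduces the quotient to a value of \<open>D\<close>.\<close>
  have qb: "norm (q n x) \<le> C * indicator (cball 0 (B + 1)) x" for n x
  proof (cases "x \<in> cball 0 (B + 1)")
    case True
    have "\<exists>z. 0 < z \<and> z < d n \<and> h (x + d n *\<^sub>R i) - h (x + 0 *\<^sub>R i) = (d n - 0) * D (x + z *\<^sub>R i)"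
      by (rule MVT2[OF d(1)]) (rule D)
    then obtain z where "h (x + d n *\<^sub>R i) - h x = d n * D (x + z *\<^sub>R i)" by auto
    then have "q n x = D (x + z *\<^sub>R i)" using d(1)[of n] by (simp add: q_def)
    then show ?thesis using C True by simp
  next
    case False
    then have n: "B + 1 < norm x" by simp
    moreover have "norm x \<le> norm (x + d n *\<^sub>R i) + norm (d n *\<^sub>R i)"
      using norm_triangle_ineq4[of "x + d n *\<^sub>R i" "d n *\<^sub>R i"] by simp
    ultimately have "x \<notin> K" "x + d n *\<^sub>R i \<notin> K"
      using B[of x] B[of "x + d n *\<^sub>R i"] d[of n] i by auto
    then show ?thesis using K(2) False by (simp add: q_def)
  qed
  have "(\<lambda>n. integral\<^sup>L lborel (q n)) \<longlonglongrightarrow> (\<integral>x. D x \<partial>lborel)"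
  proof (rule integral_dominated_convergence)
    show "integrable lborel (\<lambda>x. C * indicator (cball 0 (B + 1)) x)"
      by (intro integrable_mult_right integrable_real_indicator emeasure_lborel_cball_finite) auto
    show "D \<in> borel_measurable lborel" by (rule borel_measurable_LIMSEQ_real[OF qlim qm])
  qed (use qm qlim qb in auto)
  moreover have "integral\<^sup>L lborel (q n) = 0" for n
  proof -
    have dp: "distr lborel borel ((+) (d n *\<^sub>R i)) = (lborel :: 'a measure)" by (rule lborel_distr_plus)
    have i1: "integrable lborel (\<lambda>x. h (d n *\<^sub>R i + x))"
      using hint integrable_distr_eq[of "(+) (d n *\<^sub>R i)" lborel borel h] by (simp add: dp)
    have "(\<integral>x. h (d n *\<^sub>R i + x) \<partial>lborel) = integral\<^sup>L lborel h"
      using integral_distr[of "(+) (d n *\<^sub>R i)" lborel borel h] by (simp add: dp)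
    moreover have "integral\<^sup>L lborel (q n) = ((\<integral>x. h (d n *\<^sub>R i + x) \<partial>lborel) - integral\<^sup>L lborel h) / d n"
      unfolding q_def using Bochner_Integration.integral_diff[OF i1 hint] by (simp add: add.commute)
    ultimately show ?thesis by simp
  qed
  ultimately show ?thesis using LIMSEQ_unique[OF _ tendsto_const] by simp
qed

lemma integral_lebesgue_on_eq_lborel:
  fixes f :: "'a::euclidean_space \<Rightarrow> real"
  assumes "\<Omega> \<in> sets lebesgue" "f \<in> borel_measurable borel" "\<And>x. x \<notin> \<Omega> \<Longrightarrow> f x = 0"
  shows "(LINT x|lebesgue_on \<Omega>. f x) = (\<integral>x. f x \<partial>lborel)"
proof -
  have "(LINT x|lebesgue_on \<Omega>. f x) = (LINT x|lebesgue. indicator \<Omega> x *\<^sub>R f x)"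
    using assms(1) by (intro integral_restrict_space) auto
  also have "\<dots> = (LINT x|lebesgue. f x)"
    using assms(3) by (intro Bochner_Integration.integral_cong) (auto simp: indicator_def)
  also have "\<dots> = (\<integral>x. f x \<partial>lborel)" using assms(2) by (intro integral_completion) simp
  finally show ?thesis .
qed

text \<open>One coordinate direction \<open>i\<close> suffices. The derivative of
  \<open>(x \<bullet> i) * (v x)\<^sup>2\<close> along \<open>i\<close> has integral 0, which
  expresses the integral of \<open>(v x)\<^sup>2\<close> by that of
  \<open>(x \<bullet> i) * v x\<close> times the partial derivative. The coordinate is at most
  \<open>B\<close> on the domain; Cauchy-Schwarz and cancelling one norm of \<open>v\<close> finish
  the estimate.\<close>

lemma poincare_test_function:
  fixes \<Omega> :: "'a::euclidean_space set"
  assumes \<Omega>: "open \<Omega>" "\<And>x. x \<in> \<Omega> \<Longrightarrow> norm x \<le> B" and B: "0 \<le> B"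
    and v: "test_function \<Omega> v" "v \<in> L2 \<Omega>" "grad v \<in> L2 \<Omega>"
  shows "l2_norm \<Omega> v \<le> 2 * B * l2_norm \<Omega> (grad v)"
proof -
  obtain i :: 'a where i: "i \<in> Basis" using nonempty_Basis by blast
  obtain K where K: "compact K" "K \<subseteq> \<Omega>" "\<And>x. x \<notin> K \<Longrightarrow> v x = 0" and sm: "smooth v"
    using v(1) unfolding test_function_def by blast
  define d where "d x = frechet_derivative v (at x) i" for x
  have smd: "smooth d" unfolding d_def by (rule smoothD(2)[OF sm i])
  have cv: "continuous_on S v" and cd: "continuous_on S d" for S by (intro smooth_continuous sm smd)+
  define D where "D x = (v x)\<^sup>2 + 2 * ((x \<bullet> i) * v x * d x)" for x
  have cD: "continuous_on S D" for S unfolding D_def by (intro continuous_intros cv cd)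
  have D0: "D x = 0" if "x \<notin> K" for x using K(3)[OF that] by (simp add: D_def)
  obtain C0 where C0: "\<And>x. x \<in> K \<Longrightarrow> \<bar>D x\<bar> \<le> C0"
    using compact_imp_bounded[OF compact_continuous_image[OF cD K(1)]] unfolding bounded_iff by auto
  have C: "\<bar>D x\<bar> \<le> max C0 0" for x using C0[of x] D0[of x] by (cases "x \<in> K") auto
  have "(\<integral>x. D x \<partial>lborel) = 0"
  proof (rule integral_directional_derivative_0[where h = "\<lambda>x. (x \<bullet> i) * (v x)\<^sup>2", OF K(1) _ _ _ C])
    show "norm i = 1" using i by simp
    show "continuous_on UNIV (\<lambda>x. (x \<bullet> i) * (v x)\<^sup>2)" by (intro continuous_intros cv)
    fix x s
    have dv: "((\<lambda>s. v (x + s *\<^sub>R i)) has_real_derivative d (x + s *\<^sub>R i)) (at s)"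
      unfolding d_def by (rule directional_derivative[OF smoothD(1)[OF sm]])
    have "((\<lambda>s. (x + s *\<^sub>R i) \<bullet> i) has_real_derivative 1) (at s)"
      using i by (auto simp: inner_add_left intro!: derivative_eq_intros)
    from DERIV_mult[OF this DERIV_power[OF dv, of 2]]
    show "((\<lambda>s. (x + s *\<^sub>R i) \<bullet> i * (v (x + s *\<^sub>R i))\<^sup>2) has_real_derivative D (x + s *\<^sub>R i)) (at s)"
      by (rule DERIV_cong) (simp add: D_def power2_eq_square algebra_simps)
  qed (use K(3) in auto)
  moreover have i1: "integrable lborel (\<lambda>x. (v x)\<^sup>2)" and i2: "integrable lborel (\<lambda>x. (x \<bullet> i) * v x * d x)"
  proof -
    have "integrable lborel (\<lambda>x. indicator K x *\<^sub>R (v x)\<^sup>2)" "integrable lborel (\<lambda>x. indicator K x *\<^sub>R ((x \<bullet> i) * v x * d x))"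
      by (intro borel_integrable_compact[OF K(1)] continuous_intros cv cd)+
    moreover have "indicator K x *\<^sub>R (v x)\<^sup>2 = (v x)\<^sup>2" "indicator K x *\<^sub>R ((x \<bullet> i) * v x * d x) = (x \<bullet> i) * v x * d x" for x
      using K(3)[of x] by (auto simp: indicator_def)
    ultimately show "integrable lborel (\<lambda>x. (v x)\<^sup>2)" "integrable lborel (\<lambda>x. (x \<bullet> i) * v x * d x)" by (simp_all only:)
  qed
  ultimately have eq: "(\<integral>x. (v x)\<^sup>2 \<partial>lborel) = - 2 * (\<integral>x. (x \<bullet> i) * v x * d x \<partial>lborel)"
    unfolding D_def by simp
  have ms: "\<Omega> \<in> sets lebesgue" using \<Omega>(1) by (simp add: borel_open)
  have e1: "(l2_norm \<Omega> v)\<^sup>2 = (\<integral>x. (v x)\<^sup>2 \<partial>lborel)"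
  proof -
    have "(l2_norm \<Omega> v)\<^sup>2 = (LINT x|lebesgue_on \<Omega>. (v x)\<^sup>2)" by (simp add: l2_norm_power2 l2_inner_def flip: power2_eq_square)
    also have "\<dots> = (\<integral>x. (v x)\<^sup>2 \<partial>lborel)"
      by (rule integral_lebesgue_on_eq_lborel[OF ms])
        (use K in \<open>auto intro!: borel_measurable_continuous_onI continuous_intros cv\<close>)
    finally show ?thesis .
  qed
  have e2: "(LINT x|lebesgue_on \<Omega>. (x \<bullet> i) * v x * d x) = (\<integral>x. (x \<bullet> i) * v x * d x \<partial>lborel)"
    by (rule integral_lebesgue_on_eq_lborel[OF ms])
      (use K in \<open>auto intro!: borel_measurable_continuous_onI continuous_intros cv cd\<close>)
  have av: "(\<lambda>x. \<bar>v x\<bar>) \<in> L2 \<Omega>" "(\<lambda>x. norm (grad v x)) \<in> L2 \<Omega>"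
    using v(2,3) unfolding L2_def by auto
  have dg: "\<bar>d x\<bar> \<le> norm (grad v x)" for x
  proof -
    have "grad v x \<bullet> i = d x"
      unfolding grad_def d_def using i by (simp add: inner_sum_left_Basis)
    then show ?thesis using Basis_le_norm[OF i, of "grad v x"] by simp
  qed
  have "\<bar>LINT x|lebesgue_on \<Omega>. (x \<bullet> i) * v x * d x\<bar> \<le> (LINT x|lebesgue_on \<Omega>. \<bar>(x \<bullet> i) * v x * d x\<bar>)"
    by (rule integral_abs_bound)
  also have "\<dots> \<le> (LINT x|lebesgue_on \<Omega>. B * (\<bar>v x\<bar> \<bullet> norm (grad v x)))"
  proof (rule integral_mono_AE')
    show "integrable (lebesgue_on \<Omega>) (\<lambda>x. B * (\<bar>v x\<bar> \<bullet> norm (grad v x)))"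
      by (intro integrable_mult_right L2_inner_integrable av)
    show "AE x in lebesgue_on \<Omega>. \<bar>(x \<bullet> i) * v x * d x\<bar> \<le> B * (\<bar>v x\<bar> \<bullet> norm (grad v x))"
    proof (rule AE_I2)
      fix x assume "x \<in> space (lebesgue_on \<Omega>)"
      then have "norm x \<le> B" using \<Omega>(2) by simp
      then have "\<bar>x \<bullet> i\<bar> \<le> B" using Basis_le_norm[OF i, of x] by linarith
      then have "\<bar>x \<bullet> i\<bar> * (\<bar>v x\<bar> * \<bar>d x\<bar>) \<le> B * (\<bar>v x\<bar> * norm (grad v x))"
        using dg[of x] B by (intro mult_mono) auto
      then show "\<bar>(x \<bullet> i) * v x * d x\<bar> \<le> B * (\<bar>v x\<bar> \<bullet> norm (grad v x))"
        by (simp add: abs_mult mult.assoc)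
    qed
    show "AE x in lebesgue_on \<Omega>. 0 \<le> B * (\<bar>v x\<bar> \<bullet> norm (grad v x))"
      using B by (intro AE_I2) simp
  qed
  also have "\<dots> = B * l2_inner \<Omega> (\<lambda>x. \<bar>v x\<bar>) (\<lambda>x. norm (grad v x))"
    by (simp add: l2_inner_def)
  also have "\<dots> \<le> B * (l2_norm \<Omega> (\<lambda>x. \<bar>v x\<bar>) * l2_norm \<Omega> (\<lambda>x. norm (grad v x)))"
    using l2_Cauchy_Schwarz[OF av] B by (intro mult_left_mono) auto
  also have "\<dots> = B * (l2_norm \<Omega> v * l2_norm \<Omega> (grad v))" by (simp add: l2_norm_def)
  finally have "(l2_norm \<Omega> v)\<^sup>2 \<le> 2 * (B * (l2_norm \<Omega> v * l2_norm \<Omega> (grad v)))"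
    unfolding e1 eq e2 by linarith
  then have "l2_norm \<Omega> v * l2_norm \<Omega> v \<le> l2_norm \<Omega> v * (2 * B * l2_norm \<Omega> (grad v))"
    by (simp add: power2_eq_square mult_ac)
  moreover have "0 \<le> 2 * B * l2_norm \<Omega> (grad v)" using B by (intro mult_nonneg_nonneg l2_norm_nonneg) auto
  ultimately show ?thesis using l2_norm_nonneg[of \<Omega> v]
    by (cases "l2_norm \<Omega> v = 0") (simp_all add: mult_le_cancel_left_pos)
qed

text \<open>Testing the weak equation with the test functions that approximate \<open>f\<close>
  identifies \<mu> with the squared norm of the weak gradient. The Poincare inequality passes to the
  limit and keeps that norm away from 0, because \<open>f\<close> has norm 1.\<close>

lemma dirichlet_eigenvalue_pos:
  fixes \<Omega> :: "'a::euclidean_space set"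
  assumes \<Omega>: "open \<Omega>" "bounded \<Omega>" and e: "dirichlet_eigenpair \<Omega> \<mu> f" and f: "l2_inner \<Omega> f f = 1"
  shows "0 < \<mu>"
proof -
  obtain B where B: "0 < B" "\<And>x. x \<in> \<Omega> \<Longrightarrow> norm x \<le> B"
    using \<Omega>(2) unfolding bounded_pos by blast
  obtain G where G: "H01_with_grad \<Omega> f G"
    "\<And>v. test_function \<Omega> v \<Longrightarrow> l2_inner \<Omega> G (grad v) = \<mu> * l2_inner \<Omega> f v"
    using e unfolding dirichlet_eigenpair_def by blast
  obtain v where v: "\<And>n. test_function \<Omega> (v n)" "l2_tendsto \<Omega> v f" "l2_tendsto \<Omega> (\<lambda>n. grad (v n)) G"
    using G(1) unfolding H01_with_grad_def by blast
  have L: "v n \<in> L2 \<Omega>" "grad (v n) \<in> L2 \<Omega>" "f \<in> L2 \<Omega>" "G \<in> L2 \<Omega>" for n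
    using v(2,3) by (auto simp: l2_tendsto_def)
  have "(\<lambda>n. l2_inner \<Omega> (grad (v n)) G) \<longlonglongrightarrow> l2_inner \<Omega> G G"
    by (rule l2_tendsto_inner[OF v(3) L(4)])
  moreover have "(\<lambda>n. \<mu> * l2_inner \<Omega> (v n) f) \<longlonglongrightarrow> \<mu> * l2_inner \<Omega> f f"
    by (intro tendsto_mult_left l2_tendsto_inner[OF v(2) L(3)])
  moreover have "l2_inner \<Omega> (grad (v n)) G = \<mu> * l2_inner \<Omega> (v n) f" for n
    using G(2)[OF v(1), of n] by (metis l2_inner_commute)
  ultimately have GG: "l2_inner \<Omega> G G = \<mu>" using f LIMSEQ_unique by simp
  have "l2_norm \<Omega> f \<le> 2 * B * l2_norm \<Omega> G"
  proof (rule LIMSEQ_le[OF l2_tendsto_norm[OF v(2)] tendsto_mult_left[OF l2_tendsto_norm[OF v(3)]]])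
    show "\<exists>N. \<forall>n\<ge>N. l2_norm \<Omega> (v n) \<le> 2 * B * l2_norm \<Omega> (grad (v n))"
      using poincare_test_function[OF \<Omega>(1) B(2) less_imp_le[OF B(1)] v(1) L(1,2)] by blast
  qed
  moreover have "l2_norm \<Omega> f = 1" using l2_norm_power2[of \<Omega> f] f l2_norm_nonneg[of \<Omega> f] by (simp add: power2_eq_1_iff)
  ultimately have "0 < l2_norm \<Omega> G" using l2_norm_nonneg[of \<Omega> G] B(1)
    by (metis less_eq_real_def mult_zero_right not_one_le_zero)
  then show ?thesis using GG l2_norm_power2[of \<Omega> G] by (metis zero_less_power)
qed

section \<open>Recovery from two observations\<close>

lemma psi_scaling:
  assumes \<alpha>: "0 < \<alpha>" and s: "0 < s" and T: "0 \<le> T1" "0 \<le> T2"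
  shows "psi \<alpha> (s * T1) (s * T2) \<mu> = s * psi \<alpha> T1 T2 (s powr \<alpha> * \<mu>)"
proof -
  have eq: "- \<mu> * (s * T) powr \<alpha> = - (s powr \<alpha> * \<mu>) * T powr \<alpha>" if "0 \<le> T" for T
    using powr_mult[of s T \<alpha>] s that by simp
  show ?thesis unfolding psi_def eq[OF T(1)] eq[OF T(2)] by (simp add: algebra_simps)
qed

text \<open>By scaling, the threshold at the smallest eigenvalue serves all larger eigenvalues.\<close>

lemma psi_threshold_upward:
  assumes \<alpha>: "0 < \<alpha>" and M: "psi_threshold \<alpha> cstar M" and \<mu>0: "0 < \<mu>0" "M \<mu>0 \<le> T1" and T: "T1 < T2"
  defines "D \<equiv> cstar * (T2 - T1) / (Gamma (1 - \<alpha>) * Gamma (2 - \<alpha>)) / (T1 powr \<alpha> * T2 powr \<alpha>)"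
  shows "0 < T1" "D < 0" "\<And>\<mu>. \<mu>0 \<le> \<mu> \<Longrightarrow> psi \<alpha> T1 T2 \<mu> \<le> D / \<mu>\<^sup>2"
proof -
  have M0: "0 < M \<mu>0" and
    P: "\<And>S1 S2. M \<mu>0 \<le> S1 \<Longrightarrow> S1 < S2 \<Longrightarrow>
      psi \<alpha> S1 S2 \<mu>0 \<le> cstar * (S2 - S1) / (Gamma (1 - \<alpha>) * Gamma (2 - \<alpha>)) * (1 / (\<mu>0\<^sup>2 * S1 powr \<alpha> * S2 powr \<alpha>)) \<and>
      cstar * (S2 - S1) / (Gamma (1 - \<alpha>) * Gamma (2 - \<alpha>)) * (1 / (\<mu>0\<^sup>2 * S1 powr \<alpha> * S2 powr \<alpha>)) < 0"
    using M \<mu>0(1) unfolding psi_threshold_def by (auto simp: Let_def)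
  show T1: "0 < T1" using M0 \<mu>0 by simp
  define Q where "Q = cstar * (T2 - T1) / (Gamma (1 - \<alpha>) * Gamma (2 - \<alpha>))"
  have D: "D = Q / (T1 powr \<alpha> * T2 powr \<alpha>)" by (simp add: D_def Q_def)
  have "Q * (1 / (\<mu>0\<^sup>2 * T1 powr \<alpha> * T2 powr \<alpha>)) = D / \<mu>0\<^sup>2" by (simp add: D)
  then have "D / \<mu>0\<^sup>2 < 0" using P[OF \<mu>0(2) T] unfolding Q_def by linarith
  then show "D < 0" using \<mu>0(1) by (simp add: divide_less_0_iff)
  fix \<mu> assume \<mu>: "\<mu>0 \<le> \<mu>"
  \<comment> \<open>Multiplying both times by \<open>s\<close> has the effect of replacing
    \<open>\<mu>0\<close> by \<open>\<mu>\<close>, and \<open>1 <= s\<close> keeps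
    \<open>s * T1\<close> above the threshold that belongs to \<open>\<mu>0\<close>. The bound
    scales by \<open>s\<close> from the time difference, which cancels against the factor in
    \<open>psi_scaling\<close>, while the powers of the times turn \<open>\<mu>0\<^sup>2\<close>
    into \<open>\<mu>\<^sup>2\<close>.\<close>
  define s where "s = (\<mu> / \<mu>0) powr (1 / \<alpha>)"
  have s: "1 \<le> s" using \<mu> \<mu>0 \<alpha> by (auto simp: s_def intro!: ge_one_powr_ge_zero)
  have sa: "s powr \<alpha> = \<mu> / \<mu>0" using \<mu> \<mu>0 \<alpha> by (simp add: s_def powr_powr)
  then have sm: "s powr \<alpha> * \<mu>0 = \<mu>" using \<mu>0 by simp
  have "1 * T1 \<le> s * T1" using s T1 by (intro mult_right_mono) auto
  then have "M \<mu>0 \<le> s * T1" "s * T1 < s * T2" using \<mu>0 s T by auto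
  from P[OF this] have "psi \<alpha> (s * T1) (s * T2) \<mu>0 \<le> cstar * (s * T2 - s * T1) / (Gamma (1 - \<alpha>) * Gamma (2 - \<alpha>)) * (1 / (\<mu>0\<^sup>2 * (s * T1) powr \<alpha> * (s * T2) powr \<alpha>))"
    by simp
  also have "\<dots> = s * Q * (1 / (\<mu>0\<^sup>2 * (s * T1) powr \<alpha> * (s * T2) powr \<alpha>))"
    by (simp add: Q_def algebra_simps)
  also have "\<mu>0\<^sup>2 * (s * T1) powr \<alpha> * (s * T2) powr \<alpha> = (s powr \<alpha> * \<mu>0)\<^sup>2 * (T1 powr \<alpha> * T2 powr \<alpha>)"
    using s T1 T by (simp add: powr_mult power2_eq_square mult_ac)
  also have "s * Q * (1 / ((s powr \<alpha> * \<mu>0)\<^sup>2 * (T1 powr \<alpha> * T2 powr \<alpha>))) = s * (D / \<mu>\<^sup>2)"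
    unfolding sm by (simp add: D)
  finally have "s * psi \<alpha> T1 T2 \<mu> \<le> s * (D / \<mu>\<^sup>2)"
    using psi_scaling[OF \<alpha>, of s T1 T2 \<mu>0] s T1 T by (simp add: sm)
  then show "psi \<alpha> T1 T2 \<mu> \<le> D / \<mu>\<^sup>2"
    by (rule mult_left_le_imp_le) (use s in simp)
qed

text \<open>Every passage from bounds on coefficients to bounds on norms goes through this estimate.
  The constant 2 is a rounded-up square root of 2, from \<open>(\<bar>y\<bar> +
  \<bar>z\<bar>)\<^sup>2 <= 2 * (y\<^sup>2 + z\<^sup>2)\<close>.\<close>

lemma l2_sequence_comparison:
  fixes x y z :: "nat \<Rightarrow> real"
  assumes le: "\<And>j. \<bar>x j\<bar> \<le> C * (\<bar>y j\<bar> + \<bar>z j\<bar>)" and C: "0 \<le> C"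
    and y: "summable (\<lambda>j. (y j)\<^sup>2)" and z: "summable (\<lambda>j. (z j)\<^sup>2)"
  shows "summable (\<lambda>j. (x j)\<^sup>2)"
    "sqrt (\<Sum>j. (x j)\<^sup>2) \<le> 2 * C * (sqrt (\<Sum>j. (y j)\<^sup>2) + sqrt (\<Sum>j. (z j)\<^sup>2))"
proof -
  have b: "(x j)\<^sup>2 \<le> 2 * C\<^sup>2 * ((y j)\<^sup>2 + (z j)\<^sup>2)" for j
  proof -
    have "\<bar>x j\<bar>\<^sup>2 \<le> (C * (\<bar>y j\<bar> + \<bar>z j\<bar>))\<^sup>2" using le[of j] by (intro power_mono) auto
    also have "\<dots> = C\<^sup>2 * (\<bar>y j\<bar> + \<bar>z j\<bar>)\<^sup>2" by (rule power_mult_distrib)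
    also have "\<dots> \<le> C\<^sup>2 * (2 * ((y j)\<^sup>2 + (z j)\<^sup>2))"
      using sum_squares_bound[of "\<bar>y j\<bar>" "\<bar>z j\<bar>"] by (intro mult_left_mono) (auto simp: power2_sum)
    finally show ?thesis by (simp add: algebra_simps)
  qed
  have s: "summable (\<lambda>j. 2 * C\<^sup>2 * ((y j)\<^sup>2 + (z j)\<^sup>2))" by (intro summable_mult summable_add y z)
  show sx: "summable (\<lambda>j. (x j)\<^sup>2)"
    by (rule summable_comparison_test'[OF s, of 0]) (use b in simp)
  define Y Z where "Y = sqrt (\<Sum>j. (y j)\<^sup>2)" and "Z = sqrt (\<Sum>j. (z j)\<^sup>2)"
  have Y: "0 \<le> Y" "(\<Sum>j. (y j)\<^sup>2) = Y\<^sup>2" and Z: "0 \<le> Z" "(\<Sum>j. (z j)\<^sup>2) = Z\<^sup>2"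
    using suminf_nonneg[OF y] suminf_nonneg[OF z] by (simp_all add: Y_def Z_def)
  have "(\<Sum>j. (x j)\<^sup>2) \<le> (\<Sum>j. 2 * C\<^sup>2 * ((y j)\<^sup>2 + (z j)\<^sup>2))" by (rule suminf_le[OF b sx s])
  also have "\<dots> = 2 * C\<^sup>2 * (Y\<^sup>2 + Z\<^sup>2)"
    by (simp add: suminf_mult[OF summable_add[OF y z]] suminf_add[OF y z, symmetric] Y Z)
  also have "\<dots> \<le> 2 * C\<^sup>2 * (Y + Z)\<^sup>2" using Y Z by (intro mult_left_mono) (auto simp: power2_sum)
  also have "\<dots> \<le> (2 * C * (Y + Z))\<^sup>2" by (simp add: power_mult_distrib)
  finally have "(\<Sum>j. (x j)\<^sup>2) \<le> (2 * C * (Y + Z))\<^sup>2" .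
  then have "sqrt (\<Sum>j. (x j)\<^sup>2) \<le> sqrt ((2 * C * (Y + Z))\<^sup>2)" by (rule real_sqrt_le_mono)
  also have "\<dots> = 2 * C * (Y + Z)" using C Y Z by simp
  finally show "sqrt (\<Sum>j. (x j)\<^sup>2) \<le> 2 * C * (sqrt (\<Sum>j. (y j)\<^sup>2) + sqrt (\<Sum>j. (z j)\<^sup>2))"
    by (simp add: Y_def Z_def)
qed

lemma convex_polyhedral_domainD:
  assumes "convex_polyhedral_domain \<Omega>"
  shows "open \<Omega>" "bounded \<Omega>" "finite_measure (lebesgue_on \<Omega>)"
proof -
  show op: "open \<Omega>" using assms by (simp add: convex_polyhedral_domain_def)
  have "bounded (closure \<Omega>)"
    using assms by (simp add: convex_polyhedral_domain_def polytope_imp_bounded)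
  then show bd: "bounded \<Omega>" using bounded_subset closure_subset by blast
  show "finite_measure (lebesgue_on \<Omega>)"
    by (rule finite_measure_lebesgue_on[OF lmeasurable_open[OF bd op]])
qed

section \<open>Expansion in the Dirichlet eigenfunctions\<close>

context
  fixes \<Omega> :: "'a::euclidean_space set" and lam :: "nat \<Rightarrow> real" and \<phi> :: "nat \<Rightarrow> 'a \<Rightarrow> real"
  assumes dom: "convex_polyhedral_domain \<Omega>" and sys: "dirichlet_eigensystem \<Omega> lam \<phi>"
begin

lemma eigenfunction_L2: "\<phi> j \<in> L2 \<Omega>"
  using sys unfolding dirichlet_eigensystem_def dirichlet_eigenpair_def H01_with_grad_def l2_tendsto_def by blast

lemma eigenfunction_orthonormal: "l2_inner \<Omega> (\<phi> i) (\<phi> j) = (if i = j then 1 else 0)"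
  using sys unfolding dirichlet_eigensystem_def by blast

lemma eigenfunction_expansion: "v \<in> L2 \<Omega> \<Longrightarrow> l2_sums \<Omega> (\<lambda>j x. l2_inner \<Omega> v (\<phi> j) * \<phi> j x) v"
  using sys unfolding dirichlet_eigensystem_def by blast

lemma eigenvalue_ge: "lam 0 \<le> lam j"
  using sys unfolding dirichlet_eigensystem_def mono_def by blast

lemma eigenvalue_pos: "0 < lam j"
proof -
  have "dirichlet_eigenpair \<Omega> (lam j) (\<phi> j)" using sys unfolding dirichlet_eigensystem_def by blast
  then show ?thesis
    using dirichlet_eigenvalue_pos convex_polyhedral_domainD[OF dom] eigenfunction_orthonormal[of j j] by auto
qed

lemma parseval: "v \<in> L2 \<Omega> \<Longrightarrow> (\<lambda>j. (l2_inner \<Omega> v (\<phi> j))\<^sup>2) sums (l2_norm \<Omega> v)\<^sup>2"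
  by (rule l2_sums_norm[OF eigenfunction_L2 eigenfunction_orthonormal eigenfunction_expansion])

lemma l2_norm_coefficients: "v \<in> L2 \<Omega> \<Longrightarrow> l2_norm \<Omega> v = sqrt (\<Sum>j. (l2_inner \<Omega> v (\<phi> j))\<^sup>2)"
  using parseval[of v] l2_norm_nonneg[of \<Omega> v] by (simp add: sums_iff)

lemma equal_coefficients_AE:
  assumes "v \<in> L2 \<Omega>" "w \<in> L2 \<Omega>" "\<And>j. l2_inner \<Omega> v (\<phi> j) = l2_inner \<Omega> w (\<phi> j)"
  shows "AE x in lebesgue_on \<Omega>. v x = w x"
  using eigenfunction_expansion[OF assms(1)] eigenfunction_expansion[OF assms(2)]
  unfolding l2_sums_def assms(3) by (rule l2_tendsto_unique_AE)

lemma multiplier_suminf: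
  assumes "v \<in> L2 \<Omega>" and m: "\<And>j. \<bar>m j\<bar> \<le> B"
  defines "w \<equiv> l2_suminf \<Omega> (\<lambda>j x. m j * l2_inner \<Omega> v (\<phi> j) * \<phi> j x)"
  shows "w \<in> L2 \<Omega>" "l2_inner \<Omega> w (\<phi> j) = m j * l2_inner \<Omega> v (\<phi> j)"
proof -
  have B: "0 \<le> B" using m[of 0] by linarith
  have "summable (\<lambda>j. (m j * l2_inner \<Omega> v (\<phi> j))\<^sup>2)"
  proof (rule l2_sequence_comparison(1)[where C = B and y = "\<lambda>j. l2_inner \<Omega> v (\<phi> j)" and z = "\<lambda>j. 0"])
    show "\<bar>m j * l2_inner \<Omega> v (\<phi> j)\<bar> \<le> B * (\<bar>l2_inner \<Omega> v (\<phi> j)\<bar> + \<bar>0\<bar>)" for j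
      using m[of j] by (simp add: abs_mult mult_right_mono)
  qed (use B parseval[OF assms(1)] in \<open>auto simp: sums_iff\<close>)
  then have s: "l2_sums \<Omega> (\<lambda>j x. m j * l2_inner \<Omega> v (\<phi> j) * \<phi> j x) w"
    unfolding w_def
    by (rule l2_sums_suminf[OF eigenfunction_L2 eigenfunction_orthonormal convex_polyhedral_domainD(3)[OF dom]])
  then show "w \<in> L2 \<Omega>" by (simp add: l2_sums_def l2_tendsto_def)
  show "l2_inner \<Omega> w (\<phi> j) = m j * l2_inner \<Omega> v (\<phi> j)"
    by (rule l2_sums_coefficient[OF eigenfunction_L2 eigenfunction_orthonormal s])
qed

section \<open>The solution for given initial data and its inversion\<close>

context
  fixes \<alpha> K :: real
  assumes \<alpha>: "1 < \<alpha>" "\<alpha> < 2"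
    and K: "\<And>x. 0 \<le> x \<Longrightarrow> x * \<bar>mittag_leffler \<alpha> 1 (- x)\<bar> \<le> K" "\<And>x. 0 \<le> x \<Longrightarrow> x * \<bar>mittag_leffler \<alpha> 2 (- x)\<bar> \<le> K"
begin

lemma mode_decay:
  assumes "0 < t" "\<beta> \<in> {1, 2}"
  shows "lam j * \<bar>mittag_leffler \<alpha> \<beta> (- lam j * t powr \<alpha>)\<bar> \<le> K / t powr \<alpha>"
proof -
  have "lam j * t powr \<alpha> * \<bar>mittag_leffler \<alpha> \<beta> (- (lam j * t powr \<alpha>))\<bar> \<le> K"
    using assms(2) K[of "lam j * t powr \<alpha>"] eigenvalue_pos[of j] by auto
  then show ?thesis using assms(1) by (simp add: field_simps)
qed

text \<open>For positive \<open>t\<close> the decay estimate gives a uniform bound because all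
  eigenvalues are at least \<open>lam 0 > 0\<close>. At \<open>t = 0\<close> it would be void, but
  there the argument is 0 for every \<open>j\<close>.\<close>

lemma mode_bounded:
  assumes "0 \<le> t" "\<beta> \<in> {1, 2}"
  shows "\<exists>B. \<forall>j. \<bar>mittag_leffler \<alpha> \<beta> (- lam j * t powr \<alpha>)\<bar> \<le> B"
proof (cases "t = 0")
  case True
  then show ?thesis by auto
next
  case False
  have "\<bar>mittag_leffler \<alpha> \<beta> (- lam j * t powr \<alpha>)\<bar> \<le> K / t powr \<alpha> / lam 0" for j
  proof -
    have "lam 0 * \<bar>mittag_leffler \<alpha> \<beta> (- lam j * t powr \<alpha>)\<bar> \<le> lam j * \<bar>mittag_leffler \<alpha> \<beta> (- lam j * t powr \<alpha>)\<bar>"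
      by (intro mult_right_mono eigenvalue_ge) auto
    also have "\<dots> \<le> K / t powr \<alpha>" by (rule mode_decay) (use assms False in auto)
    finally show ?thesis using eigenvalue_pos[of 0] by (subst pos_le_divide_eq) (simp_all add: mult.commute)
  qed
  then show ?thesis by blast
qed

lemma solution_coefficients:
  assumes ab: "a \<in> L2 \<Omega>" "b \<in> L2 \<Omega>" and t: "0 \<le> t"
  shows "solution \<Omega> lam \<phi> \<alpha> a b t \<in> L2 \<Omega>"
    "l2_inner \<Omega> (solution \<Omega> lam \<phi> \<alpha> a b t) (\<phi> j) =
      l2_inner \<Omega> a (\<phi> j) * mittag_leffler \<alpha> 1 (- lam j * t powr \<alpha>)
      + l2_inner \<Omega> b (\<phi> j) * (t * mittag_leffler \<alpha> 2 (- lam j * t powr \<alpha>))"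
proof -
  obtain B1 B2 where B: "\<And>j. \<bar>mittag_leffler \<alpha> 1 (- lam j * t powr \<alpha>)\<bar> \<le> B1"
    "\<And>j. \<bar>mittag_leffler \<alpha> 2 (- lam j * t powr \<alpha>)\<bar> \<le> B2"
    using mode_bounded[OF t] by (meson insertI1 insertI2)
  have B2: "\<bar>t * mittag_leffler \<alpha> 2 (- lam j * t powr \<alpha>)\<bar> \<le> t * B2" for j
    using B(2)[of j] t by (simp add: abs_mult mult_left_mono)
  note F = multiplier_suminf[OF ab(1) B(1), folded sol_F_def]
  note Fbar = multiplier_suminf[OF ab(2) B2, folded sol_Fbar_def]
  show "solution \<Omega> lam \<phi> \<alpha> a b t \<in> L2 \<Omega>"
    unfolding solution_def by (intro L2_add F(1) Fbar(1))
  show "l2_inner \<Omega> (solution \<Omega> lam \<phi> \<alpha> a b t) (\<phi> j) =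
      l2_inner \<Omega> a (\<phi> j) * mittag_leffler \<alpha> 1 (- lam j * t powr \<alpha>)
      + l2_inner \<Omega> b (\<phi> j) * (t * mittag_leffler \<alpha> 2 (- lam j * t powr \<alpha>))"
    unfolding solution_def l2_inner_add_left[OF F(1) Fbar(1) eigenfunction_L2] F(2) Fbar(2)
    by (simp add: mult_ac)
qed

lemma solution_solves_ibvp:
  assumes ab: "a \<in> L2 \<Omega>" "b \<in> L2 \<Omega>" and T: "0 < T"
  shows "solves_ibvp \<Omega> lam \<phi> \<alpha> T a b (solution \<Omega> lam \<phi> \<alpha> a b)"
  unfolding solves_ibvp_def
proof (intro conjI ballI allI)
  let ?u = "solution \<Omega> lam \<phi> \<alpha> a b"
  note co = solution_coefficients[OF ab]
  show "?u t \<in> L2 \<Omega>" if "t \<in> {0..T}" for t using co(1) that by simp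
  show "?u t \<in> Hdot \<Omega> lam \<phi> 2" if "t \<in> {0<..T}" for t
  proof -
    have t: "0 < t" using that by simp
    \<comment> \<open>The decay of order 1 / \<lambda> compensates the weight \<lambda>, so that
      data in \<open>L2\<close> are smoothed into \<open>Hdot\<close> of order 2 at every positive
      time.\<close>
    have "summable (\<lambda>j. (lam j * l2_inner \<Omega> (?u t) (\<phi> j))\<^sup>2)"
    proof (rule l2_sequence_comparison(1))
      fix j
      have d1: "lam j * \<bar>mittag_leffler \<alpha> 1 (- lam j * t powr \<alpha>)\<bar> \<le> (1 + t) * (K / t powr \<alpha>)"
        using mode_decay[OF t, of 1 j] mult_right_mono[of 1 "1 + t" "K / t powr \<alpha>"] t K(1)[of 0] by simp
      have "t * (lam j * \<bar>mittag_leffler \<alpha> 2 (- lam j * t powr \<alpha>)\<bar>) \<le> t * (K / t powr \<alpha>)"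
        using mode_decay[OF t, of 2 j] t by (intro mult_left_mono) auto
      also have "\<dots> \<le> (1 + t) * (K / t powr \<alpha>)" using t K(1)[of 0] by (intro mult_right_mono) auto
      finally have d2: "t * (lam j * \<bar>mittag_leffler \<alpha> 2 (- lam j * t powr \<alpha>)\<bar>) \<le> (1 + t) * (K / t powr \<alpha>)" .
      have "\<bar>lam j * l2_inner \<Omega> (?u t) (\<phi> j)\<bar>
         \<le> \<bar>l2_inner \<Omega> a (\<phi> j)\<bar> * (lam j * \<bar>mittag_leffler \<alpha> 1 (- lam j * t powr \<alpha>)\<bar>)
          + \<bar>l2_inner \<Omega> b (\<phi> j)\<bar> * (t * (lam j * \<bar>mittag_leffler \<alpha> 2 (- lam j * t powr \<alpha>)\<bar>))"
        unfolding co(2)[OF less_imp_le[OF t]] distrib_left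
        by (rule order_trans[OF abs_triangle_ineq]) (use eigenvalue_pos[of j] t in \<open>simp add: abs_mult mult_ac\<close>)
      also have "\<dots> \<le> \<bar>l2_inner \<Omega> a (\<phi> j)\<bar> * ((1 + t) * (K / t powr \<alpha>)) + \<bar>l2_inner \<Omega> b (\<phi> j)\<bar> * ((1 + t) * (K / t powr \<alpha>))"
        by (intro add_mono mult_left_mono d1 d2) auto
      finally show "\<bar>lam j * l2_inner \<Omega> (?u t) (\<phi> j)\<bar>
          \<le> (1 + t) * (K / t powr \<alpha>) * (\<bar>l2_inner \<Omega> a (\<phi> j)\<bar> + \<bar>l2_inner \<Omega> b (\<phi> j)\<bar>)"
        by (simp only: distrib_left mult.commute)
    qed (use parseval ab t K(1)[of 0] in \<open>auto simp: sums_iff\<close>)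
    then show ?thesis
      using co(1) t by (simp add: Hdot_def power_mult_distrib powr_numeral less_imp_le[OF eigenvalue_pos])
  qed
  show "has_caputo_derivative \<alpha> (\<lambda>s. l2_inner \<Omega> (?u s) (\<phi> j)) (- lam j * l2_inner \<Omega> (?u t) (\<phi> j)) t"
    if "t \<in> {0<..T}" for t j
    by (rule mittag_leffler_caputo[OF \<alpha>]) (use that co(2) in auto)
  show "AE x in lebesgue_on \<Omega>. ?u 0 x = a x"
    by (rule equal_coefficients_AE)
      (use co[OF order_refl] ab \<alpha> in \<open>auto simp: mittag_leffler_0\<close>)
  show "((\<lambda>s. l2_inner \<Omega> (?u s) (\<phi> j)) has_real_derivative l2_inner \<Omega> b (\<phi> j)) (at 0 within {0..T})" for j
    by (rule has_field_derivative_transform_within[OF mittag_leffler_mode_derivative_0[OF \<alpha>(1)] zero_less_one])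
      (use T co(2) in auto)
qed

text \<open>\<open>P\<close> bounds \<lambda> times each entry of the system and \<open>- D\<close>
  bounds \<open>\<lambda>\<^sup>2\<close> times the negated determinant from below, so the entries
  of the inverse are at most \<lambda> times \<open>P / - D\<close>. The upper estimate of the data
  uses this inverse; the lower one follows from the size of the entries alone.\<close>

lemma two_time_recovery_if_bounds:
  fixes T T1 T2 D P :: real
  assumes T: "0 < T1" "T1 < T2" "T2 \<le> T" and D: "D < 0"
    and psi: "\<And>j. psi \<alpha> T1 T2 (lam j) \<le> D / (lam j)\<^sup>2"
    and P: "0 < P" "(1 + T2) * (K / T1 powr \<alpha>) \<le> P" "(1 + T2) * (K / T2 powr \<alpha>) \<le> P"
  shows "two_time_recovery \<Omega> lam \<phi> \<alpha> T T1 T2 (1 / (4 * P)) (4 * (P / - D))"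
  unfolding two_time_recovery_def
proof (intro ballI)
  fix g1 g2 assume g: "g1 \<in> Hdot \<Omega> lam \<phi> 2" "g2 \<in> Hdot \<Omega> lam \<phi> 2"
  have gL: "g1 \<in> L2 \<Omega>" "g2 \<in> L2 \<Omega>" using g by (auto simp: Hdot_def)
  define E F where "E t j = mittag_leffler \<alpha> 1 (- lam j * t powr \<alpha>)"
    and "F t j = t * mittag_leffler \<alpha> 2 (- lam j * t powr \<alpha>)" for t j
  define p q where "p j = l2_inner \<Omega> g1 (\<phi> j)" and "q j = l2_inner \<Omega> g2 (\<phi> j)" for j
  define \<psi> where "\<psi> j = psi \<alpha> T1 T2 (lam j)" for j
  have \<psi>: "\<psi> j = E T1 j * F T2 j - F T1 j * E T2 j" for j
    by (simp add: \<psi>_def psi_def E_def F_def mult_ac)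
  have \<psi>_le: "- D / (lam j)\<^sup>2 \<le> - \<psi> j" for j using psi[of j] by (simp add: \<psi>_def)
  have \<psi>_neg: "\<psi> j < 0" for j
  proof -
    have "0 < - D / (lam j)\<^sup>2" using D eigenvalue_pos[of j] by (intro divide_pos_pos) auto
    then show ?thesis using \<psi>_le[of j] by linarith
  qed
  have K0: "0 \<le> K" using K(1)[of 0] by simp
  have EF: "lam j * \<bar>E t j\<bar> \<le> P" "lam j * \<bar>F t j\<bar> \<le> P" if "t = T1 \<or> t = T2" for t j
  proof -
    have t: "0 < t" "t \<le> T2" "(1 + T2) * (K / t powr \<alpha>) \<le> P" using that T P by auto
    have "lam j * \<bar>E t j\<bar> \<le> 1 * (K / t powr \<alpha>)" using mode_decay[OF t(1), of 1 j] by (simp add: E_def)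
    also have "\<dots> \<le> (1 + T2) * (K / t powr \<alpha>)" using t T K0 by (intro mult_right_mono) auto
    finally show "lam j * \<bar>E t j\<bar> \<le> P" using t(3) by linarith
    have "lam j * \<bar>F t j\<bar> = t * (lam j * \<bar>mittag_leffler \<alpha> 2 (- lam j * t powr \<alpha>)\<bar>)"
      using t by (simp add: F_def abs_mult)
    also have "\<dots> \<le> (1 + T2) * (K / t powr \<alpha>)"
      using mode_decay[OF t(1), of 2 j] t T eigenvalue_pos[of j] by (intro mult_mono) auto
    finally show "lam j * \<bar>F t j\<bar> \<le> P" using t(3) by linarith
  qed
  \<comment> \<open>Cramer's rule for the coefficients of \<open>a\<close> and
    \<open>b\<close>.\<close>
  define ac bc where "ac j = (F T2 j * p j - F T1 j * q j) / \<psi> j"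
    and "bc j = (E T1 j * q j - E T2 j * p j) / \<psi> j" for j
  have solve: "ac j * E T1 j + bc j * F T1 j = p j" "ac j * E T2 j + bc j * F T2 j = q j" for j
    using \<psi>_neg[of j] unfolding ac_def bc_def by (simp_all add: divide_simps) (simp_all add: \<psi> algebra_simps)
  \<comment> \<open>The numerator gains 1 / \<lambda> from the entries and the determinant costs
    \<open>\<lambda>\<^sup>2\<close>, which leaves one factor \<lambda> on the data: exactly the
    weight of the norm of order 2.\<close>
  have quot: "\<bar>(x * r - y * s) / \<psi> j\<bar> \<le> P / - D * (\<bar>lam j * r\<bar> + \<bar>lam j * s\<bar>)"
    if x: "lam j * \<bar>x\<bar> \<le> P" "lam j * \<bar>y\<bar> \<le> P" for x y r s j
  proof -
    have l: "0 < lam j" by (rule eigenvalue_pos)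
    have "lam j * \<bar>x * r - y * s\<bar> \<le> lam j * (\<bar>x * r\<bar> + \<bar>y * s\<bar>)"
      using l by (intro mult_left_mono abs_triangle_ineq4) auto
    also have "\<dots> = (lam j * \<bar>x\<bar>) * \<bar>r\<bar> + (lam j * \<bar>y\<bar>) * \<bar>s\<bar>" by (simp add: abs_mult algebra_simps)
    also have "\<dots> \<le> P * \<bar>r\<bar> + P * \<bar>s\<bar>" by (intro add_mono mult_right_mono x) auto
    finally have 1: "lam j * \<bar>x * r - y * s\<bar> \<le> P * (\<bar>r\<bar> + \<bar>s\<bar>)" by (simp add: algebra_simps)
    have "\<bar>(x * r - y * s) / \<psi> j\<bar> = \<bar>x * r - y * s\<bar> / - \<psi> j" using \<psi>_neg[of j] by simp
    also have "\<dots> \<le> \<bar>x * r - y * s\<bar> / (- D / (lam j)\<^sup>2)"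
      using \<psi>_le[of j] \<psi>_neg[of j] D l divide_neg_pos[OF D, of "(lam j)\<^sup>2"]
      by (intro divide_left_mono mult_pos_pos) auto
    also have "\<dots> = lam j * (lam j * \<bar>x * r - y * s\<bar>) / - D"
      by (simp add: power2_eq_square mult_ac)
    also have "\<dots> \<le> lam j * (P * (\<bar>r\<bar> + \<bar>s\<bar>)) / - D"
      using 1 l D by (intro divide_right_mono mult_left_mono) auto
    also have "\<dots> = P / - D * (\<bar>lam j * r\<bar> + \<bar>lam j * s\<bar>)" using l by (simp add: abs_mult algebra_simps add_divide_distrib)
    finally show ?thesis .
  qed
  have ac_le: "\<bar>ac j\<bar> \<le> P / - D * (\<bar>lam j * p j\<bar> + \<bar>lam j * q j\<bar>)" for j
    unfolding ac_def by (rule quot) (auto intro: EF)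
  have bc_le: "\<bar>bc j\<bar> \<le> P / - D * (\<bar>lam j * q j\<bar> + \<bar>lam j * p j\<bar>)" for j
    unfolding bc_def by (rule quot) (auto intro: EF)
  have data_le: "\<bar>lam j * (x * y + r * s)\<bar> \<le> P * (\<bar>x\<bar> + \<bar>r\<bar>)"
    if "lam j * \<bar>y\<bar> \<le> P" "lam j * \<bar>s\<bar> \<le> P" for x y r s j
  proof -
    have l: "0 < lam j" by (rule eigenvalue_pos)
    have "\<bar>lam j * (x * y + r * s)\<bar> \<le> \<bar>x\<bar> * (lam j * \<bar>y\<bar>) + \<bar>r\<bar> * (lam j * \<bar>s\<bar>)"
      unfolding distrib_left by (rule order_trans[OF abs_triangle_ineq]) (use l in \<open>simp add: abs_mult mult_ac\<close>)
    also have "\<dots> \<le> \<bar>x\<bar> * P + \<bar>r\<bar> * P" by (intro add_mono mult_left_mono that) auto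
    finally show ?thesis by (simp add: algebra_simps)
  qed
  have p_le: "\<bar>lam j * p j\<bar> \<le> P * (\<bar>ac j\<bar> + \<bar>bc j\<bar>)" for j
    unfolding solve(1)[symmetric] by (rule data_le) (auto intro: EF)
  have q_le: "\<bar>lam j * q j\<bar> \<le> P * (\<bar>ac j\<bar> + \<bar>bc j\<bar>)" for j
    unfolding solve(2)[symmetric] by (rule data_le) (auto intro: EF)
  have h: "lam j powr 2 * (r)\<^sup>2 = (lam j * r)\<^sup>2" for j r
    using eigenvalue_pos[of j] by (simp add: power_mult_distrib powr_numeral)
  have sp: "summable (\<lambda>j. (lam j * p j)\<^sup>2)" and sq: "summable (\<lambda>j. (lam j * q j)\<^sup>2)"
    using g unfolding Hdot_def h p_def q_def by auto
  have Np: "Hdot_norm \<Omega> lam \<phi> 2 g1 = sqrt (\<Sum>j. (lam j * p j)\<^sup>2)"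
    and Nq: "Hdot_norm \<Omega> lam \<phi> 2 g2 = sqrt (\<Sum>j. (lam j * q j)\<^sup>2)"
    unfolding Hdot_norm_def h p_def q_def by simp_all
  have C: "0 \<le> P / - D" using P D by (intro divide_nonneg_pos) auto
  note sa = l2_sequence_comparison[OF ac_le C sp sq]
  note sb = l2_sequence_comparison[OF bc_le C sq sp]
  note P0 = less_imp_le[OF P(1)]
  note up = l2_sequence_comparison(2)[OF p_le P0 sa(1) sb(1)]
  note uq = l2_sequence_comparison(2)[OF q_le P0 sa(1) sb(1)]
  note rf = riesz_fischer[OF eigenfunction_L2 eigenfunction_orthonormal convex_polyhedral_domainD(3)[OF dom]]
  obtain a where a: "l2_sums \<Omega> (\<lambda>j x. ac j * \<phi> j x) a" by (rule rf[OF sa(1)])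
  obtain b where b: "l2_sums \<Omega> (\<lambda>j x. bc j * \<phi> j x) b" by (rule rf[OF sb(1)])
  have ab: "a \<in> L2 \<Omega>" "b \<in> L2 \<Omega>" using a b by (auto simp: l2_sums_def l2_tendsto_def)
  have aj: "l2_inner \<Omega> a (\<phi> j) = ac j" and bj: "l2_inner \<Omega> b (\<phi> j) = bc j" for j
    by (rule l2_sums_coefficient[OF eigenfunction_L2 eigenfunction_orthonormal a],
        rule l2_sums_coefficient[OF eigenfunction_L2 eigenfunction_orthonormal b])
  have Na: "l2_norm \<Omega> a = sqrt (\<Sum>j. (ac j)\<^sup>2)" and Nb: "l2_norm \<Omega> b = sqrt (\<Sum>j. (bc j)\<^sup>2)"
    using l2_norm_coefficients[OF ab(1)] l2_norm_coefficients[OF ab(2)] by (simp_all add: aj bj)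
  note co = solution_coefficients[OF ab, unfolded aj bj, folded E_def F_def]
  show "\<exists>a\<in>L2 \<Omega>. \<exists>b\<in>L2 \<Omega>.
      solves_ibvp \<Omega> lam \<phi> \<alpha> T a b (solution \<Omega> lam \<phi> \<alpha> a b) \<and>
      (AE x in lebesgue_on \<Omega>. solution \<Omega> lam \<phi> \<alpha> a b T1 x = g1 x) \<and>
      (AE x in lebesgue_on \<Omega>. solution \<Omega> lam \<phi> \<alpha> a b T2 x = g2 x) \<and>
      1 / (4 * P) * (Hdot_norm \<Omega> lam \<phi> 2 g1 + Hdot_norm \<Omega> lam \<phi> 2 g2) \<le> l2_norm \<Omega> a + l2_norm \<Omega> b \<and>
      l2_norm \<Omega> a + l2_norm \<Omega> b \<le> 4 * (P / - D) * (Hdot_norm \<Omega> lam \<phi> 2 g1 + Hdot_norm \<Omega> lam \<phi> 2 g2)"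
  proof (rule bexI[OF bexI[OF _ ab(2)] ab(1)], intro conjI)
    show "solves_ibvp \<Omega> lam \<phi> \<alpha> T a b (solution \<Omega> lam \<phi> \<alpha> a b)"
      by (rule solution_solves_ibvp[OF ab]) (use T in linarith)
    show "AE x in lebesgue_on \<Omega>. solution \<Omega> lam \<phi> \<alpha> a b T1 x = g1 x"
      by (rule equal_coefficients_AE) (use co[of T1] solve(1) gL T in \<open>auto simp: p_def\<close>)
    show "AE x in lebesgue_on \<Omega>. solution \<Omega> lam \<phi> \<alpha> a b T2 x = g2 x"
      by (rule equal_coefficients_AE) (use co[of T2] solve(2) gL T in \<open>auto simp: q_def\<close>)
    \<comment> \<open>The 4 arises twice in the same way: a factor 2 from each comparison of
      sequences, and another 2 from adding the estimates for the two functions.\<close>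
    have "Hdot_norm \<Omega> lam \<phi> 2 g1 + Hdot_norm \<Omega> lam \<phi> 2 g2 \<le> 4 * P * (l2_norm \<Omega> a + l2_norm \<Omega> b)"
      using add_mono[OF up uq] by (simp add: Np Nq Na Nb algebra_simps)
    then show "1 / (4 * P) * (Hdot_norm \<Omega> lam \<phi> 2 g1 + Hdot_norm \<Omega> lam \<phi> 2 g2) \<le> l2_norm \<Omega> a + l2_norm \<Omega> b"
      using P(1) by (simp add: field_simps)
    show "l2_norm \<Omega> a + l2_norm \<Omega> b \<le> 4 * (P / - D) * (Hdot_norm \<Omega> lam \<phi> 2 g1 + Hdot_norm \<Omega> lam \<phi> 2 g2)"
      using add_mono[OF sa(2) sb(2)] unfolding Na Nb Np Nq by argo
  qed
qed

end

end

text \<open>The constants are expressions in \<alpha>, \<open>cstar\<close>, \<open>T1\<close>,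
  \<open>T2\<close> and \<open>K\<close>, chosen before any domain or threshold is given. At that
  stage neither the positivity of the times nor the sign of \<open>D\<close> is known; the default
  value 1 and the modulus of \<open>T2\<close> provide for this. Once a threshold is present, both
  conditions in the constants are true.\<close>

lemma two_time_recovery_constants:
  fixes \<alpha> cstar T1 T2 :: real
  assumes \<alpha>: "1 < \<alpha>" "\<alpha> < 2" and T: "T1 < T2"
    and K: "0 < K" "\<And>x. 0 \<le> x \<Longrightarrow> x * \<bar>mittag_leffler \<alpha> 1 (- x)\<bar> \<le> K" "\<And>x. 0 \<le> x \<Longrightarrow> x * \<bar>mittag_leffler \<alpha> 2 (- x)\<bar> \<le> K"
    and dom: "convex_polyhedral_domain \<Omega>" and sys: "dirichlet_eigensystem \<Omega> lam \<phi>"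
    and M: "psi_threshold \<alpha> cstar M" "M (lam 0) \<le> T1" and T': "T2 \<le> T"
  defines "P \<equiv> (1 + \<bar>T2\<bar>) * (K / T1 powr \<alpha> + K / T2 powr \<alpha>) "
    and "D \<equiv> cstar * (T2 - T1) / (Gamma (1 - \<alpha>) * Gamma (2 - \<alpha>)) / (T1 powr \<alpha> * T2 powr \<alpha>)"
  shows "two_time_recovery \<Omega> lam \<phi> \<alpha> T T1 T2 (if 0 < P then 1 / (4 * P) else 1) (if 0 < P / - D then 4 * (P / - D) else 1)"
proof -
  have \<alpha>0: "0 < \<alpha>" using \<alpha> by simp
  note up = psi_threshold_upward[OF \<alpha>0 M(1) eigenvalue_pos[OF dom sys] M(2) T, folded D_def]
  have p: "0 < K / T1 powr \<alpha>" "0 < K / T2 powr \<alpha>" using K(1) up(1) T by (auto intro!: divide_pos_pos)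
  have P: "0 < P" unfolding P_def using p by (intro mult_pos_pos add_pos_pos) auto
  have P': "(1 + T2) * (K / T1 powr \<alpha>) \<le> P" "(1 + T2) * (K / T2 powr \<alpha>) \<le> P"
    unfolding P_def using p by (intro mult_mono; simp)+
  have "0 < P / - D" using P up(2) by (intro divide_pos_pos) auto
  moreover have "two_time_recovery \<Omega> lam \<phi> \<alpha> T T1 T2 (1 / (4 * P)) (4 * (P / - D))"
    by (rule two_time_recovery_if_bounds[OF dom sys \<alpha> K(2,3) up(1) T T' up(2) up(3)[OF eigenvalue_ge[OF dom sys]] P P'])
  ultimately show ?thesis using P by (simp only: if_True)
qed

theorem theorem3p2:
  fixes \<alpha> cstar T1 T2 :: real
  assumes "1 < \<alpha>" "\<alpha> < 2" and "0 < cstar" and "T1 < T2"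
  shows "\<exists>c1>0. \<exists>c2>0.
    (\<forall>(\<Omega> :: (real^1) set) lam \<phi> M T.
        convex_polyhedral_domain \<Omega> \<and> dirichlet_eigensystem \<Omega> lam \<phi> \<and>
        psi_threshold \<alpha> cstar M \<and> M (lam 0) \<le> T1 \<and> T2 \<le> T \<longrightarrow>
        two_time_recovery \<Omega> lam \<phi> \<alpha> T T1 T2 c1 c2) \<and>
    (\<forall>(\<Omega> :: (real^2) set) lam \<phi> M T.
        convex_polyhedral_domain \<Omega> \<and> dirichlet_eigensystem \<Omega> lam \<phi> \<and>
        psi_threshold \<alpha> cstar M \<and> M (lam 0) \<le> T1 \<and> T2 \<le> T \<longrightarrow>
        two_time_recovery \<Omega> lam \<phi> \<alpha> T T1 T2 c1 c2) \<and>
    (\<forall>(\<Omega> :: (real^3) set) lam \<phi> M T.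
        convex_polyhedral_domain \<Omega> \<and> dirichlet_eigensystem \<Omega> lam \<phi> \<and>
        psi_threshold \<alpha> cstar M \<and> M (lam 0) \<le> T1 \<and> T2 \<le> T \<longrightarrow>
        two_time_recovery \<Omega> lam \<phi> \<alpha> T T1 T2 c1 c2)"
proof -
  obtain K1 where K1: "0 < K1" "\<And>x. 0 \<le> x \<Longrightarrow> x * \<bar>mittag_leffler \<alpha> 1 (- x)\<bar> \<le> K1"
    using mittag_leffler_decay[of \<alpha> 1] assms by auto
  obtain K2 where K2: "0 < K2" "\<And>x. 0 \<le> x \<Longrightarrow> x * \<bar>mittag_leffler \<alpha> 2 (- x)\<bar> \<le> K2"
    using mittag_leffler_decay[of \<alpha> 2] assms by auto
  \<comment> \<open>One decay constant for both functions, determined by \<alpha> alone.\<close>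
  define K where "K = K1 + K2"
  have K: "0 < K" "\<And>x. 0 \<le> x \<Longrightarrow> x * \<bar>mittag_leffler \<alpha> 1 (- x)\<bar> \<le> K" "\<And>x. 0 \<le> x \<Longrightarrow> x * \<bar>mittag_leffler \<alpha> 2 (- x)\<bar> \<le> K"
    using K1(1) K2(1) order_trans[OF K1(2), of _ K] order_trans[OF K2(2), of _ K] by (simp_all add: K_def)
  define P where "P = (1 + \<bar>T2\<bar>) * (K / T1 powr \<alpha> + K / T2 powr \<alpha>)"
  define D where "D = cstar * (T2 - T1) / (Gamma (1 - \<alpha>) * Gamma (2 - \<alpha>)) / (T1 powr \<alpha> * T2 powr \<alpha>)"
  note main = two_time_recovery_constants[OF assms(1,2,4) K, where cstar = cstar, folded P_def D_def]
  show ?thesis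
  proof (intro exI conjI)
    show "0 < (if 0 < P then 1 / (4 * P) else 1)" "0 < (if 0 < P / - D then 4 * (P / - D) else 1)"
      by (simp_all only: split: if_split) auto
  \<comment> \<open>The fact \<open>main\<close> is polymorphic in the underlying space, so the same
    constants serve all three dimensions.\<close>
  qed (intro allI impI; elim conjE; rule main; assumption)+
qed

end
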